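(* Let $(\mathscr{C},\mathbf{W})$ satisfy conditions (BF), and fix a set of choices $\mathrm{C}(\mathbf{W})$. Let $\underline f:=(A',w,f):A\to B$ and $\underline g^m:=(B^m,v^m,g^m):B\to C$ for $m=1,2$ be morphisms and $\Delta:\underline g^1\Rightarrow\underline g^2$ a 2-morphism in $\mathscr{C}[\mathbf{W}^{-1}]$. Fix any representative $(B^3,u^1,u^2,\alpha,\beta)$ for $\Delta$ (so $u^m:B^3\to B^m$, $\alpha:v^1\circ u^1\Rightarrow v^2\circ u^2$, $\beta:g^1\circ u^1\Rightarrow g^2\circ u^2$). Suppose that $\mathrm{C}(\mathbf{W})$ gives, for the pairs $(f,v^m)$, $m=1,2$, the data $(D^m,\ w^m:D^m\to A',\ f^m:D^m\to B^m,\ \rho^m:f\circ w^m\Rightarrow v^m\circ f^m)$ with $w^m$ in $\mathbf{W}$ and $\rho^m$ invertible (so that $\underline g^m\circ\underline f=(D^m,w\circ w^m,g^m\circ f^m)$). Fix any set of data in $\mathscr{C}$ as follows: (F5) objects $D^3,D^4$, morphisms $t^1:D^3\to D^1$ and $t^2:D^4\to D^2$ in $\mathbf{W}$, morphisms $h^1:D^3\to B^3$, $h^2:D^4\to B^3$, and invertible 2-morphisms $\sigma^1:f^1\circ t^1\Rightarrow u^1\circ h^1$, $\sigma^2:f^2\circ t^2\Rightarrow u^2\circ h^2$; (F6) an object $D^5$, a morphism $t^3:D^5\to D^3$ in $\mathbf{W}$, a morphism $t^4:D^5\to D^4$ and an invertible 2-morphism $\varphi:w^1\circ t^1\circ t^3\Rightarrow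 w^2\circ t^2\circ t^4$; (F7) an invertible 2-morphism $\delta:h^1\circ t^3\Rightarrow h^2\circ t^4$ such that $v^1\circ u^1\circ\delta$ equals $$(\alpha^{-1}\circ h^2\circ t^4)\bullet(v^2\circ\sigma^2\circ t^4)\bullet(\rho^2\circ t^2\circ t^4)\bullet(f\circ\varphi)\bullet((\rho^1)^{-1}\circ t^1\circ t^3)\bullet(v^1\circ(\sigma^1)^{-1}\circ t^3).$$ Then $\Delta\circ\underline f$ is represented by $(D^5,t^1\circ t^3,t^2\circ t^4,w\circ\varphi,\xi)$, where $$\xi:=(g^2\circ(\sigma^2)^{-1}\circ t^4)\bullet(\beta\circ h^2\circ t^4)\bullet(g^1\circ u^1\circ\delta)\bullet(g^1\circ\sigma^1\circ t^3).$$ Given any other representative for $\Delta$, and any other set of data as in (F5)–(F7), the quintuple induced by the new data represents the same 2-morphism.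
   Context: Conventions. $\mathscr{C}$ is a bicategory and $\mathbf{W}$ a class of 1-morphisms in it. $\circ$ denotes composition of 1-morphisms and whiskering; $\bullet$ denotes vertical composition of 2-morphisms of $\mathscr{C}$ ($\beta\bullet\alpha$ means first $\alpha$, then $\beta$). Associators and unitors of $\mathscr{C}$ are omitted from the notation, as if $\mathscr{C}$ were a 2-category (by coherence they can be inserted unambiguously); the statement is meant for arbitrary bicategories. Conditions (BF): (BF1) every $\mathrm{id}_A$ is in $\mathbf{W}$. (BF2) $\mathbf{W}$ is closed under composition. (BF3) For every $w:A\to B$ in $\mathbf{W}$ and every $f:C\to B$ there are an object $D$, $w':D\to C$ in $\mathbf{W}$, $f':D\to A$ and an invertible 2-morphism $f\circ w'\Rightarrow w\circ f'$. (BF4a) For every $w:B\to A$ in $\mathbf{W}$, $f^1,f^2:C\to B$ and $\alpha:w\circ f^1\Rightarrow w\circ f^2$ there are an object $D$, $v:D\to C$ in $\mathbf{W}$ and $\beta:f^1\circ v\Rightarrow f^2\circ v$ with $\alpha\circ v=w\circ\beta$. (BF4b) If $\alpha$ in (BF4a) is invertible, so is $\beta$. (BF4c) If $(D',v',\beta')$ is another triple with the same properties as $(D,v,\beta)$ in (BF4a), there are an object $E$, $u:E\to D$, $u':E\to D'$ and an invertible $\zeta:v\circ u\Rightarrow v'\circ u'$ with $v\circ u\in\mathbf{W}$ and $(\beta'\circ u')\bullet(f^1\circ\zeta)=(f^2\circ\zeta)\bullet(\beta\circ u)$. (BF5) If $w:A\to B$ is in $\mathbf{W}$ and there is an invertible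 $v\Rightarrow w$, then $v\in\mathbf{W}$. Choices. $\mathrm{C}(\mathbf{W})$: for every $f:A'\to B$ and $v:B'\to B$ in $\mathbf{W}$, a chosen $(A'',v',f',\rho)$ with $v':A''\to A'$ in $\mathbf{W}$, $f':A''\to B'$, $\rho:f\circ v'\Rightarrow v\circ f'$ invertible. $\mathrm{D}(\mathbf{W})$: for every $w:B\to A$ in $\mathbf{W}$, $f^1,f^2:C\to B$, $\alpha:w\circ f^1\Rightarrow w\circ f^2$, a chosen $v:D\to C$ in $\mathbf{W}$ and $\beta:f^1\circ v\Rightarrow f^2\circ v$ with $\alpha\circ v=w\circ\beta$. Bicategory of fractions $\mathscr{C}[\mathbf{W}^{-1}]$ (Pronk). Objects: those of $\mathscr{C}$. A morphism $A\to B$ is a triple $(A',w,f)$ with $w:A'\to A$ in $\mathbf{W}$, $f:A'\to B$. Composition: $(B',v,g)\circ(A',w,f):=(A'',w\circ v',g\circ f')$ with $(A'',v',f',\rho)$ the choice in $\mathrm{C}(\mathbf{W})$ for $(f,v)$. A 2-morphism $(A^1,w^1,f^1)\Rightarrow(A^2,w^2,f^2)$ (both $A\to B$) is an equivalence class of data (its representatives) $(A^3,v^1,v^2,\alpha,\beta)$ with $v^m:A^3\to A^m$, $w^1\circ v^1\in\mathbf{W}$, $\alpha:w^1\circ v^1\Rightarrow w^2\circ v^2$ invertible, $\beta:f^1\circ v^1\Rightarrow f^2\circ v^2$; $(A^3,v^1,v^2,\alpha,\beta)$ and $(A'^3,v'^1,v'^2,\alpha',\beta')$ are equivalent iff there are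 $z:A^4\to A^3$, $z':A^4\to A'^3$ and invertible $\sigma^1:v'^1\circ z'\Rightarrow v^1\circ z$, $\sigma^2:v^2\circ z\Rightarrow v'^2\circ z'$ with $w^1\circ v^1\circ z\in\mathbf{W}$, $(w^2\circ\sigma^2)\bullet(\alpha\circ z)\bullet(w^1\circ\sigma^1)=\alpha'\circ z'$ and $(f^2\circ\sigma^2)\bullet(\beta\circ z)\bullet(f^1\circ\sigma^1)=\beta'\circ z'$. In Pronk's construction the composition $\Delta\circ\underline f:\underline g^1\circ\underline f\Rightarrow\underline g^2\circ\underline f$ is defined as the class of the quintuple of the claim for any representative of $\Delta$ and for one particular set of data (F5)–(F7), selected by means of the fixed choices $\mathrm{C}(\mathbf{W})$ and $\mathrm{D}(\mathbf{W})$; by Pronk, the result does not depend on the representative used. *)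

theory Defs
  imports Main
begin

section \<open>Bicategories\<close>

text \<open>
  A bicategory is given by carrier sets of objects, 1-morphisms and 2-morphisms inside three
  types. Values of the operations outside the carriers, or on non-composable arguments, are
  irrelevant. \<open>g \<star> f\<close> is ``first \<open>f\<close>, then \<open>g\<close>'', and \<open>\<beta> \<bullet> \<alpha>\<close> is ``first \<open>\<alpha>\<close>, then \<open>\<beta>\<close>''.
\<close>

record ('o, 'm, 't) bicategory_data =
  Obj :: "'o set"
  Arr :: "'m set"
  Cell :: "'t set"
  Src :: "'m \<Rightarrow> 'o"
  Trg :: "'m \<Rightarrow> 'o"
  Dom :: "'t \<Rightarrow> 'm"
  Cod :: "'t \<Rightarrow> 'm"
  Id1 :: "'o \<Rightarrow> 'm"
  Id2 :: "'m \<Rightarrow> 't"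
  Comp :: "'m \<Rightarrow> 'm \<Rightarrow> 'm"  (infixr \<open>\<star>\<index>\<close> 75)
  VComp :: "'t \<Rightarrow> 't \<Rightarrow> 't"  (infixr \<open>\<bullet>\<index>\<close> 65)
  HComp :: "'t \<Rightarrow> 't \<Rightarrow> 't"
  Assoc :: "'m \<Rightarrow> 'm \<Rightarrow> 'm \<Rightarrow> 't"
  LUnit :: "'m \<Rightarrow> 't"
  RUnit :: "'m \<Rightarrow> 't"

definition Hom1 :: "('o, 'm, 't, 'x) bicategory_data_scheme \<Rightarrow> 'o \<Rightarrow> 'o \<Rightarrow> 'm set" where
  "Hom1 \<C> A B = {f \<in> Arr \<C>. Src \<C> f = A \<and> Trg \<C> f = B}"

definition Hom2 :: "('o, 'm, 't, 'x) bicategory_data_scheme \<Rightarrow> 'm \<Rightarrow> 'm \<Rightarrow> 't set" where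
  "Hom2 \<C> f g = {\<alpha> \<in> Cell \<C>. Dom \<C> \<alpha> = f \<and> Cod \<C> \<alpha> = g}"

definition inverse2 ::
  "('o, 'm, 't, 'x) bicategory_data_scheme \<Rightarrow> 't \<Rightarrow> 't \<Rightarrow> bool" where
  "inverse2 \<C> \<alpha> \<beta> \<longleftrightarrow> \<beta> \<in> Hom2 \<C> (Cod \<C> \<alpha>) (Dom \<C> \<alpha>) \<and>
     \<beta> \<bullet>\<^bsub>\<C>\<^esub> \<alpha> = Id2 \<C> (Dom \<C> \<alpha>) \<and> \<alpha> \<bullet>\<^bsub>\<C>\<^esub> \<beta> = Id2 \<C> (Cod \<C> \<alpha>)"

definition Iso2 :: "('o, 'm, 't, 'x) bicategory_data_scheme \<Rightarrow> 'm \<Rightarrow> 'm \<Rightarrow> 't set" where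
  "Iso2 \<C> f g = {\<alpha> \<in> Hom2 \<C> f g. \<exists>\<beta>. inverse2 \<C> \<alpha> \<beta>}"

definition Inv2 :: "('o, 'm, 't, 'x) bicategory_data_scheme \<Rightarrow> 't \<Rightarrow> 't" where
  "Inv2 \<C> \<alpha> = (THE \<beta>. inverse2 \<C> \<alpha> \<beta>)"

definition LWhisk :: "('o, 'm, 't, 'x) bicategory_data_scheme \<Rightarrow> 'm \<Rightarrow> 't \<Rightarrow> 't"
    (infixr \<open>\<triangleleft>\<index>\<close> 75) where
  "g \<triangleleft>\<^bsub>\<C>\<^esub> \<alpha> = HComp \<C> (Id2 \<C> g) \<alpha>"

definition RWhisk :: "('o, 'm, 't, 'x) bicategory_data_scheme \<Rightarrow> 't \<Rightarrow> 'm \<Rightarrow> 't"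
    (infixl \<open>\<triangleright>\<index>\<close> 75) where
  "\<alpha> \<triangleright>\<^bsub>\<C>\<^esub> f = HComp \<C> \<alpha> (Id2 \<C> f)"

locale bicategory =
  fixes \<C> :: "('o, 'm, 't, 'x) bicategory_data_scheme" (structure)
  assumes Src_Obj: "f \<in> Arr \<C> \<Longrightarrow> Src \<C> f \<in> Obj \<C>"
    and Trg_Obj: "f \<in> Arr \<C> \<Longrightarrow> Trg \<C> f \<in> Obj \<C>"
    and Dom_Arr: "\<alpha> \<in> Cell \<C> \<Longrightarrow> Dom \<C> \<alpha> \<in> Arr \<C>"
    and Cod_Arr: "\<alpha> \<in> Cell \<C> \<Longrightarrow> Cod \<C> \<alpha> \<in> Arr \<C>"
    and Src_Dom: "\<alpha> \<in> Cell \<C> \<Longrightarrow> Src \<C> (Dom \<C> \<alpha>) = Src \<C> (Cod \<C> \<alpha>)"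
    and Trg_Dom: "\<alpha> \<in> Cell \<C> \<Longrightarrow> Trg \<C> (Dom \<C> \<alpha>) = Trg \<C> (Cod \<C> \<alpha>)"
    and Id1_Hom1: "A \<in> Obj \<C> \<Longrightarrow> Id1 \<C> A \<in> Hom1 \<C> A A"
    and Comp_Hom1: "\<lbrakk>f \<in> Hom1 \<C> A B; g \<in> Hom1 \<C> B E\<rbrakk> \<Longrightarrow> g \<star> f \<in> Hom1 \<C> A E"
    and Id2_Hom2: "f \<in> Arr \<C> \<Longrightarrow> Id2 \<C> f \<in> Hom2 \<C> f f"
    and VComp_Hom2: "\<lbrakk>\<alpha> \<in> Hom2 \<C> f g; \<beta> \<in> Hom2 \<C> g h\<rbrakk> \<Longrightarrow> \<beta> \<bullet> \<alpha> \<in> Hom2 \<C> f h"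
    and VComp_Id2_right: "\<alpha> \<in> Hom2 \<C> f g \<Longrightarrow> \<alpha> \<bullet> Id2 \<C> f = \<alpha>"
    and VComp_Id2_left: "\<alpha> \<in> Hom2 \<C> f g \<Longrightarrow> Id2 \<C> g \<bullet> \<alpha> = \<alpha>"
    and VComp_assoc: "\<lbrakk>\<alpha> \<in> Hom2 \<C> f g; \<beta> \<in> Hom2 \<C> g h; \<gamma> \<in> Hom2 \<C> h k\<rbrakk>
          \<Longrightarrow> (\<gamma> \<bullet> \<beta>) \<bullet> \<alpha> = \<gamma> \<bullet> (\<beta> \<bullet> \<alpha>)"
    and HComp_Hom2: "\<lbrakk>f \<in> Hom1 \<C> A B; g \<in> Hom1 \<C> B E; \<alpha> \<in> Hom2 \<C> f f'; \<beta> \<in> Hom2 \<C> g g'\<rbrakk>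
          \<Longrightarrow> HComp \<C> \<beta> \<alpha> \<in> Hom2 \<C> (g \<star> f) (g' \<star> f')"
    and HComp_Id2: "\<lbrakk>f \<in> Hom1 \<C> A B; g \<in> Hom1 \<C> B E\<rbrakk>
          \<Longrightarrow> HComp \<C> (Id2 \<C> g) (Id2 \<C> f) = Id2 \<C> (g \<star> f)"
    and interchange: "\<lbrakk>f \<in> Hom1 \<C> A B; g \<in> Hom1 \<C> B E;
            \<alpha> \<in> Hom2 \<C> f f'; \<alpha>' \<in> Hom2 \<C> f' f''; \<beta> \<in> Hom2 \<C> g g'; \<beta>' \<in> Hom2 \<C> g' g''\<rbrakk>
          \<Longrightarrow> HComp \<C> (\<beta>' \<bullet> \<beta>) (\<alpha>' \<bullet> \<alpha>) = HComp \<C> \<beta>' \<alpha>' \<bullet> HComp \<C> \<beta> \<alpha>"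
    and Assoc_Iso2: "\<lbrakk>f \<in> Hom1 \<C> A B; g \<in> Hom1 \<C> B E; h \<in> Hom1 \<C> E F\<rbrakk>
          \<Longrightarrow> Assoc \<C> h g f \<in> Iso2 \<C> ((h \<star> g) \<star> f) (h \<star> (g \<star> f))"
    and Assoc_natural: "\<lbrakk>f \<in> Hom1 \<C> A B; g \<in> Hom1 \<C> B E; h \<in> Hom1 \<C> E F;
            \<alpha> \<in> Hom2 \<C> f f'; \<beta> \<in> Hom2 \<C> g g'; \<gamma> \<in> Hom2 \<C> h h'\<rbrakk>
          \<Longrightarrow> Assoc \<C> h' g' f' \<bullet> HComp \<C> (HComp \<C> \<gamma> \<beta>) \<alpha>
              = HComp \<C> \<gamma> (HComp \<C> \<beta> \<alpha>) \<bullet> Assoc \<C> h g f"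
    and LUnit_Iso2: "f \<in> Hom1 \<C> A B \<Longrightarrow> LUnit \<C> f \<in> Iso2 \<C> (Id1 \<C> B \<star> f) f"
    and LUnit_natural: "\<lbrakk>f \<in> Hom1 \<C> A B; \<alpha> \<in> Hom2 \<C> f f'\<rbrakk>
          \<Longrightarrow> LUnit \<C> f' \<bullet> (Id1 \<C> B \<triangleleft> \<alpha>) = \<alpha> \<bullet> LUnit \<C> f"
    and RUnit_Iso2: "f \<in> Hom1 \<C> A B \<Longrightarrow> RUnit \<C> f \<in> Iso2 \<C> (f \<star> Id1 \<C> A) f"
    and RUnit_natural: "\<lbrakk>f \<in> Hom1 \<C> A B; \<alpha> \<in> Hom2 \<C> f f'\<rbrakk>
          \<Longrightarrow> RUnit \<C> f' \<bullet> (\<alpha> \<triangleright> Id1 \<C> A) = \<alpha> \<bullet> RUnit \<C> f"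
    and pentagon: "\<lbrakk>f \<in> Hom1 \<C> A B; g \<in> Hom1 \<C> B E; h \<in> Hom1 \<C> E F; k \<in> Hom1 \<C> F G\<rbrakk>
          \<Longrightarrow> (k \<triangleleft> Assoc \<C> h g f) \<bullet> Assoc \<C> k (h \<star> g) f \<bullet> (Assoc \<C> k h g \<triangleright> f)
              = Assoc \<C> k h (g \<star> f) \<bullet> Assoc \<C> (k \<star> h) g f"
    and triangle: "\<lbrakk>f \<in> Hom1 \<C> A B; g \<in> Hom1 \<C> B E\<rbrakk>
          \<Longrightarrow> (g \<triangleleft> LUnit \<C> f) \<bullet> Assoc \<C> g (Id1 \<C> B) f = RUnit \<C> g \<triangleright> f"

text \<open>
  Convention for the associators suppressed in the informal notation: an unbracketed composite of
  1-morphisms is bracketed to the right. The following operation is the right whiskering of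
  \<open>\<theta> : x \<circ> y \<Rightarrow> x' \<circ> y'\<close> by \<open>t\<close>, rebracketed to \<open>x \<circ> (y \<circ> t) \<Rightarrow> x' \<circ> (y' \<circ> t)\<close>. The factors
  are arguments because they are not determined by the composites.
\<close>

definition RW :: "('o, 'm, 't, 'x) bicategory_data_scheme \<Rightarrow>
    'm \<Rightarrow> 'm \<Rightarrow> 'm \<Rightarrow> 'm \<Rightarrow> 't \<Rightarrow> 'm \<Rightarrow> 't" where
  "RW \<C> x y x' y' \<theta> t =
     Assoc \<C> x' y' t \<bullet>\<^bsub>\<C>\<^esub> (\<theta> \<triangleright>\<^bsub>\<C>\<^esub> t) \<bullet>\<^bsub>\<C>\<^esub> Inv2 \<C> (Assoc \<C> x y t)"


section \<open>Conditions (BF) and the choices C(W), D(W)\<close>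

text \<open>Tuples \<open>(D, v', f', \<rho>)\<close> as in (BF3), for \<open>v\<close> in \<open>\<W>\<close> and \<open>f\<close> with the same target.\<close>

definition fillers :: "('o, 'm, 't, 'x) bicategory_data_scheme \<Rightarrow> 'm set \<Rightarrow> 'm \<Rightarrow> 'm \<Rightarrow>
    ('o \<times> 'm \<times> 'm \<times> 't) set" where
  "fillers \<C> \<W> f v = {(D, v', f', \<rho>).
     v' \<in> Hom1 \<C> D (Src \<C> f) \<and> v' \<in> \<W> \<and> f' \<in> Hom1 \<C> D (Src \<C> v) \<and>
     \<rho> \<in> Iso2 \<C> (f \<star>\<^bsub>\<C>\<^esub> v') (v \<star>\<^bsub>\<C>\<^esub> f')}"

text \<open>Triples \<open>(D, v, \<beta>)\<close> as in (BF4a), for \<open>\<alpha> : w \<circ> f1 \<Rightarrow> w \<circ> f2\<close>.\<close>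

definition lifts :: "('o, 'm, 't, 'x) bicategory_data_scheme \<Rightarrow> 'm set \<Rightarrow>
    'm \<Rightarrow> 'm \<Rightarrow> 'm \<Rightarrow> 't \<Rightarrow> ('o \<times> 'm \<times> 't) set" where
  "lifts \<C> \<W> w f1 f2 \<alpha> = {(D, v, \<beta>).
     v \<in> Hom1 \<C> D (Src \<C> f1) \<and> v \<in> \<W> \<and> \<beta> \<in> Hom2 \<C> (f1 \<star>\<^bsub>\<C>\<^esub> v) (f2 \<star>\<^bsub>\<C>\<^esub> v) \<and>
     RW \<C> w f1 w f2 \<alpha> v = w \<triangleleft>\<^bsub>\<C>\<^esub> \<beta>}"

locale BF = bicategory \<C>
  for \<C> :: "('o, 'm, 't, 'x) bicategory_data_scheme" (structure) +
  fixes \<W> :: "'m set"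
  assumes W_Arr: "\<W> \<subseteq> Arr \<C>"
    and BF1: "A \<in> Obj \<C> \<Longrightarrow> Id1 \<C> A \<in> \<W>"
    and BF2: "\<lbrakk>f \<in> Hom1 \<C> A B; g \<in> Hom1 \<C> B E; f \<in> \<W>; g \<in> \<W>\<rbrakk> \<Longrightarrow> g \<star> f \<in> \<W>"
    and BF3: "\<lbrakk>w \<in> Hom1 \<C> A B; w \<in> \<W>; f \<in> Hom1 \<C> E B\<rbrakk> \<Longrightarrow> fillers \<C> \<W> f w \<noteq> {}"
    and BF4a: "\<lbrakk>w \<in> Hom1 \<C> B A; w \<in> \<W>; f1 \<in> Hom1 \<C> E B; f2 \<in> Hom1 \<C> E B;
            \<alpha> \<in> Hom2 \<C> (w \<star> f1) (w \<star> f2)\<rbrakk> \<Longrightarrow> lifts \<C> \<W> w f1 f2 \<alpha> \<noteq> {}"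
    and BF4b: "\<lbrakk>w \<in> Hom1 \<C> B A; w \<in> \<W>; f1 \<in> Hom1 \<C> E B; f2 \<in> Hom1 \<C> E B;
            \<alpha> \<in> Iso2 \<C> (w \<star> f1) (w \<star> f2); (D, v, \<beta>) \<in> lifts \<C> \<W> w f1 f2 \<alpha>\<rbrakk>
          \<Longrightarrow> \<beta> \<in> Iso2 \<C> (f1 \<star> v) (f2 \<star> v)"
    and BF4c: "\<lbrakk>w \<in> Hom1 \<C> B A; w \<in> \<W>; f1 \<in> Hom1 \<C> E B; f2 \<in> Hom1 \<C> E B;
            \<alpha> \<in> Hom2 \<C> (w \<star> f1) (w \<star> f2);
            (D, v, \<beta>) \<in> lifts \<C> \<W> w f1 f2 \<alpha>; (D', v', \<beta>') \<in> lifts \<C> \<W> w f1 f2 \<alpha>\<rbrakk>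
          \<Longrightarrow> \<exists>F u u' \<zeta>. u \<in> Hom1 \<C> F D \<and> u' \<in> Hom1 \<C> F D' \<and>
                \<zeta> \<in> Iso2 \<C> (v \<star> u) (v' \<star> u') \<and> v \<star> u \<in> \<W> \<and>
                RW \<C> f1 v' f2 v' \<beta>' u' \<bullet> (f1 \<triangleleft> \<zeta>) = (f2 \<triangleleft> \<zeta>) \<bullet> RW \<C> f1 v f2 v \<beta> u"
    and BF5: "\<lbrakk>w \<in> \<W>; v \<in> Arr \<C>; \<alpha> \<in> Iso2 \<C> v w\<rbrakk> \<Longrightarrow> v \<in> \<W>"

definition C_choices :: "('o, 'm, 't, 'x) bicategory_data_scheme \<Rightarrow> 'm set \<Rightarrow>
    ('m \<Rightarrow> 'm \<Rightarrow> 'o \<times> 'm \<times> 'm \<times> 't) \<Rightarrow> bool" where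
  "C_choices \<C> \<W> CW \<longleftrightarrow>
     (\<forall>A B E f v. f \<in> Hom1 \<C> A B \<longrightarrow> v \<in> Hom1 \<C> E B \<longrightarrow> v \<in> \<W> \<longrightarrow> CW f v \<in> fillers \<C> \<W> f v)"

definition D_choices :: "('o, 'm, 't, 'x) bicategory_data_scheme \<Rightarrow> 'm set \<Rightarrow>
    ('m \<Rightarrow> 'm \<Rightarrow> 'm \<Rightarrow> 't \<Rightarrow> 'o \<times> 'm \<times> 't) \<Rightarrow> bool" where
  "D_choices \<C> \<W> DW \<longleftrightarrow>
     (\<forall>A B E w f1 f2 \<alpha>. w \<in> Hom1 \<C> B A \<longrightarrow> w \<in> \<W> \<longrightarrow> f1 \<in> Hom1 \<C> E B \<longrightarrow> f2 \<in> Hom1 \<C> E B \<longrightarrow>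
        \<alpha> \<in> Hom2 \<C> (w \<star>\<^bsub>\<C>\<^esub> f1) (w \<star>\<^bsub>\<C>\<^esub> f2) \<longrightarrow> DW w f1 f2 \<alpha> \<in> lifts \<C> \<W> w f1 f2 \<alpha>)"


section \<open>The bicategory of fractions: morphisms and 2-morphisms\<close>

type_synonym ('o, 'm) frac = "'o \<times> 'm \<times> 'm"
type_synonym ('o, 'm, 't) frac_rep = "'o \<times> 'm \<times> 'm \<times> 't \<times> 't"

definition frac_hom :: "('o, 'm, 't, 'x) bicategory_data_scheme \<Rightarrow> 'm set \<Rightarrow>
    'o \<Rightarrow> 'o \<Rightarrow> ('o, 'm) frac set" where
  "frac_hom \<C> \<W> A B = {(A', w, f). w \<in> Hom1 \<C> A' A \<and> w \<in> \<W> \<and> f \<in> Hom1 \<C> A' B}"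

fun frac_comp :: "('o, 'm, 't, 'x) bicategory_data_scheme \<Rightarrow>
    ('m \<Rightarrow> 'm \<Rightarrow> 'o \<times> 'm \<times> 'm \<times> 't) \<Rightarrow> ('o, 'm) frac \<Rightarrow> ('o, 'm) frac \<Rightarrow> ('o, 'm) frac" where
  "frac_comp \<C> CW (B', v, g) (A', w, f) =
     (case CW f v of (A'', v', f', \<rho>) \<Rightarrow> (A'', w \<star>\<^bsub>\<C>\<^esub> v', g \<star>\<^bsub>\<C>\<^esub> f'))"

fun frac_reps :: "('o, 'm, 't, 'x) bicategory_data_scheme \<Rightarrow> 'm set \<Rightarrow>
    ('o, 'm) frac \<Rightarrow> ('o, 'm) frac \<Rightarrow> ('o, 'm, 't) frac_rep set" where
  "frac_reps \<C> \<W> (A1, w1, f1) (A2, w2, f2) = {(A3, v1, v2, \<alpha>, \<beta>).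
     v1 \<in> Hom1 \<C> A3 A1 \<and> v2 \<in> Hom1 \<C> A3 A2 \<and> w1 \<star>\<^bsub>\<C>\<^esub> v1 \<in> \<W> \<and>
     \<alpha> \<in> Iso2 \<C> (w1 \<star>\<^bsub>\<C>\<^esub> v1) (w2 \<star>\<^bsub>\<C>\<^esub> v2) \<and> \<beta> \<in> Hom2 \<C> (f1 \<star>\<^bsub>\<C>\<^esub> v1) (f2 \<star>\<^bsub>\<C>\<^esub> v2)}"

fun frac_equiv :: "('o, 'm, 't, 'x) bicategory_data_scheme \<Rightarrow> 'm set \<Rightarrow>
    ('o, 'm) frac \<Rightarrow> ('o, 'm) frac \<Rightarrow> ('o, 'm, 't) frac_rep rel" where
  "frac_equiv \<C> \<W> (A1, w1, f1) (A2, w2, f2) =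
     {((A3, v1, v2, \<alpha>, \<beta>), (A3', v1', v2', \<alpha>', \<beta>')).
        (A3, v1, v2, \<alpha>, \<beta>) \<in> frac_reps \<C> \<W> (A1, w1, f1) (A2, w2, f2) \<and>
        (A3', v1', v2', \<alpha>', \<beta>') \<in> frac_reps \<C> \<W> (A1, w1, f1) (A2, w2, f2) \<and>
        (\<exists>A4 z z' \<sigma>1 \<sigma>2.
           z \<in> Hom1 \<C> A4 A3 \<and> z' \<in> Hom1 \<C> A4 A3' \<and>
           \<sigma>1 \<in> Iso2 \<C> (v1' \<star>\<^bsub>\<C>\<^esub> z') (v1 \<star>\<^bsub>\<C>\<^esub> z) \<and> \<sigma>2 \<in> Iso2 \<C> (v2 \<star>\<^bsub>\<C>\<^esub> z) (v2' \<star>\<^bsub>\<C>\<^esub> z') \<and>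
           w1 \<star>\<^bsub>\<C>\<^esub> (v1 \<star>\<^bsub>\<C>\<^esub> z) \<in> \<W> \<and>
           (w2 \<triangleleft>\<^bsub>\<C>\<^esub> \<sigma>2) \<bullet>\<^bsub>\<C>\<^esub> RW \<C> w1 v1 w2 v2 \<alpha> z \<bullet>\<^bsub>\<C>\<^esub> (w1 \<triangleleft>\<^bsub>\<C>\<^esub> \<sigma>1)
             = RW \<C> w1 v1' w2 v2' \<alpha>' z' \<and>
           (f2 \<triangleleft>\<^bsub>\<C>\<^esub> \<sigma>2) \<bullet>\<^bsub>\<C>\<^esub> RW \<C> f1 v1 f2 v2 \<beta> z \<bullet>\<^bsub>\<C>\<^esub> (f1 \<triangleleft>\<^bsub>\<C>\<^esub> \<sigma>1)
             = RW \<C> f1 v1' f2 v2' \<beta>' z')}"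

definition frac_class :: "('o, 'm, 't, 'x) bicategory_data_scheme \<Rightarrow> 'm set \<Rightarrow>
    ('o, 'm) frac \<Rightarrow> ('o, 'm) frac \<Rightarrow> ('o, 'm, 't) frac_rep \<Rightarrow> ('o, 'm, 't) frac_rep set" where
  "frac_class \<C> \<W> F G r = frac_equiv \<C> \<W> F G `` {r}"

definition frac_2hom :: "('o, 'm, 't, 'x) bicategory_data_scheme \<Rightarrow> 'm set \<Rightarrow>
    ('o, 'm) frac \<Rightarrow> ('o, 'm) frac \<Rightarrow> ('o, 'm, 't) frac_rep set set" where
  "frac_2hom \<C> \<W> F G = frac_reps \<C> \<W> F G // frac_equiv \<C> \<W> F G"


section \<open>Composition of a 2-morphism with a morphism\<close>

text \<open>A system of data (F5), (F6), (F7), in the order in which the data are introduced.\<close>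

type_synonym ('o, 'm, 't) F_data =
  "'o \<times> 'o \<times> 'm \<times> 'm \<times> 'm \<times> 'm \<times> 't \<times> 't \<times> 'o \<times> 'm \<times> 'm \<times> 't \<times> 't"

text \<open>
  The composite \<open>v1 \<circ> u1 \<circ> h1 \<circ> t3 \<Rightarrow> v1 \<circ> u1 \<circ> h2 \<circ> t4\<close> to which (F7) equates \<open>v1 \<circ> u1 \<circ> \<delta>\<close>.
\<close>

definition F7_cell :: "('o, 'm, 't, 'x) bicategory_data_scheme \<Rightarrow> 'm \<Rightarrow> 'm \<Rightarrow> 'm \<Rightarrow>
    'm \<Rightarrow> 'm \<Rightarrow> 't \<Rightarrow> 'm \<Rightarrow> 'm \<Rightarrow> 't \<Rightarrow> 'm \<Rightarrow> 'm \<Rightarrow> 't \<Rightarrow>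
    'm \<Rightarrow> 'm \<Rightarrow> 'm \<Rightarrow> 'm \<Rightarrow> 't \<Rightarrow> 't \<Rightarrow> 'm \<Rightarrow> 'm \<Rightarrow> 't \<Rightarrow> 't" where
  "F7_cell \<C> f v1 v2 u1 u2 \<alpha> w1 f1 \<rho>1 w2 f2 \<rho>2 t1 t2 h1 h2 \<sigma>1 \<sigma>2 t3 t4 \<phi> =
     RW \<C> v2 u2 v1 u1 (Inv2 \<C> \<alpha>) (h2 \<star>\<^bsub>\<C>\<^esub> t4)
     \<bullet>\<^bsub>\<C>\<^esub> (v2 \<triangleleft>\<^bsub>\<C>\<^esub> RW \<C> f2 t2 u2 h2 \<sigma>2 t4)
     \<bullet>\<^bsub>\<C>\<^esub> RW \<C> f w2 v2 f2 \<rho>2 (t2 \<star>\<^bsub>\<C>\<^esub> t4)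
     \<bullet>\<^bsub>\<C>\<^esub> (f \<triangleleft>\<^bsub>\<C>\<^esub> \<phi>)
     \<bullet>\<^bsub>\<C>\<^esub> RW \<C> v1 f1 f w1 (Inv2 \<C> \<rho>1) (t1 \<star>\<^bsub>\<C>\<^esub> t3)
     \<bullet>\<^bsub>\<C>\<^esub> (v1 \<triangleleft>\<^bsub>\<C>\<^esub> RW \<C> u1 h1 f1 t1 (Inv2 \<C> \<sigma>1) t3)"

fun F567 :: "('o, 'm, 't, 'x) bicategory_data_scheme \<Rightarrow> 'm set \<Rightarrow>
    ('m \<Rightarrow> 'm \<Rightarrow> 'o \<times> 'm \<times> 'm \<times> 't) \<Rightarrow>
    ('o, 'm) frac \<Rightarrow> ('o, 'm) frac \<Rightarrow> ('o, 'm) frac \<Rightarrow> ('o, 'm, 't) frac_rep \<Rightarrow>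
    ('o, 'm, 't) F_data set" where
  "F567 \<C> \<W> CW (A', w, f) (B1, v1, g1) (B2, v2, g2) (B3, u1, u2, \<alpha>, \<beta>) =
     (let (D1, w1, f1, \<rho>1) = CW f v1; (D2, w2, f2, \<rho>2) = CW f v2 in
      {(D3, D4, t1, t2, h1, h2, \<sigma>1, \<sigma>2, D5, t3, t4, \<phi>, \<delta>).
         t1 \<in> Hom1 \<C> D3 D1 \<and> t1 \<in> \<W> \<and> t2 \<in> Hom1 \<C> D4 D2 \<and> t2 \<in> \<W> \<and>
         h1 \<in> Hom1 \<C> D3 B3 \<and> h2 \<in> Hom1 \<C> D4 B3 \<and>
         \<sigma>1 \<in> Iso2 \<C> (f1 \<star>\<^bsub>\<C>\<^esub> t1) (u1 \<star>\<^bsub>\<C>\<^esub> h1) \<and> \<sigma>2 \<in> Iso2 \<C> (f2 \<star>\<^bsub>\<C>\<^esub> t2) (u2 \<star>\<^bsub>\<C>\<^esub> h2) \<and>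
         t3 \<in> Hom1 \<C> D5 D3 \<and> t3 \<in> \<W> \<and> t4 \<in> Hom1 \<C> D5 D4 \<and>
         \<phi> \<in> Iso2 \<C> (w1 \<star>\<^bsub>\<C>\<^esub> (t1 \<star>\<^bsub>\<C>\<^esub> t3)) (w2 \<star>\<^bsub>\<C>\<^esub> (t2 \<star>\<^bsub>\<C>\<^esub> t4)) \<and>
         \<delta> \<in> Iso2 \<C> (h1 \<star>\<^bsub>\<C>\<^esub> t3) (h2 \<star>\<^bsub>\<C>\<^esub> t4) \<and>
         v1 \<triangleleft>\<^bsub>\<C>\<^esub> (u1 \<triangleleft>\<^bsub>\<C>\<^esub> \<delta>) =
           F7_cell \<C> f v1 v2 u1 u2 \<alpha> w1 f1 \<rho>1 w2 f2 \<rho>2 t1 t2 h1 h2 \<sigma>1 \<sigma>2 t3 t4 \<phi>})"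

text \<open>
  The quintuple \<open>(D5, t1 \<circ> t3, t2 \<circ> t4, w \<circ> \<phi>, \<xi>)\<close>. As a representative of a 2-morphism
  \<open>(D1, w \<circ> w1, g1 \<circ> f1) \<Rightarrow> (D2, w \<circ> w2, g2 \<circ> f2)\<close>, its 2-morphism components have sources
  \<open>(w \<circ> w1) \<circ> (t1 \<circ> t3)\<close> and \<open>(g1 \<circ> f1) \<circ> (t1 \<circ> t3)\<close>, and similarly for the targets; this explains
  the outermost associators.
\<close>

fun induced_rep :: "('o, 'm, 't, 'x) bicategory_data_scheme \<Rightarrow>
    ('m \<Rightarrow> 'm \<Rightarrow> 'o \<times> 'm \<times> 'm \<times> 't) \<Rightarrow>
    ('o, 'm) frac \<Rightarrow> ('o, 'm) frac \<Rightarrow> ('o, 'm) frac \<Rightarrow> ('o, 'm, 't) frac_rep \<Rightarrow>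
    ('o, 'm, 't) F_data \<Rightarrow> ('o, 'm, 't) frac_rep" where
  "induced_rep \<C> CW (A', w, f) (B1, v1, g1) (B2, v2, g2) (B3, u1, u2, \<alpha>, \<beta>)
      (D3, D4, t1, t2, h1, h2, \<sigma>1, \<sigma>2, D5, t3, t4, \<phi>, \<delta>) =
     (let (D1, w1, f1, \<rho>1) = CW f v1; (D2, w2, f2, \<rho>2) = CW f v2;
          \<xi> = (g2 \<triangleleft>\<^bsub>\<C>\<^esub> RW \<C> u2 h2 f2 t2 (Inv2 \<C> \<sigma>2) t4)
              \<bullet>\<^bsub>\<C>\<^esub> RW \<C> g1 u1 g2 u2 \<beta> (h2 \<star>\<^bsub>\<C>\<^esub> t4)
              \<bullet>\<^bsub>\<C>\<^esub> (g1 \<triangleleft>\<^bsub>\<C>\<^esub> (u1 \<triangleleft>\<^bsub>\<C>\<^esub> \<delta>))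
              \<bullet>\<^bsub>\<C>\<^esub> (g1 \<triangleleft>\<^bsub>\<C>\<^esub> RW \<C> f1 t1 u1 h1 \<sigma>1 t3)
      in (D5, t1 \<star>\<^bsub>\<C>\<^esub> t3, t2 \<star>\<^bsub>\<C>\<^esub> t4,
          Inv2 \<C> (Assoc \<C> w w2 (t2 \<star>\<^bsub>\<C>\<^esub> t4)) \<bullet>\<^bsub>\<C>\<^esub> (w \<triangleleft>\<^bsub>\<C>\<^esub> \<phi>) \<bullet>\<^bsub>\<C>\<^esub> Assoc \<C> w w1 (t1 \<star>\<^bsub>\<C>\<^esub> t3),
          Inv2 \<C> (Assoc \<C> g2 f2 (t2 \<star>\<^bsub>\<C>\<^esub> t4)) \<bullet>\<^bsub>\<C>\<^esub> \<xi> \<bullet>\<^bsub>\<C>\<^esub> Assoc \<C> g1 f1 (t1 \<star>\<^bsub>\<C>\<^esub> t3)))"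

text \<open>
  The selection of data (F5)--(F7) by means of the choices C(W) and D(W). It is one of several possible
  selections; the composition below does not depend on it.
  (F5): since \<open>v \<circ> u\<close> is in \<open>\<W>\<close>, C(W) applies to \<open>(v \<circ> f', v \<circ> u)\<close>; then D(W) cancels \<open>v\<close>.
\<close>

definition select_F5 :: "('o, 'm, 't, 'x) bicategory_data_scheme \<Rightarrow>
    ('m \<Rightarrow> 'm \<Rightarrow> 'o \<times> 'm \<times> 'm \<times> 't) \<Rightarrow> ('m \<Rightarrow> 'm \<Rightarrow> 'm \<Rightarrow> 't \<Rightarrow> 'o \<times> 'm \<times> 't) \<Rightarrow>
    'm \<Rightarrow> 'm \<Rightarrow> 'm \<Rightarrow> 'o \<times> 'm \<times> 'm \<times> 't" where
  "select_F5 \<C> CW DW v f' u =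
     (let (E, p, q, \<tau>) = CW (v \<star>\<^bsub>\<C>\<^esub> f') (v \<star>\<^bsub>\<C>\<^esub> u);
          (D, r, \<theta>) = DW v (f' \<star>\<^bsub>\<C>\<^esub> p) (u \<star>\<^bsub>\<C>\<^esub> q)
             (Assoc \<C> v u q \<bullet>\<^bsub>\<C>\<^esub> \<tau> \<bullet>\<^bsub>\<C>\<^esub> Inv2 \<C> (Assoc \<C> v f' p))
      in (D, p \<star>\<^bsub>\<C>\<^esub> r, q \<star>\<^bsub>\<C>\<^esub> r, Assoc \<C> u q r \<bullet>\<^bsub>\<C>\<^esub> \<theta> \<bullet>\<^bsub>\<C>\<^esub> Inv2 \<C> (Assoc \<C> f' p r)))"

text \<open>
  (F6), (F7): C(W) fills the pair \<open>(w1 \<circ> t1, w2 \<circ> t2)\<close> with \<open>s3\<close>, \<open>s4\<close>; then D(W) cancels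
  \<open>v1 \<circ> u1\<close>, at the price of precomposing \<open>s3\<close> and \<open>s4\<close> with some \<open>r\<close> in \<open>\<W>\<close>.
\<close>

fun select_F567 :: "('o, 'm, 't, 'x) bicategory_data_scheme \<Rightarrow>
    ('m \<Rightarrow> 'm \<Rightarrow> 'o \<times> 'm \<times> 'm \<times> 't) \<Rightarrow> ('m \<Rightarrow> 'm \<Rightarrow> 'm \<Rightarrow> 't \<Rightarrow> 'o \<times> 'm \<times> 't) \<Rightarrow>
    ('o, 'm) frac \<Rightarrow> ('o, 'm) frac \<Rightarrow> ('o, 'm) frac \<Rightarrow> ('o, 'm, 't) frac_rep \<Rightarrow>
    ('o, 'm, 't) F_data" where
  "select_F567 \<C> CW DW (A', w, f) (B1, v1, g1) (B2, v2, g2) (B3, u1, u2, \<alpha>, \<beta>) =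
     (let (D1, w1, f1, \<rho>1) = CW f v1; (D2, w2, f2, \<rho>2) = CW f v2;
          (D3, t1, h1, \<sigma>1) = select_F5 \<C> CW DW v1 f1 u1;
          (D4, t2, h2, \<sigma>2) = select_F5 \<C> CW DW v2 f2 u2;
          (E, s3, s4, \<psi>) = CW (w1 \<star>\<^bsub>\<C>\<^esub> t1) (w2 \<star>\<^bsub>\<C>\<^esub> t2);
          \<phi>0 = Assoc \<C> w2 t2 s4 \<bullet>\<^bsub>\<C>\<^esub> \<psi> \<bullet>\<^bsub>\<C>\<^esub> Inv2 \<C> (Assoc \<C> w1 t1 s3);
          (D5, r, \<delta>0) = DW (v1 \<star>\<^bsub>\<C>\<^esub> u1) (h1 \<star>\<^bsub>\<C>\<^esub> s3) (h2 \<star>\<^bsub>\<C>\<^esub> s4)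
             (Inv2 \<C> (Assoc \<C> v1 u1 (h2 \<star>\<^bsub>\<C>\<^esub> s4))
              \<bullet>\<^bsub>\<C>\<^esub> F7_cell \<C> f v1 v2 u1 u2 \<alpha> w1 f1 \<rho>1 w2 f2 \<rho>2 t1 t2 h1 h2 \<sigma>1 \<sigma>2 s3 s4 \<phi>0
              \<bullet>\<^bsub>\<C>\<^esub> Assoc \<C> v1 u1 (h1 \<star>\<^bsub>\<C>\<^esub> s3));
          \<phi> = (w2 \<triangleleft>\<^bsub>\<C>\<^esub> Assoc \<C> t2 s4 r)
              \<bullet>\<^bsub>\<C>\<^esub> RW \<C> w1 (t1 \<star>\<^bsub>\<C>\<^esub> s3) w2 (t2 \<star>\<^bsub>\<C>\<^esub> s4) \<phi>0 r
              \<bullet>\<^bsub>\<C>\<^esub> (w1 \<triangleleft>\<^bsub>\<C>\<^esub> Inv2 \<C> (Assoc \<C> t1 s3 r));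
          \<delta> = Assoc \<C> h2 s4 r \<bullet>\<^bsub>\<C>\<^esub> \<delta>0 \<bullet>\<^bsub>\<C>\<^esub> Inv2 \<C> (Assoc \<C> h1 s3 r)
      in (D3, D4, t1, t2, h1, h2, \<sigma>1, \<sigma>2, D5, s3 \<star>\<^bsub>\<C>\<^esub> r, s4 \<star>\<^bsub>\<C>\<^esub> r, \<phi>, \<delta>))"

text \<open>
  The composition \<open>\<Delta> \<circ> F\<close> for \<open>\<Delta> : G1 \<Rightarrow> G2\<close>: the class of the quintuple induced by any representative
  of \<open>\<Delta>\<close> and the selected data. As usual for functions on a quotient, this is written as a union over
  the representatives, which is a single class because all representatives give the same one.
\<close>

definition frac_whisker :: "('o, 'm, 't, 'x) bicategory_data_scheme \<Rightarrow> 'm set \<Rightarrow>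
    ('m \<Rightarrow> 'm \<Rightarrow> 'o \<times> 'm \<times> 'm \<times> 't) \<Rightarrow> ('m \<Rightarrow> 'm \<Rightarrow> 'm \<Rightarrow> 't \<Rightarrow> 'o \<times> 'm \<times> 't) \<Rightarrow>
    ('o, 'm) frac \<Rightarrow> ('o, 'm) frac \<Rightarrow> ('o, 'm, 't) frac_rep set \<Rightarrow> ('o, 'm) frac \<Rightarrow>
    ('o, 'm, 't) frac_rep set" where
  "frac_whisker \<C> \<W> CW DW G1 G2 \<Delta> F =
     (\<Union>r\<in>\<Delta>. frac_class \<C> \<W> (frac_comp \<C> CW G1 F) (frac_comp \<C> CW G2 F)
        (induced_rep \<C> CW F G1 G2 r (select_F567 \<C> CW DW F G1 G2 r)))"

end

theory Submission
  imports Defs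
begin

text \<open>
  Associators are avoided by a strictification: a nonempty list \<open>p\<close> of composable 1-morphisms stands
  for its composite \<open>cmp p\<close> bracketed to the right, and a cell \<open>p \<Rightarrow> q\<close> between lists is a 2-morphism
  \<open>cmp p \<Rightarrow> cmp q\<close>. Concatenation is strictly associative, the whiskering by a list \<open>t\<close> on the right
  depends on \<open>cmp t\<close> only, and for lists of length two it is the operation \<open>RW\<close>.

  In this calculus, absorb \<open>\<delta>\<close> into \<open>\<sigma>2\<close>. Data (F5)--(F7) become \<open>T1\<close>, \<open>T2\<close>, \<open>H\<close> with invertible
  \<open>\<phi> : w1 T1 \<Rightarrow> w2 T2\<close>, \<open>S1 : f1 T1 \<Rightarrow> u1 H\<close>, \<open>S2 : f2 T2 \<Rightarrow> u2 H\<close> such that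
  \<open>(\<alpha> H) (v1 S1) (\<rho>1 T1) = (v2 S2) (\<rho>2 T2) (f \<phi>)\<close>, and \<open>\<xi> = (g2 S2)\<inverse> (\<beta> H) (g1 S1)\<close>. Suppose that
  \<open>(z, z', t1, t2)\<close> exhibits two representatives of \<open>\<Delta>\<close> as equivalent, and let a second set of data
  (primed) be given for the second one. By (BF3) and (BF4) there are, after a common precomposition,
  \<open>l1 : T1' Y' \<Rightarrow> T1 Y\<close> and \<open>l2 : T2 Y \<Rightarrow> T2' Y'\<close> compatible with \<open>\<phi>\<close> and \<open>\<phi>'\<close>, and \<open>h : H Y \<Rightarrow> z K\<close>,
  \<open>h' : H' Y' \<Rightarrow> z' K\<close> such that \<open>(u1 h) (S1 Y) (f1 l1) = (t1 K) (u1' h') (S1' Y')\<close>. The corresponding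
  equation for \<open>S2\<close> follows from (F7) after whiskering by \<open>v2\<close>, hence holds after a further
  precomposition; both equations together show that \<open>l1\<close>, \<open>l2\<close> carry \<open>\<xi>\<close> to \<open>\<xi>'\<close>.
\<close>

section \<open>Whiskering and inverses in a bicategory\<close>

text \<open>Taking for one of the two sets of data the one selected by C(W) and D(W) makes the
  formula for the composite an instance of independence, once the selected data are known to satisfy
  (F5)-(F7). What shapes the comparison is that \<open>u1\<close>, \<open>u2\<close>,
  \<open>z\<close>, \<open>z'\<close> and \<open>t4\<close> need not be in \<W>: cancellation is
  available only along \<open>w1\<close>, \<open>w2\<close>, \<open>v1\<close>, \<open>v2\<close>
  and composites such as \<open>v1 u1\<close> or \<open>v1 u1 z\<close>. Of the four comparison
  cells, \<open>l1\<close> and \<open>h\<close> are free fillers, while \<open>l2\<close> and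
  \<open>h'\<close> are then forced by \<phi> and by the equation for \<open>S1\<close>. Nothing is
  left to adjust for \<open>S2\<close>, so its equation has to come out of (F7). (BF4c) enters as a
  faithfulness statement: cells that agree after whiskering by a member of \<W> agree after a
  precomposition in \<W>. The comparison is made over \<open>w1\<close> and the list
  \<open>g1 f1\<close>; the factor \<open>w\<close> and the passage to single composites come at the
  end, where the same comparison cells still serve.\<close>

context bicategory
begin

lemma Hom1_iff: "f \<in> Hom1 \<C> A B \<longleftrightarrow> f \<in> Arr \<C> \<and> Src \<C> f = A \<and> Trg \<C> f = B"
  by (simp add: Hom1_def)

lemma Hom2_iff: "\<alpha> \<in> Hom2 \<C> f g \<longleftrightarrow> \<alpha> \<in> Cell \<C> \<and> Dom \<C> \<alpha> = f \<and> Cod \<C> \<alpha> = g"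
  by (simp add: Hom2_def)

declare Dom_Arr [simp] Cod_Arr [simp]

lemma Src_Cod [simp]: "\<alpha> \<in> Cell \<C> \<Longrightarrow> Src \<C> (Cod \<C> \<alpha>) = Src \<C> (Dom \<C> \<alpha>)"
  by (simp add: Src_Dom)

lemma Trg_Cod [simp]: "\<alpha> \<in> Cell \<C> \<Longrightarrow> Trg \<C> (Cod \<C> \<alpha>) = Trg \<C> (Dom \<C> \<alpha>)"
  by (simp add: Trg_Dom)

lemma Comp_simps [simp]:
  assumes "f \<in> Arr \<C>" "g \<in> Arr \<C>" "Src \<C> g = Trg \<C> f"
  shows "g \<star> f \<in> Arr \<C>" "Src \<C> (g \<star> f) = Src \<C> f" "Trg \<C> (g \<star> f) = Trg \<C> g"
  using Comp_Hom1 [of f "Src \<C> f" "Trg \<C> f" g "Trg \<C> g"] assms by (auto simp: Hom1_iff)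

lemma Id1_simps [simp]:
  assumes "A \<in> Obj \<C>"
  shows "Id1 \<C> A \<in> Arr \<C>" "Src \<C> (Id1 \<C> A) = A" "Trg \<C> (Id1 \<C> A) = A"
  using Id1_Hom1 [OF assms] by (auto simp: Hom1_iff)

lemma Id2_simps [simp]:
  assumes "f \<in> Arr \<C>"
  shows "Id2 \<C> f \<in> Cell \<C>" "Dom \<C> (Id2 \<C> f) = f" "Cod \<C> (Id2 \<C> f) = f"
  using Id2_Hom2 [OF assms] by (auto simp: Hom2_iff)

lemma VComp_simps [simp]:
  assumes "\<alpha> \<in> Cell \<C>" "\<beta> \<in> Cell \<C>" "Cod \<C> \<alpha> = Dom \<C> \<beta>"
  shows "\<beta> \<bullet> \<alpha> \<in> Cell \<C>" "Dom \<C> (\<beta> \<bullet> \<alpha>) = Dom \<C> \<alpha>" "Cod \<C> (\<beta> \<bullet> \<alpha>) = Cod \<C> \<beta>"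
  using VComp_Hom2 [of \<alpha> "Dom \<C> \<alpha>" "Cod \<C> \<alpha>" \<beta> "Cod \<C> \<beta>"] assms by (auto simp: Hom2_iff)

lemma VComp_Id2 [simp]:
  assumes "\<alpha> \<in> Cell \<C>"
  shows "Cod \<C> \<alpha> = f \<Longrightarrow> Id2 \<C> f \<bullet> \<alpha> = \<alpha>" "Dom \<C> \<alpha> = f \<Longrightarrow> \<alpha> \<bullet> Id2 \<C> f = \<alpha>"
  using VComp_Id2_left VComp_Id2_right assms by (auto simp: Hom2_iff)

lemma VComp_assoc' [simp]:
  "\<lbrakk>\<alpha> \<in> Cell \<C>; \<beta> \<in> Cell \<C>; \<gamma> \<in> Cell \<C>; Cod \<C> \<alpha> = Dom \<C> \<beta>; Cod \<C> \<beta> = Dom \<C> \<gamma>\<rbrakk>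
    \<Longrightarrow> (\<gamma> \<bullet> \<beta>) \<bullet> \<alpha> = \<gamma> \<bullet> \<beta> \<bullet> \<alpha>"
  using VComp_assoc by (auto simp: Hom2_iff)

lemma LWhisk_simps [simp]:
  assumes "\<alpha> \<in> Cell \<C>" "g \<in> Arr \<C>" "Src \<C> g = Trg \<C> (Dom \<C> \<alpha>)"
  shows "g \<triangleleft> \<alpha> \<in> Cell \<C>" "Dom \<C> (g \<triangleleft> \<alpha>) = g \<star> Dom \<C> \<alpha>" "Cod \<C> (g \<triangleleft> \<alpha>) = g \<star> Cod \<C> \<alpha>"
  using HComp_Hom2 [of "Dom \<C> \<alpha>" "Src \<C> (Dom \<C> \<alpha>)" "Src \<C> g" g "Trg \<C> g" \<alpha> "Cod \<C> \<alpha>" "Id2 \<C> g" g] assms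
  by (auto simp: Hom2_iff Hom1_iff LWhisk_def)

lemma RWhisk_simps [simp]:
  assumes "\<alpha> \<in> Cell \<C>" "f \<in> Arr \<C>" "Src \<C> (Dom \<C> \<alpha>) = Trg \<C> f"
  shows "\<alpha> \<triangleright> f \<in> Cell \<C>" "Dom \<C> (\<alpha> \<triangleright> f) = Dom \<C> \<alpha> \<star> f" "Cod \<C> (\<alpha> \<triangleright> f) = Cod \<C> \<alpha> \<star> f"
  using HComp_Hom2 [of f "Src \<C> f" "Trg \<C> f" "Dom \<C> \<alpha>" "Trg \<C> (Dom \<C> \<alpha>)" "Id2 \<C> f" f \<alpha> "Cod \<C> \<alpha>"] assms
  by (auto simp: Hom2_iff Hom1_iff RWhisk_def)

lemma LWhisk_VComp [simp]:
  assumes "\<alpha> \<in> Cell \<C>" "\<beta> \<in> Cell \<C>" "Cod \<C> \<alpha> = Dom \<C> \<beta>" "g \<in> Arr \<C>" "Src \<C> g = Trg \<C> (Dom \<C> \<alpha>)"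
  shows "g \<triangleleft> (\<beta> \<bullet> \<alpha>) = (g \<triangleleft> \<beta>) \<bullet> (g \<triangleleft> \<alpha>)"
  using interchange [of "Dom \<C> \<alpha>" "Src \<C> (Dom \<C> \<alpha>)" "Src \<C> g" g "Trg \<C> g" \<alpha> "Cod \<C> \<alpha>" \<beta> "Cod \<C> \<beta>"
      "Id2 \<C> g" g "Id2 \<C> g" g] assms
  by (auto simp: Hom2_iff Hom1_iff LWhisk_def)

lemma RWhisk_VComp [simp]:
  assumes "\<alpha> \<in> Cell \<C>" "\<beta> \<in> Cell \<C>" "Cod \<C> \<alpha> = Dom \<C> \<beta>" "f \<in> Arr \<C>" "Src \<C> (Dom \<C> \<alpha>) = Trg \<C> f"
  shows "(\<beta> \<bullet> \<alpha>) \<triangleright> f = (\<beta> \<triangleright> f) \<bullet> (\<alpha> \<triangleright> f)"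
  using interchange [of f "Src \<C> f" "Trg \<C> f" "Dom \<C> \<alpha>" "Trg \<C> (Dom \<C> \<alpha>)" "Id2 \<C> f" f "Id2 \<C> f" f
      \<alpha> "Cod \<C> \<alpha>" \<beta> "Cod \<C> \<beta>"] assms
  by (auto simp: Hom2_iff Hom1_iff RWhisk_def)

lemma Whisk_Id2 [simp]:
  assumes "f \<in> Arr \<C>" "g \<in> Arr \<C>" "Src \<C> g = Trg \<C> f"
  shows "g \<triangleleft> Id2 \<C> f = Id2 \<C> (g \<star> f)" "Id2 \<C> g \<triangleright> f = Id2 \<C> (g \<star> f)"
  using HComp_Id2 assms by (auto simp: Hom1_iff LWhisk_def RWhisk_def)

text \<open>Both sides are the horizontal composite of \<beta> and \<alpha>;
  \<open>interchange\<close> factors it with the identities inserted in either order.\<close>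

lemma whisker_exchange:
  assumes "\<alpha> \<in> Cell \<C>" "\<beta> \<in> Cell \<C>" "Src \<C> (Dom \<C> \<beta>) = Trg \<C> (Dom \<C> \<alpha>)"
  shows "(\<beta> \<triangleright> Cod \<C> \<alpha>) \<bullet> (Dom \<C> \<beta> \<triangleleft> \<alpha>) = (Cod \<C> \<beta> \<triangleleft> \<alpha>) \<bullet> (\<beta> \<triangleright> Dom \<C> \<alpha>)"
proof -
  let ?f = "Dom \<C> \<alpha>" and ?f' = "Cod \<C> \<alpha>" and ?g = "Dom \<C> \<beta>" and ?g' = "Cod \<C> \<beta>"
  have "HComp \<C> (\<beta> \<bullet> Id2 \<C> ?g) (Id2 \<C> ?f' \<bullet> \<alpha>) = HComp \<C> \<beta> (Id2 \<C> ?f') \<bullet> HComp \<C> (Id2 \<C> ?g) \<alpha>"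
    by (rule interchange [of ?f "Src \<C> ?f" "Src \<C> ?g" ?g "Trg \<C> ?g" _ ?f' _ ?f' _ ?g _ ?g'])
      (use assms in \<open>auto simp: Hom2_iff Hom1_iff\<close>)
  moreover have "HComp \<C> (Id2 \<C> ?g' \<bullet> \<beta>) (\<alpha> \<bullet> Id2 \<C> ?f) = HComp \<C> (Id2 \<C> ?g') \<alpha> \<bullet> HComp \<C> \<beta> (Id2 \<C> ?f)"
    by (rule interchange [of ?f "Src \<C> ?f" "Src \<C> ?g" ?g "Trg \<C> ?g" _ ?f _ ?f' _ ?g' _ ?g'])
      (use assms in \<open>auto simp: Hom2_iff Hom1_iff\<close>)
  ultimately show ?thesis
    using assms by (simp add: LWhisk_def RWhisk_def)
qed

section \<open>Invertible 2-morphisms and their inverses\<close>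

definition iso2 :: "'t \<Rightarrow> bool" where
  "iso2 \<alpha> \<longleftrightarrow> \<alpha> \<in> Cell \<C> \<and> (\<exists>\<beta>. inverse2 \<C> \<alpha> \<beta>)"

lemma Iso2_iff: "\<alpha> \<in> Iso2 \<C> f g \<longleftrightarrow> iso2 \<alpha> \<and> Dom \<C> \<alpha> = f \<and> Cod \<C> \<alpha> = g"
  by (auto simp: Iso2_def Hom2_iff iso2_def)

lemma iso2_Cell [simp]: "iso2 \<alpha> \<Longrightarrow> \<alpha> \<in> Cell \<C>"
  by (simp add: iso2_def)

lemma inverse2_unique:
  assumes "\<alpha> \<in> Cell \<C>" "inverse2 \<C> \<alpha> \<beta>" "inverse2 \<C> \<alpha> \<beta>'"
  shows "\<beta> = \<beta>'"
proof -
  have *: "\<beta> \<in> Cell \<C>" "Dom \<C> \<beta> = Cod \<C> \<alpha>" "Cod \<C> \<beta> = Dom \<C> \<alpha>" "\<beta> \<bullet> \<alpha> = Id2 \<C> (Dom \<C> \<alpha>)"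
    "\<beta>' \<in> Cell \<C>" "Dom \<C> \<beta>' = Cod \<C> \<alpha>" "Cod \<C> \<beta>' = Dom \<C> \<alpha>" "\<alpha> \<bullet> \<beta>' = Id2 \<C> (Cod \<C> \<alpha>)"
    using assms(2,3) by (auto simp: inverse2_def Hom2_iff)
  then have "(\<beta> \<bullet> \<alpha>) \<bullet> \<beta>' = \<beta> \<bullet> (\<alpha> \<bullet> \<beta>')"
    using assms(1) by (intro VComp_assoc') auto
  then show ?thesis
    using * assms(1) by simp
qed

lemma inverse2_Inv2: "iso2 \<alpha> \<Longrightarrow> inverse2 \<C> \<alpha> (Inv2 \<C> \<alpha>)"
  unfolding Inv2_def iso2_def by (rule theI') (auto intro: inverse2_unique)

lemma Inv2_simps [simp]:
  assumes "iso2 \<alpha>"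
  shows "Inv2 \<C> \<alpha> \<in> Cell \<C>" "Dom \<C> (Inv2 \<C> \<alpha>) = Cod \<C> \<alpha>" "Cod \<C> (Inv2 \<C> \<alpha>) = Dom \<C> \<alpha>"
    "Inv2 \<C> \<alpha> \<bullet> \<alpha> = Id2 \<C> (Dom \<C> \<alpha>)" "\<alpha> \<bullet> Inv2 \<C> \<alpha> = Id2 \<C> (Cod \<C> \<alpha>)"
  using inverse2_Inv2 [OF assms] by (auto simp: inverse2_def Hom2_iff)

lemma Inv2_cancel [simp]:
  assumes "iso2 \<alpha>" "\<beta> \<in> Cell \<C>"
  shows "Cod \<C> \<beta> = Dom \<C> \<alpha> \<Longrightarrow> Inv2 \<C> \<alpha> \<bullet> \<alpha> \<bullet> \<beta> = \<beta>"
    "Cod \<C> \<beta> = Cod \<C> \<alpha> \<Longrightarrow> \<alpha> \<bullet> Inv2 \<C> \<alpha> \<bullet> \<beta> = \<beta>"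
  by (subst VComp_assoc' [symmetric]; use assms in simp)+

lemma iso2I:
  assumes "\<alpha> \<in> Cell \<C>" "\<beta> \<in> Cell \<C>" "Cod \<C> \<alpha> = Dom \<C> \<beta>" "Cod \<C> \<beta> = Dom \<C> \<alpha>"
    "\<beta> \<bullet> \<alpha> = Id2 \<C> (Dom \<C> \<alpha>)" "\<alpha> \<bullet> \<beta> = Id2 \<C> (Cod \<C> \<alpha>)"
  shows "iso2 \<alpha>" "Inv2 \<C> \<alpha> = \<beta>"
proof -
  have i: "inverse2 \<C> \<alpha> \<beta>"
    using assms by (simp add: inverse2_def Hom2_iff)
  then show "iso2 \<alpha>"
    using assms by (auto simp: iso2_def)
  then show "Inv2 \<C> \<alpha> = \<beta>"
    using inverse2_Inv2 i inverse2_unique assms(1) by blast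
qed

lemma iso2_Id2 [simp]: "f \<in> Arr \<C> \<Longrightarrow> iso2 (Id2 \<C> f)" "f \<in> Arr \<C> \<Longrightarrow> Inv2 \<C> (Id2 \<C> f) = Id2 \<C> f"
  using iso2I [of "Id2 \<C> f" "Id2 \<C> f"] by auto

lemma iso2_Inv2 [simp]: "iso2 \<alpha> \<Longrightarrow> iso2 (Inv2 \<C> \<alpha>)" "iso2 \<alpha> \<Longrightarrow> Inv2 \<C> (Inv2 \<C> \<alpha>) = \<alpha>"
  using iso2I [of "Inv2 \<C> \<alpha>" \<alpha>] by auto

lemma iso2_VComp [simp]:
  assumes "iso2 \<alpha>" "iso2 \<beta>" "Cod \<C> \<alpha> = Dom \<C> \<beta>"
  shows "iso2 (\<beta> \<bullet> \<alpha>)" "Inv2 \<C> (\<beta> \<bullet> \<alpha>) = Inv2 \<C> \<alpha> \<bullet> Inv2 \<C> \<beta>"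
  using iso2I [of "\<beta> \<bullet> \<alpha>" "Inv2 \<C> \<alpha> \<bullet> Inv2 \<C> \<beta>"] assms by auto

lemma iso2_LWhisk [simp]:
  assumes "iso2 \<alpha>" "g \<in> Arr \<C>" "Src \<C> g = Trg \<C> (Dom \<C> \<alpha>)"
  shows "iso2 (g \<triangleleft> \<alpha>)" "Inv2 \<C> (g \<triangleleft> \<alpha>) = g \<triangleleft> Inv2 \<C> \<alpha>"
proof -
  have "(g \<triangleleft> Inv2 \<C> \<alpha>) \<bullet> (g \<triangleleft> \<alpha>) = Id2 \<C> (g \<star> Dom \<C> \<alpha>)" "(g \<triangleleft> \<alpha>) \<bullet> (g \<triangleleft> Inv2 \<C> \<alpha>) = Id2 \<C> (g \<star> Cod \<C> \<alpha>)"
    using assms LWhisk_VComp [of \<alpha> "Inv2 \<C> \<alpha>" g] LWhisk_VComp [of "Inv2 \<C> \<alpha>" \<alpha> g]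
    by (simp_all del: LWhisk_VComp)
  then show "iso2 (g \<triangleleft> \<alpha>)" "Inv2 \<C> (g \<triangleleft> \<alpha>) = g \<triangleleft> Inv2 \<C> \<alpha>"
    using iso2I [of "g \<triangleleft> \<alpha>" "g \<triangleleft> Inv2 \<C> \<alpha>"] assms by auto
qed

lemma iso2_RWhisk [simp]:
  assumes "iso2 \<alpha>" "f \<in> Arr \<C>" "Src \<C> (Dom \<C> \<alpha>) = Trg \<C> f"
  shows "iso2 (\<alpha> \<triangleright> f)" "Inv2 \<C> (\<alpha> \<triangleright> f) = Inv2 \<C> \<alpha> \<triangleright> f"
proof -
  have "(Inv2 \<C> \<alpha> \<triangleright> f) \<bullet> (\<alpha> \<triangleright> f) = Id2 \<C> (Dom \<C> \<alpha> \<star> f)" "(\<alpha> \<triangleright> f) \<bullet> (Inv2 \<C> \<alpha> \<triangleright> f) = Id2 \<C> (Cod \<C> \<alpha> \<star> f)"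
    using assms RWhisk_VComp [of \<alpha> "Inv2 \<C> \<alpha>" f] RWhisk_VComp [of "Inv2 \<C> \<alpha>" \<alpha> f]
    by (simp_all del: RWhisk_VComp)
  then show "iso2 (\<alpha> \<triangleright> f)" "Inv2 \<C> (\<alpha> \<triangleright> f) = Inv2 \<C> \<alpha> \<triangleright> f"
    using iso2I [of "\<alpha> \<triangleright> f" "Inv2 \<C> \<alpha> \<triangleright> f"] assms by auto
qed

lemma VComp_right_cancel:
  assumes "iso2 \<gamma>" "\<alpha> \<in> Cell \<C>" "\<beta> \<in> Cell \<C>" "Dom \<C> \<alpha> = Cod \<C> \<gamma>" "Dom \<C> \<beta> = Cod \<C> \<gamma>" "\<alpha> \<bullet> \<gamma> = \<beta> \<bullet> \<gamma>"
  shows "\<alpha> = \<beta>"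
proof -
  have "\<alpha> = (\<alpha> \<bullet> \<gamma>) \<bullet> Inv2 \<C> \<gamma>" "\<beta> = (\<beta> \<bullet> \<gamma>) \<bullet> Inv2 \<C> \<gamma>"
    using assms(1-5) by auto
  then show ?thesis
    using assms(6) by simp
qed

section \<open>The associator: naturality in each variable separately, and the pentagon\<close>

lemma Assoc_simps [simp]:
  assumes "f \<in> Arr \<C>" "g \<in> Arr \<C>" "h \<in> Arr \<C>" "Src \<C> g = Trg \<C> f" "Src \<C> h = Trg \<C> g"
  shows "iso2 (Assoc \<C> h g f)" "Dom \<C> (Assoc \<C> h g f) = (h \<star> g) \<star> f" "Cod \<C> (Assoc \<C> h g f) = h \<star> g \<star> f"
  using Assoc_Iso2 [of f "Src \<C> f" "Trg \<C> f" g "Trg \<C> g" h "Trg \<C> h"] assms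
  by (auto simp: Hom1_iff Iso2_iff)

lemma Assoc_natural_right:
  assumes "\<alpha> \<in> Cell \<C>" "g \<in> Arr \<C>" "h \<in> Arr \<C>" "Src \<C> g = Trg \<C> (Dom \<C> \<alpha>)" "Src \<C> h = Trg \<C> g"
  shows "Assoc \<C> h g (Cod \<C> \<alpha>) \<bullet> ((h \<star> g) \<triangleleft> \<alpha>) = (h \<triangleleft> g \<triangleleft> \<alpha>) \<bullet> Assoc \<C> h g (Dom \<C> \<alpha>)"
  using Assoc_natural [of "Dom \<C> \<alpha>" "Src \<C> (Dom \<C> \<alpha>)" "Trg \<C> (Dom \<C> \<alpha>)" g "Trg \<C> g" h "Trg \<C> h" \<alpha>
      "Cod \<C> \<alpha>"
      "Id2 \<C> g" g "Id2 \<C> h" h] assms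
  by (auto simp: Hom1_iff Hom2_iff LWhisk_def HComp_Id2)

lemma Assoc_natural_middle:
  assumes "\<beta> \<in> Cell \<C>" "f \<in> Arr \<C>" "h \<in> Arr \<C>" "Src \<C> (Dom \<C> \<beta>) = Trg \<C> f" "Src \<C> h = Trg \<C> (Dom \<C> \<beta>)"
  shows "Assoc \<C> h (Cod \<C> \<beta>) f \<bullet> ((h \<triangleleft> \<beta>) \<triangleright> f) = (h \<triangleleft> (\<beta> \<triangleright> f)) \<bullet> Assoc \<C> h (Dom \<C> \<beta>) f"
  using Assoc_natural [of f "Src \<C> f" "Trg \<C> f" "Dom \<C> \<beta>" "Trg \<C> (Dom \<C> \<beta>)" h "Trg \<C> h" "Id2 \<C> f" f
      \<beta> "Cod \<C> \<beta>" "Id2 \<C> h" h] assms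
  by (auto simp: Hom1_iff Hom2_iff LWhisk_def RWhisk_def)

lemma Assoc_natural_left:
  assumes "\<gamma> \<in> Cell \<C>" "f \<in> Arr \<C>" "g \<in> Arr \<C>" "Src \<C> g = Trg \<C> f" "Src \<C> (Dom \<C> \<gamma>) = Trg \<C> g"
  shows "Assoc \<C> (Cod \<C> \<gamma>) g f \<bullet> ((\<gamma> \<triangleright> g) \<triangleright> f) = (\<gamma> \<triangleright> (g \<star> f)) \<bullet> Assoc \<C> (Dom \<C> \<gamma>) g f"
  using Assoc_natural [of f "Src \<C> f" "Trg \<C> f" g "Trg \<C> g" "Dom \<C> \<gamma>" "Trg \<C> (Dom \<C> \<gamma>)" "Id2 \<C> f" f
      "Id2 \<C> g" g \<gamma> "Cod \<C> \<gamma>"] assms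
  by (auto simp: Hom1_iff Hom2_iff RWhisk_def HComp_Id2)

lemma pentagon':
  assumes "f \<in> Arr \<C>" "g \<in> Arr \<C>" "h \<in> Arr \<C>" "k \<in> Arr \<C>"
    "Src \<C> g = Trg \<C> f" "Src \<C> h = Trg \<C> g" "Src \<C> k = Trg \<C> h"
  shows "(k \<triangleleft> Assoc \<C> h g f) \<bullet> Assoc \<C> k (h \<star> g) f \<bullet> (Assoc \<C> k h g \<triangleright> f)
              = Assoc \<C> k h (g \<star> f) \<bullet> Assoc \<C> (k \<star> h) g f"
  using pentagon [of f "Src \<C> f" "Trg \<C> f" g "Trg \<C> g" h "Trg \<C> h" k "Trg \<C> k"] assms
  by (auto simp: Hom1_iff)

text \<open>
  The pitfall of the list encoding: the empty list stands for no 1-morphism (its endpoints would be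
  undetermined), so \<open>cmp []\<close>, \<open>src []\<close>, \<open>trg []\<close> are junk and \<open>arr []\<close> fails.
\<close>

primrec cmp :: "'m list \<Rightarrow> 'm" where
  "cmp [] = undefined"
| "cmp (x # p) = (if p = [] then x else x \<star> cmp p)"

definition src :: "'m list \<Rightarrow> 'o" where "src p = Src \<C> (last p)"
definition trg :: "'m list \<Rightarrow> 'o" where "trg p = Trg \<C> (hd p)"

primrec arr :: "'m list \<Rightarrow> bool" where
  "arr [] \<longleftrightarrow> False"
| "arr (x # p) \<longleftrightarrow> x \<in> Arr \<C> \<and> (p = [] \<or> arr p \<and> Src \<C> x = trg p)"

lemma src_simps [simp]: "src [x] = Src \<C> x" "src (x # y # p) = src (y # p)"
    "q \<noteq> [] \<Longrightarrow> src (p @ q) = src q"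
  by (simp_all add: src_def)

lemma trg_simps [simp]: "trg (x # p) = Trg \<C> x" "p \<noteq> [] \<Longrightarrow> trg (p @ q) = trg p"
  by (simp_all add: trg_def)

lemma arr_not_Nil [simp]: "arr p \<Longrightarrow> p \<noteq> []"
  by auto

lemma src_Cons: "p \<noteq> [] \<Longrightarrow> src (x # p) = src p"
  by (simp add: src_def)

lemma arr_append [simp]:
  "\<lbrakk>p \<noteq> []; q \<noteq> []\<rbrakk> \<Longrightarrow> arr (p @ q) \<longleftrightarrow> arr p \<and> arr q \<and> src p = trg q"
proof (induction p)
  case (Cons x p)
  then show ?case by (cases "p = []") (auto simp: src_Cons)
qed simp

lemma cmp_simps [simp]:
  assumes "arr p"
  shows "cmp p \<in> Arr \<C>" "Src \<C> (cmp p) = src p" "Trg \<C> (cmp p) = trg p"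
proof -
  have "cmp p \<in> Arr \<C> \<and> Src \<C> (cmp p) = src p \<and> Trg \<C> (cmp p) = trg p"
    using assms by (induction p) (auto simp: src_Cons)
  then show "cmp p \<in> Arr \<C>" "Src \<C> (cmp p) = src p" "Trg \<C> (cmp p) = trg p"
    by auto
qed

text \<open>With brackets to the right, contracting a tail to its composite changes nothing. Hence
  right whiskering can be set up for a single 1-morphism \<open>m\<close> and used with
  \<open>m = cmp t\<close>.\<close>

lemma cmp_append_cmp [simp]: "t \<noteq> [] \<Longrightarrow> cmp (p @ [cmp t]) = cmp (p @ t)"
  by (induction p) auto

text \<open>Brackets to the right make left whiskering by a list an iterated whiskering free of
  associators; all associators are concentrated in right whiskering.\<close>

primrec lwr :: "'m list \<Rightarrow> 't \<Rightarrow> 't" where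
  "lwr [] \<alpha> = \<alpha>"
| "lwr (x # p) \<alpha> = x \<triangleleft> lwr p \<alpha>"

text \<open>
  The canonical associator \<open>cmp p \<star> m \<Rightarrow> cmp (p @ [m])\<close>. That it depends on a list to its right only
  through its composite \<open>m\<close> is what makes the cells below insensitive to bracketing on the right.
\<close>

primrec acell :: "'m list \<Rightarrow> 'm \<Rightarrow> 't" where
  "acell [] m = undefined"
| "acell (x # p) m = (if p = [] then Id2 \<C> (x \<star> m) else (x \<triangleleft> acell p m) \<bullet> Assoc \<C> x (cmp p) m)"

lemma acell_simps [simp]:
  assumes "arr p" "m \<in> Arr \<C>" "src p = Trg \<C> m"
  shows "iso2 (acell p m)" "Dom \<C> (acell p m) = cmp p \<star> m" "Cod \<C> (acell p m) = cmp (p @ [m])"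
proof -
  have "iso2 (acell p m) \<and> Dom \<C> (acell p m) = cmp p \<star> m \<and> Cod \<C> (acell p m) = cmp (p @ [m])"
    using assms by (induction p) (auto simp: src_Cons)
  then show "iso2 (acell p m)" "Dom \<C> (acell p m) = cmp p \<star> m" "Cod \<C> (acell p m) = cmp (p @ [m])"
    by auto
qed

lemma lwr_simps [simp]:
  assumes "\<alpha> \<in> Cell \<C>" "arr (p @ [Dom \<C> \<alpha>])"
  shows "lwr p \<alpha> \<in> Cell \<C>" "Dom \<C> (lwr p \<alpha>) = cmp (p @ [Dom \<C> \<alpha>])"
      "Cod \<C> (lwr p \<alpha>) = cmp (p @ [Cod \<C> \<alpha>])"
proof -
  have "lwr p \<alpha> \<in> Cell \<C> \<and> Dom \<C> (lwr p \<alpha>) = cmp (p @ [Dom \<C> \<alpha>]) \<and> Cod \<C> (lwr p \<alpha>)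
      = cmp (p @ [Cod \<C> \<alpha>])"
    using assms by (induction p) (auto simp: trg_def hd_append)
  then show "lwr p \<alpha> \<in> Cell \<C>" "Dom \<C> (lwr p \<alpha>) = cmp (p @ [Dom \<C> \<alpha>])"
      "Cod \<C> (lwr p \<alpha>) = cmp (p @ [Cod \<C> \<alpha>])"
    by auto
qed

lemma iso2_lwr:
  assumes "iso2 \<alpha>" "arr (p @ [Dom \<C> \<alpha>])"
  shows "iso2 (lwr p \<alpha>) \<and> Inv2 \<C> (lwr p \<alpha>) = lwr p (Inv2 \<C> \<alpha>)"
  using assms by (induction p) (auto simp: trg_def hd_append)

lemma lwr_VComp:
  assumes "\<alpha> \<in> Cell \<C>" "\<beta> \<in> Cell \<C>" "Dom \<C> \<beta> = Cod \<C> \<alpha>" "arr (p @ [Dom \<C> \<alpha>])"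
  shows "lwr p (\<beta> \<bullet> \<alpha>) = lwr p \<beta> \<bullet> lwr p \<alpha>"
  using assms(4)
proof (induction p)
  case (Cons x p)
  then show ?case
    using assms(1-3) by (cases "p = []") auto
qed simp

lemma lwr_append: "lwr (p @ q) \<alpha> = lwr p (lwr q \<alpha>)"
  by (induction p) auto

lemma lwr_Id2: "f \<in> Arr \<C> \<Longrightarrow> arr (p @ [f]) \<Longrightarrow> lwr p (Id2 \<C> f) = Id2 \<C> (cmp (p @ [f]))"
  by (induction p) (auto simp: trg_def hd_append)

text \<open>The pentagon for lists. In the induction step, naturality of \<open>Assoc\<close> in the
  middle and in the last variable moves the smaller instance into place, and one pentagon for
  \<open>x\<close>, \<open>cmp p\<close>, \<open>cmp s\<close>, \<open>m\<close> remains.\<close>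

lemma acell_assoc:
  assumes "arr p" "arr s" "m \<in> Arr \<C>" "src p = trg s" "src s = Trg \<C> m"
  shows "acell (p @ s) m \<bullet> (acell p (cmp s) \<triangleright> m)
     = acell p (cmp (s @ [m])) \<bullet> (cmp p \<triangleleft> acell s m) \<bullet> Assoc \<C> (cmp p) (cmp s) m"
  using assms(1,4)
proof (induction p)
  case (Cons x p)
  have s: "s \<noteq> []" using assms by auto
  show ?case
  proof (cases "p = []")
    case True
    with Cons assms s show ?thesis by simp
  next
    case False
    let ?P = "cmp p" and ?S = "cmp s"
    have ty: "x \<in> Arr \<C>" "arr p" "Src \<C> x = trg p" "src p = trg s"
      using Cons.prems False by (auto simp: src_Cons)
    have IH: "acell (p @ s) m \<bullet> (acell p ?S \<triangleright> m)
     = acell p (cmp (s @ [m])) \<bullet> (?P \<triangleleft> acell s m) \<bullet> Assoc \<C> ?P ?S m"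
      using Cons.IH ty by simp
    have "acell ((x # p) @ s) m \<bullet> (acell (x # p) ?S \<triangleright> m)
       = (x \<triangleleft> acell (p @ s) m) \<bullet> (Assoc \<C> x (cmp (p @ s)) m \<bullet> ((x \<triangleleft> acell p ?S) \<triangleright> m)) \<bullet> (Assoc \<C> x
           ?P ?S \<triangleright> m)"
      using False assms ty s by simp
    also have "Assoc \<C> x (cmp (p @ s)) m \<bullet> ((x \<triangleleft> acell p ?S) \<triangleright> m)
       = (x \<triangleleft> (acell p ?S \<triangleright> m)) \<bullet> Assoc \<C> x (?P \<star> ?S) m"
      using Assoc_natural_middle [of "acell p ?S" m x] False assms ty s by simp
    also have "(x \<triangleleft> acell (p @ s) m) \<bullet> ((x \<triangleleft> (acell p ?S \<triangleright> m)) \<bullet> Assoc \<C> x (?P \<star> ?S) m) \<bullet> (Assoc \<C> x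
        ?P ?S \<triangleright> m)
       = (x \<triangleleft> (acell (p @ s) m \<bullet> (acell p ?S \<triangleright> m))) \<bullet> Assoc \<C> x (?P \<star> ?S) m \<bullet> (Assoc \<C> x ?P ?S \<triangleright> m)"
      using False assms ty s by simp
    also have "\<dots> = (x \<triangleleft> acell p (cmp (s @ [m]))) \<bullet> (x \<triangleleft> ?P \<triangleleft> acell s m) \<bullet>
        ((x \<triangleleft> Assoc \<C> ?P ?S m) \<bullet> Assoc \<C> x (?P \<star> ?S) m \<bullet> (Assoc \<C> x ?P ?S \<triangleright> m))"
      unfolding IH using False assms ty s by simp
    also have "(x \<triangleleft> Assoc \<C> ?P ?S m) \<bullet> Assoc \<C> x (?P \<star> ?S) m \<bullet> (Assoc \<C> x ?P ?S \<triangleright> m)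
        = Assoc \<C> x ?P (?S \<star> m) \<bullet> Assoc \<C> (x \<star> ?P) ?S m"
      using pentagon' assms ty by simp
    also have "(x \<triangleleft> acell p (cmp (s @ [m]))) \<bullet> (x \<triangleleft> ?P \<triangleleft> acell s m) \<bullet> \<dots>
        = (x \<triangleleft> acell p (cmp (s @ [m]))) \<bullet> ((x \<triangleleft> ?P \<triangleleft> acell s m) \<bullet> Assoc \<C> x ?P (?S \<star> m)) \<bullet> Assoc \<C>
            (x \<star> ?P) ?S m"
      using False assms ty s by simp
    also have "(x \<triangleleft> ?P \<triangleleft> acell s m) \<bullet> Assoc \<C> x ?P (?S \<star> m)
        = Assoc \<C> x ?P (cmp (s @ [m])) \<bullet> ((x \<star> ?P) \<triangleleft> acell s m)"
      using Assoc_natural_right [of "acell s m" ?P x] assms ty s by simp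
    finally show ?thesis
      using False assms ty s by simp
  qed
qed simp

text \<open>Naturality of \<open>acell p\<close> in its last variable, by iterating that of
  \<open>Assoc\<close>. It turns \<open>whisker_exchange\<close> into an exchange law for
  lists.\<close>

lemma lwr_acell:
  assumes "\<beta> \<in> Cell \<C>" "arr p" "src p = Trg \<C> (Dom \<C> \<beta>)"
  shows "lwr p \<beta> \<bullet> acell p (Dom \<C> \<beta>) = acell p (Cod \<C> \<beta>) \<bullet> (cmp p \<triangleleft> \<beta>)"
  using assms(2,3)
proof (induction p)
  case (Cons x p)
  show ?case
  proof (cases "p = []")
    case True
    with Cons assms show ?thesis by simp
  next
    case False
    have ty: "x \<in> Arr \<C>" "arr p" "Src \<C> x = trg p" "src p = Trg \<C> (Dom \<C> \<beta>)"
      using Cons.prems False by (auto simp: src_Cons)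
    have IH: "lwr p \<beta> \<bullet> acell p (Dom \<C> \<beta>) = acell p (Cod \<C> \<beta>) \<bullet> (cmp p \<triangleleft> \<beta>)"
      using Cons.IH ty by simp
    have "lwr (x # p) \<beta> \<bullet> acell (x # p) (Dom \<C> \<beta>)
        = (x \<triangleleft> (lwr p \<beta> \<bullet> acell p (Dom \<C> \<beta>))) \<bullet> Assoc \<C> x (cmp p) (Dom \<C> \<beta>)"
      using False assms(1) ty by simp
    also have "\<dots> = (x \<triangleleft> acell p (Cod \<C> \<beta>)) \<bullet> ((x \<triangleleft> cmp p \<triangleleft> \<beta>) \<bullet> Assoc \<C> x (cmp p) (Dom \<C> \<beta>))"
      unfolding IH using False assms(1) ty by simp
    also have "(x \<triangleleft> cmp p \<triangleleft> \<beta>) \<bullet> Assoc \<C> x (cmp p) (Dom \<C> \<beta>) = Assoc \<C> x (cmp p) (Cod \<C> \<beta>) \<bullet> ((x \<star>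
        cmp p) \<triangleleft> \<beta>)"
      using Assoc_natural_right [of \<beta> "cmp p" x] assms(1) ty by simp
    finally show ?thesis
      using False assms(1) ty by simp
  qed
qed simp

text \<open>\<open>\<alpha> \<triangleright> m\<close> is bracketed to the left; conjugation by the
  canonical associators moves the brackets to the right. The factorizations \<open>p\<close>,
  \<open>q\<close> are arguments because \<alpha> knows only the composites.\<close>

definition rwr :: "'m list \<Rightarrow> 'm list \<Rightarrow> 't \<Rightarrow> 'm \<Rightarrow> 't" where
  "rwr p q \<alpha> m = acell q m \<bullet> (\<alpha> \<triangleright> m) \<bullet> Inv2 \<C> (acell p m)"

context
  fixes p q :: "'m list" and \<alpha> :: 't and m :: 'm
  assumes ty: "arr p" "arr q" "src p = Trg \<C> m" "src q = Trg \<C> m" "trg q = trg p" "m \<in> Arr \<C>"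
    "\<alpha> \<in> Cell \<C>" "Dom \<C> \<alpha> = cmp p" "Cod \<C> \<alpha> = cmp q"
begin

lemma rwr_simps: "rwr p q \<alpha> m \<in> Cell \<C>" "Dom \<C> (rwr p q \<alpha> m) = cmp (p @ [m])"
    "Cod \<C> (rwr p q \<alpha> m) = cmp (q @ [m])"
  using ty by (simp_all add: rwr_def)

lemma rwr_acell: "rwr p q \<alpha> m \<bullet> acell p m = acell q m \<bullet> (\<alpha> \<triangleright> m)"
  using ty by (simp add: rwr_def)

text \<open>\<open>acell p m\<close> is invertible, so a cell completing this square is unique.
  Compatibility laws can thus be proved by checking the square, without handling inverse
  associators.\<close>

lemma rwr_eqI:
  assumes "\<rho> \<in> Cell \<C>" "Dom \<C> \<rho> = cmp (p @ [m])" "\<rho> \<bullet> acell p m = acell q m \<bullet> (\<alpha> \<triangleright> m)"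
  shows "\<rho> = rwr p q \<alpha> m"
  by (rule VComp_right_cancel [of "acell p m"]) (use assms rwr_simps rwr_acell ty in simp_all)

lemma iso2_rwr: "iso2 \<alpha> \<Longrightarrow> iso2 (rwr p q \<alpha> m)" "iso2 \<alpha> \<Longrightarrow> Inv2 \<C> (rwr p q \<alpha> m) = rwr q p (Inv2 \<C> \<alpha>) m"
  using ty by (simp_all add: rwr_def)

end

lemma rwr_VComp:
  assumes "arr p" "arr q" "arr r" "src p = Trg \<C> m" "src q = Trg \<C> m" "src r = Trg \<C> m"
      "trg q = trg p" "trg r = trg p"
    "m \<in> Arr \<C>" "\<alpha> \<in> Cell \<C>" "Dom \<C> \<alpha> = cmp p" "Cod \<C> \<alpha> = cmp q" "\<beta> \<in> Cell \<C>" "Dom \<C> \<beta> = cmp q"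
        "Cod \<C> \<beta> = cmp r"
  shows "rwr p r (\<beta> \<bullet> \<alpha>) m = rwr q r \<beta> m \<bullet> rwr p q \<alpha> m"
  using assms by (simp add: rwr_def)

text \<open>Naturality of \<open>Assoc\<close> in the middle variable makes the two whiskerings
  commute strictly.\<close>

lemma lwr_rwr1:
  assumes "arr p" "arr q" "src p = Trg \<C> m" "src q = Trg \<C> m" "trg q = trg p" "m \<in> Arr \<C>"
    "\<alpha> \<in> Cell \<C>" "Dom \<C> \<alpha> = cmp p" "Cod \<C> \<alpha> = cmp q" "x \<in> Arr \<C>" "Src \<C> x = trg p"
  shows "x \<triangleleft> rwr p q \<alpha> m = rwr (x # p) (x # q) (x \<triangleleft> \<alpha>) m"
proof (rule rwr_eqI)
  note rwr_simps [simp]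
  have ne: "p \<noteq> []" "q \<noteq> []" using assms by auto
  have "(x \<triangleleft> rwr p q \<alpha> m) \<bullet> acell (x # p) m = (x \<triangleleft> (rwr p q \<alpha> m \<bullet> acell p m)) \<bullet> Assoc \<C> x (cmp p) m"
    using assms ne by simp
  also have "\<dots> = (x \<triangleleft> acell q m) \<bullet> ((x \<triangleleft> (\<alpha> \<triangleright> m)) \<bullet> Assoc \<C> x (cmp p) m)"
    using assms ne by (simp add: rwr_acell)
  also have "(x \<triangleleft> (\<alpha> \<triangleright> m)) \<bullet> Assoc \<C> x (cmp p) m = Assoc \<C> x (cmp q) m \<bullet> ((x \<triangleleft> \<alpha>) \<triangleright> m)"
    using Assoc_natural_middle [of \<alpha> m x] assms by simp
  finally show "(x \<triangleleft> rwr p q \<alpha> m) \<bullet> acell (x # p) m = acell (x # q) m \<bullet> ((x \<triangleleft> \<alpha>) \<triangleright> m)"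
    using assms ne by simp
qed (use assms in \<open>auto simp: rwr_simps src_Cons\<close>)

text \<open>\<open>acell_assoc\<close>, used for \<open>p\<close> and for \<open>q\<close>, merges
  the two conjugations into one; in between, \<alpha> passes \<open>Assoc\<close> by naturality in
  the left variable and \<open>acell s m\<close> by interchange.\<close>

lemma rwr_rwr:
  assumes "arr p" "arr q" "arr s" "src p = trg s" "src q = trg s" "trg q = trg p"
    "src s = Trg \<C> m" "m \<in> Arr \<C>" "\<alpha> \<in> Cell \<C>" "Dom \<C> \<alpha> = cmp p" "Cod \<C> \<alpha> = cmp q"
  shows "rwr (p @ s) (q @ s) (rwr p q \<alpha> (cmp s)) m = rwr p q \<alpha> (cmp (s @ [m]))"
proof (rule rwr_eqI)
  note rwr_simps [simp]
  have ne: "s \<noteq> []" "p \<noteq> []" "q \<noteq> []" using assms by auto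
  let ?P = "cmp p" and ?Q = "cmp q" and ?S = "cmp s" and ?R = "rwr p q \<alpha> (cmp s)"
  \<comment> \<open>\<open>?c\<close> is the invertible remainder of the right-hand side of
    \<open>acell_assoc\<close>; it is cancelled at the end.\<close>
  let ?c = "(?P \<triangleleft> acell s m) \<bullet> Assoc \<C> ?P ?S m" and ?RR = "rwr (p @ s) (q @ s) ?R m"
  have ta: "trg (s @ [m]) = trg s" "arr (s @ [m])" using assms ne by simp_all
  have "(?RR \<bullet> acell p (cmp (s @ [m]))) \<bullet> ?c = ?RR \<bullet> acell (p @ s) m \<bullet> (acell p ?S \<triangleright> m)"
    using assms ne by (simp add: acell_assoc)
  also have "\<dots> = (?RR \<bullet> acell (p @ s) m) \<bullet> (acell p ?S \<triangleright> m)"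
    using assms ne by simp
  also have "?RR \<bullet> acell (p @ s) m = acell (q @ s) m \<bullet> (?R \<triangleright> m)"
    using assms ne by (intro rwr_acell) simp_all
  also have "(acell (q @ s) m \<bullet> (?R \<triangleright> m)) \<bullet> (acell p ?S \<triangleright> m) = acell (q @ s) m \<bullet> ((?R \<bullet> acell p ?S)
      \<triangleright> m)"
    using assms ne by simp
  also have "?R \<bullet> acell p ?S = acell q ?S \<bullet> (\<alpha> \<triangleright> ?S)"
    using assms ne by (intro rwr_acell) simp_all
  also have "acell (q @ s) m \<bullet> ((acell q ?S \<bullet> (\<alpha> \<triangleright> ?S)) \<triangleright> m) = (acell (q @ s) m \<bullet> (acell q ?S \<triangleright> m))
      \<bullet> ((\<alpha> \<triangleright> ?S) \<triangleright> m)"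
    using assms ne by simp
  also have "\<dots> = acell q (cmp (s @ [m])) \<bullet> (?Q \<triangleleft> acell s m) \<bullet> (Assoc \<C> ?Q ?S m \<bullet> ((\<alpha> \<triangleright> ?S) \<triangleright> m))"
    using assms ne by (simp add: acell_assoc)
  also have "Assoc \<C> ?Q ?S m \<bullet> ((\<alpha> \<triangleright> ?S) \<triangleright> m) = (\<alpha> \<triangleright> (?S \<star> m)) \<bullet> Assoc \<C> ?P ?S m"
    using Assoc_natural_left [of \<alpha> m ?S] assms by simp
  also have "acell q (cmp (s @ [m])) \<bullet> (?Q \<triangleleft> acell s m) \<bullet> \<dots>
      = acell q (cmp (s @ [m])) \<bullet> ((?Q \<triangleleft> acell s m) \<bullet> (\<alpha> \<triangleright> (?S \<star> m))) \<bullet> Assoc \<C> ?P ?S m"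
    using assms ne by simp
  also have "(?Q \<triangleleft> acell s m) \<bullet> (\<alpha> \<triangleright> (?S \<star> m)) = (\<alpha> \<triangleright> cmp (s @ [m])) \<bullet> (?P \<triangleleft> acell s m)"
    using whisker_exchange [of "acell s m" \<alpha>] assms by simp
  finally have
      "(?RR \<bullet> acell p (cmp (s @ [m]))) \<bullet> ?c = (acell q (cmp (s @ [m])) \<bullet> (\<alpha> \<triangleright> cmp (s @ [m]))) \<bullet> ?c"
    using assms ne by simp
  then show "?RR \<bullet> acell p (cmp (s @ [m])) = acell q (cmp (s @ [m])) \<bullet> (\<alpha> \<triangleright> cmp (s @ [m]))"
    by (rule VComp_right_cancel [rotated 5]) (use assms ne in simp_all)
qed (use assms in \<open>auto simp: rwr_simps\<close>)

text \<open>Naturality of \<open>acell p\<close> and \<open>acell q\<close> in the last variable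
  reduces this to \<open>whisker_exchange\<close>.\<close>

lemma rwr_exchange:
  assumes "arr p" "arr q" "src q = src p" "trg q = trg p" "\<alpha> \<in> Cell \<C>" "Dom \<C> \<alpha> = cmp p"
      "Cod \<C> \<alpha> = cmp q"
    "\<beta> \<in> Cell \<C>" "src p = Trg \<C> (Dom \<C> \<beta>)"
  shows "rwr p q \<alpha> (Cod \<C> \<beta>) \<bullet> lwr p \<beta> = lwr q \<beta> \<bullet> rwr p q \<alpha> (Dom \<C> \<beta>)"
proof (rule VComp_right_cancel [of "acell p (Dom \<C> \<beta>)"])
  note rwr_simps [simp]
  have ne: "p \<noteq> []" "q \<noteq> []" using assms by auto
  let ?P = "cmp p" and ?Q = "cmp q" and ?s = "Dom \<C> \<beta>" and ?t = "Cod \<C> \<beta>"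
  have "(rwr p q \<alpha> ?t \<bullet> lwr p \<beta>) \<bullet> acell p ?s = rwr p q \<alpha> ?t \<bullet> acell p ?t \<bullet> (?P \<triangleleft> \<beta>)"
    using assms ne by (simp add: lwr_acell)
  also have "\<dots> = (rwr p q \<alpha> ?t \<bullet> acell p ?t) \<bullet> (?P \<triangleleft> \<beta>)"
    using assms ne by simp
  also have "\<dots> = acell q ?t \<bullet> (\<alpha> \<triangleright> ?t) \<bullet> (?P \<triangleleft> \<beta>)"
    using assms ne by (simp add: rwr_acell)
  also have "(\<alpha> \<triangleright> ?t) \<bullet> (?P \<triangleleft> \<beta>) = (?Q \<triangleleft> \<beta>) \<bullet> (\<alpha> \<triangleright> ?s)"
    using whisker_exchange [of \<beta> \<alpha>] assms by simp
  also have "acell q ?t \<bullet> (?Q \<triangleleft> \<beta>) \<bullet> (\<alpha> \<triangleright> ?s) = (lwr q \<beta> \<bullet> acell q ?s) \<bullet> (\<alpha> \<triangleright> ?s)"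
    using assms ne by (simp add: lwr_acell)
  also have "\<dots> = lwr q \<beta> \<bullet> rwr p q \<alpha> ?s \<bullet> acell p ?s"
    using assms ne by (simp add: rwr_acell)
  finally show "(rwr p q \<alpha> ?t \<bullet> lwr p \<beta>) \<bullet> acell p ?s = (lwr q \<beta> \<bullet> rwr p q \<alpha> ?s) \<bullet> acell p ?s"
    using assms ne by simp
qed (use assms in \<open>auto simp: rwr_simps\<close>)

end

section \<open>The strict calculus of cells between lists of 1-morphisms\<close>

text \<open>A cell carries its two lists, since a 2-morphism determines only their composites.
  Equality of cells therefore includes equality of their typing.\<close>

type_synonym ('m, 't) path_cell = "'m list \<times> 't \<times> 'm list"

abbreviation dm :: "('m, 't) path_cell \<Rightarrow> 'm list" where "dm c \<equiv> fst c"
abbreviation raw :: "('m, 't) path_cell \<Rightarrow> 't" where "raw c \<equiv> fst (snd c)"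
abbreviation cd :: "('m, 't) path_cell \<Rightarrow> 'm list" where "cd c \<equiv> snd (snd c)"

context bicategory
begin

definition cell :: "('m, 't) path_cell \<Rightarrow> bool" where
  "cell c \<longleftrightarrow> arr (dm c) \<and> arr (cd c) \<and>
     raw c \<in> Cell \<C> \<and> Dom \<C> (raw c) = cmp (dm c) \<and> Cod \<C> (raw c) = cmp (cd c)"

text \<open>
  Non-composable operations yield \<open>null\<close>, which is not a cell and is absorbing. Since lists cancel, the
  laws of a strict 2-category then hold without side conditions and can be used for rewriting.
\<close>

definition null :: "('m, 't) path_cell" where
  "null = ([], undefined, [])"

definition vc :: "('m, 't) path_cell \<Rightarrow> ('m, 't) path_cell \<Rightarrow> ('m, 't) path_cell" (infixr \<open>\<odot>\<close> 65) where
  "d \<odot> c = (if cell c \<and> cell d \<and> cd c = dm d then (dm c, raw d \<bullet> raw c, cd d) else null)"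

definition lw :: "'m list \<Rightarrow> ('m, 't) path_cell \<Rightarrow> ('m, 't) path_cell" (infixr \<open>\<lhd>\<close> 76) where
  "x \<lhd> c = (if cell c \<and> arr (x @ dm c) then (x @ dm c, lwr x (raw c), x @ cd c) else null)"

text \<open>The empty list has its own case because \<open>cmp []\<close> is junk; this lets
  \<open>rw_rw\<close> hold for all lists. For \<open>lw\<close> the recursion of \<open>lwr\<close>
  already takes care of it.\<close>

definition rw :: "('m, 't) path_cell \<Rightarrow> 'm list \<Rightarrow> ('m, 't) path_cell" (infixl \<open>\<rhd>\<close> 75) where
  "c \<rhd> t = (if cell c \<and> arr (dm c @ t)
     then (dm c @ t, if t = [] then raw c else rwr (dm c) (cd c) (raw c) (cmp t), cd c @ t) else null)"

definition idc :: "'m list \<Rightarrow> ('m, 't) path_cell" where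
  "idc p = (p, Id2 \<C> (cmp p), p)"

definition isoc :: "('m, 't) path_cell \<Rightarrow> bool" where
  "isoc c \<longleftrightarrow> cell c \<and> iso2 (raw c)"

definition cinv :: "('m, 't) path_cell \<Rightarrow> ('m, 't) path_cell" where
  "cinv c = (cd c, Inv2 \<C> (raw c), dm c)"

section \<open>Typing of cells and the laws of a strict 2-category\<close>

lemma not_cell_null [simp]: "\<not> cell null"
  by (simp add: cell_def null_def)

lemma cell_parallel:
  assumes "cell c"
  shows "arr (dm c)" "arr (cd c)" "src (cd c) = src (dm c)" "trg (cd c) = trg (dm c)"
    "raw c \<in> Cell \<C>" "Dom \<C> (raw c) = cmp (dm c)" "Cod \<C> (raw c) = cmp (cd c)"
proof -
  show *: "arr (dm c)" "arr (cd c)" "raw c \<in> Cell \<C>" "Dom \<C> (raw c) = cmp (dm c)"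
      "Cod \<C> (raw c) = cmp (cd c)"
    using assms by (auto simp: cell_def)
  show "src (cd c) = src (dm c)" "trg (cd c) = trg (dm c)"
    using Src_Dom [OF *(3)] Trg_Dom [OF *(3)] * by simp_all
qed

lemma arr_append_iff: "arr (p @ q) \<longleftrightarrow> (if p = [] then arr q else if q = [] then arr p else arr p
    \<and> arr q \<and> src p = trg q)"
  by simp

lemma arr_append_cong:
  assumes "cell c"
  shows "arr (x @ cd c) \<longleftrightarrow> arr (x @ dm c)" "arr (cd c @ t) \<longleftrightarrow> arr (dm c @ t)"
  using cell_parallel [OF assms] by (auto simp: arr_append_iff)

lemma vc_eq: "cell c \<Longrightarrow> cell d \<Longrightarrow> cd c = dm d \<Longrightarrow> d \<odot> c = (dm c, raw d \<bullet> raw c, cd d)"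
  by (simp add: vc_def)

lemma cell_vc: "cell (d \<odot> c) \<longleftrightarrow> cell c \<and> cell d \<and> cd c = dm d"
  by (auto simp: vc_def) (auto simp: cell_def)

lemma lw_eq: "cell c \<Longrightarrow> arr (x @ dm c) \<Longrightarrow> x \<lhd> c = (x @ dm c, lwr x (raw c), x @ cd c)"
  by (simp add: lw_def)

lemma arr_cmp_tail: "p \<noteq> [] \<Longrightarrow> arr (x @ p) \<Longrightarrow> arr (x @ [cmp p])"
  by (cases "x = []") auto

lemma arr_append_right: "p \<noteq> [] \<Longrightarrow> arr (x @ p) \<Longrightarrow> arr p"
  by (cases "x = []") auto

lemma arr_append_left: "p \<noteq> [] \<Longrightarrow> arr (p @ x) \<Longrightarrow> arr p"
  by (cases "x = []") auto

lemma lwr_cell: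
  assumes "cell c" "arr (x @ dm c)"
  shows "lwr x (raw c) \<in> Cell \<C>" "Dom \<C> (lwr x (raw c)) = cmp (x @ dm c)"
      "Cod \<C> (lwr x (raw c)) = cmp (x @ cd c)"
  using cell_parallel [OF assms(1)] arr_cmp_tail [of "dm c" x] assms(2) by simp_all

lemma cell_lw: "cell (x \<lhd> c) \<longleftrightarrow> cell c \<and> arr (x @ dm c)"
proof (cases "cell c \<and> arr (x @ dm c)")
  case True
  then show ?thesis
    using lwr_cell [of c x] by (simp add: lw_def cell_def [of "(_, _)"] arr_append_cong)
qed (auto simp: lw_def)

lemma rwr_cell:
  assumes "cell c" "arr (dm c @ t)" "t \<noteq> []"
  shows "rwr (dm c) (cd c) (raw c) (cmp t) \<in> Cell \<C>"
      "Dom \<C> (rwr (dm c) (cd c) (raw c) (cmp t)) = cmp (dm c @ t)"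
    "Cod \<C> (rwr (dm c) (cd c) (raw c) (cmp t)) = cmp (cd c @ t)"
  using rwr_simps [of "dm c" "cd c" "cmp t" "raw c"] cell_parallel [OF assms(1)] assms by simp_all

lemma cell_rw: "cell (c \<rhd> t) \<longleftrightarrow> cell c \<and> arr (dm c @ t)"
proof (cases "cell c \<and> arr (dm c @ t)")
  case True
  then show ?thesis
    using rwr_cell [of c t] cell_parallel [of c] by (auto simp: rw_def cell_def [of
        "(_, _)"] arr_append_cong)
qed (auto simp: rw_def)

lemma dm_cd [simp]:
  "cell (d \<odot> c) \<Longrightarrow> dm (d \<odot> c) = dm c" "cell (d \<odot> c) \<Longrightarrow> cd (d \<odot> c) = cd d"
  "cell (x \<lhd> c) \<Longrightarrow> dm (x \<lhd> c) = x @ dm c" "cell (x \<lhd> c) \<Longrightarrow> cd (x \<lhd> c) = x @ cd c"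
  "cell (c \<rhd> t) \<Longrightarrow> dm (c \<rhd> t) = dm c @ t" "cell (c \<rhd> t) \<Longrightarrow> cd (c \<rhd> t) = cd c @ t"
  by (auto simp: cell_vc cell_lw cell_rw vc_eq lw_def rw_def)

lemma raw_simps:
  "cell (d \<odot> c) \<Longrightarrow> raw (d \<odot> c) = raw d \<bullet> raw c"
  "cell (x \<lhd> c) \<Longrightarrow> raw (x \<lhd> c) = lwr x (raw c)"
  "cell (c \<rhd> t) \<Longrightarrow> raw (c \<rhd> t) = (if t = [] then raw c else rwr (dm c) (cd c) (raw c) (cmp t))"
  by (auto simp: cell_vc cell_lw cell_rw vc_eq lw_def rw_def)

declare cell_vc [simp] cell_lw [simp] cell_rw [simp]

text \<open>All results of the operations are proper. For an equation between them it is enough that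
  both sides are cells under the same conditions and that their components agree in that
  case.\<close>

definition proper :: "('m, 't) path_cell \<Rightarrow> bool" where
  "proper c \<longleftrightarrow> cell c \<or> c = null"

lemma proper_simps [simp]: "proper (d \<odot> c)" "proper (x \<lhd> c)" "proper (c \<rhd> t)"
  using cell_vc [of d c] cell_lw [of x c] cell_rw [of c t] by (auto simp: proper_def vc_def lw_def
      rw_def)

lemma proper_eqI:
  assumes "proper c" "proper d" "cell c \<longleftrightarrow> cell d"
    "cell c \<Longrightarrow> cell d \<Longrightarrow> dm c = dm d \<and> cd c = cd d \<and> raw c = raw d"
  shows "c = d"
  using assms by (auto simp: proper_def prod_eq_iff)

lemma vc_assoc [simp]: "(e \<odot> d) \<odot> c = e \<odot> d \<odot> c"
proof (rule proper_eqI)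
  assume "cell ((e \<odot> d) \<odot> c)" "cell (e \<odot> d \<odot> c)"
  then show "dm ((e \<odot> d) \<odot> c) = dm (e \<odot> d \<odot> c) \<and> cd ((e \<odot> d) \<odot> c) = cd (e \<odot> d \<odot> c) \<and> raw ((e \<odot> d)
      \<odot> c) = raw (e \<odot> d \<odot> c)"
    by (auto simp: raw_simps cell_parallel)
qed auto

lemma lw_vc [simp]: "x \<lhd> (d \<odot> c) = (x \<lhd> d) \<odot> (x \<lhd> c)"
proof (rule proper_eqI)
  assume "cell (x \<lhd> (d \<odot> c))"
  then have "cell c" "cell d" "cd c = dm d" "arr (x @ dm c)" "arr (x @ dm d)"
    using arr_append_cong(1) [of c x] by auto
  then show "dm (x \<lhd> (d \<odot> c)) = dm ((x \<lhd> d) \<odot> (x \<lhd> c)) \<and> cd (x \<lhd> (d \<odot> c)) = cd ((x \<lhd> d) \<odot> (x \<lhd> c))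
      \<and> raw (x \<lhd> (d \<odot> c)) = raw ((x \<lhd> d) \<odot> (x \<lhd> c))"
    using lwr_VComp [of "raw c" "raw d" x] arr_cmp_tail [of "dm c" x]
        by (simp add: raw_simps cell_parallel)
qed (use arr_append_cong(1) [of c x] in auto)

lemma rw_vc [simp]: "(d \<odot> c) \<rhd> t = (d \<rhd> t) \<odot> (c \<rhd> t)"
proof (rule proper_eqI)
  assume "cell ((d \<odot> c) \<rhd> t)"
  then have *: "cell c" "cell d" "cd c = dm d" "arr (dm c @ t)" "arr (dm d @ t)"
    using arr_append_cong(2) [of c t] by auto
  show "dm ((d \<odot> c) \<rhd> t) = dm ((d \<rhd> t) \<odot> (c \<rhd> t)) \<and> cd ((d \<odot> c) \<rhd> t) = cd ((d \<rhd> t) \<odot> (c \<rhd> t))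
      \<and> raw ((d \<odot> c) \<rhd> t) = raw ((d \<rhd> t) \<odot> (c \<rhd> t))"
    using * cell_parallel [of c] cell_parallel [of d] 
    by (cases "t = []") (auto simp add: raw_simps intro!: rwr_VComp)
qed (use arr_append_cong(2) [of c t] in auto)

lemma lw_lw [simp]: "x \<lhd> y \<lhd> c = (x @ y) \<lhd> c"
proof (rule proper_eqI)
  show "cell (x \<lhd> y \<lhd> c) \<longleftrightarrow> cell ((x @ y) \<lhd> c)"
    using arr_append_right [of "y @ dm c" x] cell_parallel [of c] by auto
qed (auto simp: raw_simps lwr_append)

lemma rw_rw [simp]: "c \<rhd> s \<rhd> t = c \<rhd> (s @ t)"
proof (rule proper_eqI)
  show iff: "cell (c \<rhd> s \<rhd> t) \<longleftrightarrow> cell (c \<rhd> (s @ t))"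
    using arr_append_left [of "dm c @ s" t] cell_parallel [of c] by auto
  assume a: "cell (c \<rhd> s \<rhd> t)" "cell (c \<rhd> (s @ t))"
  have "raw (c \<rhd> s \<rhd> t) = raw (c \<rhd> (s @ t))"
  proof (cases "s = [] \<or> t = []")
    case True
    with a show ?thesis by (auto simp: raw_simps)
  next
    case False
    with a have "cell c" "arr (dm c @ s @ t)" "arr (dm c @ s)" by auto
    with False cell_parallel [of c] show ?thesis
      using rwr_rwr [of "dm c" "cd c" s "cmp t" "raw c"] by (simp add: raw_simps)
  qed
  with a show "dm (c \<rhd> s \<rhd> t) = dm (c \<rhd> (s @ t)) \<and> cd (c \<rhd> s \<rhd> t) = cd (c \<rhd> (s @ t))
      \<and> raw (c \<rhd> s \<rhd> t) = raw (c \<rhd> (s @ t))"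
    by auto
qed auto

text \<open>This orientation fixes the normal form of the simplifier: a right-nested
  \<open>\<odot>\<close> of factors \<open>x \<lhd> c \<rhd> t\<close>. The exchange law, which has
  no preferred direction, is kept out of it and invoked explicitly.\<close>

lemma lw_rw [simp]: "x \<lhd> (c \<rhd> t) = (x \<lhd> c) \<rhd> t"
proof (rule proper_eqI)
  show "cell (x \<lhd> (c \<rhd> t)) \<longleftrightarrow> cell ((x \<lhd> c) \<rhd> t)"
    using arr_append_left [of "x @ dm c" t] arr_append_right [of "dm c @ t" x] cell_parallel [of c]
        by auto
  assume "cell (x \<lhd> (c \<rhd> t))" "cell ((x \<lhd> c) \<rhd> t)"
  then have a: "cell c" "arr (x @ dm c @ t)" "arr (x @ dm c)" "arr (dm c @ t)" by auto
  have "raw (x \<lhd> (c \<rhd> t)) = raw ((x \<lhd> c) \<rhd> t)"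
  proof (cases "t = []")
    case True
    with a show ?thesis by (auto simp: raw_simps)
  next
    case False
    have "lwr x (rwr (dm c) (cd c) (raw c) (cmp t)) = rwr (x @ dm c) (x @ cd c) (lwr x (raw c)) (cmp t)"
      using a(2)
    proof (induction x)
      case (Cons y x)
      have ne: "dm c \<noteq> []" "cd c \<noteq> []" using cell_parallel [of c] a by auto
      have b: "arr (x @ dm c @ t)" "y \<in> Arr \<C>" "Src \<C> y = trg (x @ dm c @ t)"
        using Cons.prems ne by auto
      then have c: "arr (x @ dm c)" "src (x @ dm c) = trg t" "arr t" "Src \<C> y = trg (x @ dm c)"
        using arr_append [of "x @ dm c" t] trg_simps(2) [of "x @ dm c" t] ne False
            by (simp_all del: arr_append trg_simps)
      then have d: "arr (x @ cd c)" "src (x @ cd c) = trg t" "trg (x @ cd c) = trg (x @ dm c)"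
        using arr_append_cong [of c x] a cell_parallel [of c] ne by (auto simp: trg_def hd_append)
      show ?case
        using Cons.IH lwr_rwr1 [of "x @ dm c" "x @ cd c" "cmp t"
            "lwr x (raw c)" y] lwr_cell [of c x] a b c d by simp
    qed simp
    with a False show ?thesis by (simp add: raw_simps)
  qed
  with a show "dm (x \<lhd> (c \<rhd> t)) = dm ((x \<lhd> c) \<rhd> t) \<and> cd (x \<lhd> (c \<rhd> t)) = cd ((x \<lhd> c) \<rhd> t)
      \<and> raw (x \<lhd> (c \<rhd> t)) = raw ((x \<lhd> c) \<rhd> t)"
    by simp
qed auto

lemma vc_exchange: "(c \<rhd> cd d) \<odot> (dm c \<lhd> d) = (cd c \<lhd> d) \<odot> (c \<rhd> dm d)"
proof (rule proper_eqI)
  show iff: "cell ((c \<rhd> cd d) \<odot> (dm c \<lhd> d)) \<longleftrightarrow> cell ((cd c \<lhd> d) \<odot> (c \<rhd> dm d))"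
    using arr_append_cong(1) [of d "dm c"] arr_append_cong(2) [of c "dm d"] by auto
  assume "cell ((c \<rhd> cd d) \<odot> (dm c \<lhd> d))" "cell ((cd c \<lhd> d) \<odot> (c \<rhd> dm d))"
  then have a: "cell c" "cell d" "arr (dm c @ cd d)" "arr (dm c @ dm d)" "arr (cd c @ dm d)"
    by (simp_all only: cell_vc cell_rw cell_lw)
  then have "rwr (dm c) (cd c) (raw c) (cmp (cd d)) \<bullet> lwr (dm c) (raw d)
      = lwr (cd c) (raw d) \<bullet> rwr (dm c) (cd c) (raw c) (cmp (dm d))"
    using cell_parallel [of c] cell_parallel [of d] rwr_exchange [of "dm c" "cd c" "raw c" "raw d"]
        by simp
  with a show "dm ((c \<rhd> cd d) \<odot> (dm c \<lhd> d)) = dm ((cd c \<lhd> d) \<odot> (c \<rhd> dm d)) \<and>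
     cd ((c \<rhd> cd d) \<odot> (dm c \<lhd> d)) = cd ((cd c \<lhd> d) \<odot> (c \<rhd> dm d)) \<and>
     raw ((c \<rhd> cd d) \<odot> (dm c \<lhd> d)) = raw ((cd c \<lhd> d) \<odot> (c \<rhd> dm d))"
    using cell_parallel [of c] cell_parallel [of d] by (simp add: raw_simps)
qed auto

section \<open>Identity cells and invertible cells\<close>

lemma cd_idc [simp]: "cd (idc p) = p"
  by (simp add: idc_def)

lemma vc_idc [simp]:
  "cell c \<Longrightarrow> cd c = p \<Longrightarrow> idc p \<odot> c = c" "cell c \<Longrightarrow> dm c = p \<Longrightarrow> c \<odot> idc p = c"
  using cell_parallel [of c] by (auto simp: vc_def idc_def cell_def [of "(_,_)"] prod_eq_iff)

lemma iso_cell [simp]: "isoc c \<Longrightarrow> cell c"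
  by (simp add: isoc_def)

lemma iso_vc [simp]: "isoc c \<Longrightarrow> isoc d \<Longrightarrow> cd c = dm d \<Longrightarrow> isoc (d \<odot> c)"
  by (auto simp: isoc_def raw_simps cell_parallel)

lemma iso_lw [simp]: "isoc c \<Longrightarrow> arr (x @ dm c) \<Longrightarrow> isoc (x \<lhd> c)"
  using iso2_lwr [of "raw c" x] arr_cmp_tail [of "dm c" x] cell_parallel [of c]
      by (auto simp: isoc_def raw_simps)

lemma iso_rw [simp]: "isoc c \<Longrightarrow> arr (dm c @ t) \<Longrightarrow> isoc (c \<rhd> t)"
  using iso2_rwr [of "dm c" "cd c" "cmp t" "raw c"] cell_parallel [of c]
      by (auto simp: isoc_def raw_simps)

lemma iso_inv [simp]:
  assumes "isoc c"
  shows "isoc (cinv c)"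
proof -
  have c: "cell c" "iso2 (raw c)" using assms by (auto simp: isoc_def)
  then have "cell (cinv c)"
    by (subst cell_def) (simp add: cinv_def cell_parallel)
  with c show ?thesis by (simp add: isoc_def cinv_def)
qed

lemma dm_inv [simp]: "dm (cinv c) = cd c" "cd (cinv c) = dm c"
  by (simp_all add: cinv_def)

lemma inv_inv [simp]: "isoc c \<Longrightarrow> cinv (cinv c) = c"
  by (simp add: isoc_def cinv_def prod_eq_iff)

lemma raw_inv: "raw (cinv c) = Inv2 \<C> (raw c)"
  by (simp add: cinv_def)

lemma vc_inv [simp]: "isoc c \<Longrightarrow> cinv c \<odot> c = idc (dm c)" "isoc c \<Longrightarrow> c \<odot> cinv c = idc (cd c)"
proof -
  assume a: "isoc c"
  have "cell c" "cell (cinv c)" "iso2 (raw c)" using a iso_inv [of c] by (simp_all add: isoc_def)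
  then show "cinv c \<odot> c = idc (dm c)" "c \<odot> cinv c = idc (cd c)"
    using cell_parallel [of c] by (auto simp: vc_eq idc_def cinv_def)
qed

lemma inv_vc [simp]: "isoc c \<Longrightarrow> isoc d \<Longrightarrow> cd c = dm d \<Longrightarrow> cinv (d \<odot> c) = cinv c \<odot> cinv d"
proof -
  assume a: "isoc c" "isoc d" "cd c = dm d"
  have "cell c" "cell (cinv c)" "iso2 (raw c)" "cell d" "cell (cinv d)" "iso2 (raw d)"
    using a iso_inv [of c] iso_inv [of d] by (simp_all add: isoc_def)
  then show ?thesis
    using a cell_parallel [of c] cell_parallel [of d] by (auto simp: vc_eq cinv_def)
qed

lemma inv_lw [simp]: "isoc c \<Longrightarrow> arr (x @ dm c) \<Longrightarrow> cinv (x \<lhd> c) = x \<lhd> cinv c"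
proof -
  assume a: "isoc c" "arr (x @ dm c)"
  have "cell c" "cell (cinv c)" "iso2 (raw c)" using a iso_inv [of c] by (simp_all add: isoc_def)
  then show ?thesis
    using a cell_parallel [of c] iso2_lwr [of "raw c" x] arr_cmp_tail [of
        "dm c" x] arr_append_cong(1) [of c x]
    by (auto simp: lw_eq cinv_def)
qed

lemma inv_rw [simp]: "isoc c \<Longrightarrow> arr (dm c @ t) \<Longrightarrow> cinv (c \<rhd> t) = cinv c \<rhd> t"
proof -
  assume a: "isoc c" "arr (dm c @ t)"
  have "cell c" "cell (cinv c)" "iso2 (raw c)" using a iso_inv [of c] by (simp_all add: isoc_def)
  then show ?thesis
    using a cell_parallel [of c] iso2_rwr [of "dm c" "cd c" "cmp t" "raw c"] arr_append_cong(2) [of c t]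
    by (auto simp: rw_def cinv_def)
qed

lemma vc_inv_cancel [simp]:
  assumes "isoc c" "cell d"
  shows "cd d = dm c \<Longrightarrow> cinv c \<odot> c \<odot> d = d" "cd d = cd c \<Longrightarrow> c \<odot> cinv c \<odot> d = d"
  by (subst vc_assoc [symmetric]; use assms in simp)+

lemma lw_inv_cancel [simp]:
  assumes "isoc c" "arr (x @ dm c)"
  shows "(x \<lhd> cinv c) \<odot> (x \<lhd> c) = idc (x @ dm c)" "(x \<lhd> c) \<odot> (x \<lhd> cinv c) = idc (x @ cd c)"
    "cell d \<Longrightarrow> cd d = x @ dm c \<Longrightarrow> (x \<lhd> cinv c) \<odot> (x \<lhd> c) \<odot> d = d"
    "cell d \<Longrightarrow> cd d = x @ cd c \<Longrightarrow> (x \<lhd> c) \<odot> (x \<lhd> cinv c) \<odot> d = d"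
  using vc_inv [of "x \<lhd> c"] vc_inv_cancel [of "x \<lhd> c" d] assms by simp_all

lemma rw_inv_cancel [simp]:
  assumes "isoc c" "arr (dm c @ t)"
  shows "(cinv c \<rhd> t) \<odot> (c \<rhd> t) = idc (dm c @ t)" "(c \<rhd> t) \<odot> (cinv c \<rhd> t) = idc (cd c @ t)"
    "cell d \<Longrightarrow> cd d = dm c @ t \<Longrightarrow> (cinv c \<rhd> t) \<odot> (c \<rhd> t) \<odot> d = d"
    "cell d \<Longrightarrow> cd d = cd c @ t \<Longrightarrow> (c \<rhd> t) \<odot> (cinv c \<rhd> t) \<odot> d = d"
  using vc_inv [of "c \<rhd> t"] vc_inv_cancel [of "c \<rhd> t" d] assms by simp_all

text \<open>Cancellation for factors in the normal form \<open>x \<lhd> c \<rhd> t\<close>, also at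
  the head of a longer composite.\<close>

lemma lw_rw_inv_cancel [simp]:
  assumes "isoc c" "arr (x @ dm c)" "arr (x @ dm c @ t)"
  shows "(x \<lhd> cinv c \<rhd> t) \<odot> (x \<lhd> c \<rhd> t) = idc (x @ dm c @ t)"
      "(x \<lhd> c \<rhd> t) \<odot> (x \<lhd> cinv c \<rhd> t) = idc (x @ cd c @ t)"
    "cell d \<Longrightarrow> cd d = x @ dm c @ t \<Longrightarrow> (x \<lhd> cinv c \<rhd> t) \<odot> (x \<lhd> c \<rhd> t) \<odot> d = d"
    "cell d \<Longrightarrow> cd d = x @ cd c @ t \<Longrightarrow> (x \<lhd> c \<rhd> t) \<odot> (x \<lhd> cinv c \<rhd> t) \<odot> d = d"
  using rw_inv_cancel(1,2) [of "x \<lhd> c" t] rw_inv_cancel(3,4) [of "x \<lhd> c" t d] assms by simp_all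

lemma vc_left_cancel: "isoc c \<Longrightarrow> cell d \<Longrightarrow> cell e \<Longrightarrow> cd d = dm c \<Longrightarrow> cd e = dm c \<Longrightarrow> c \<odot> d = c \<odot> e \<Longrightarrow> d = e"
  by (metis vc_inv_cancel(1))

lemma vc_right_cancel: "isoc c \<Longrightarrow> cell d \<Longrightarrow> cell e \<Longrightarrow> dm d = cd c \<Longrightarrow> dm e = cd c \<Longrightarrow> d \<odot> c = e \<odot> c \<Longrightarrow> d = e"
  by (metis vc_assoc vc_idc(2) vc_inv(2))

text \<open>
  The identity 2-morphism of \<open>cmp p\<close>, read as a cell from the list to its composite; whiskering it
  on the right produces inverse associators.
\<close>

definition pack :: "'m list \<Rightarrow> ('m, 't) path_cell" where
  "pack p = (p, Id2 \<C> (cmp p), [cmp p])"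

lemma pack_simps [simp]: "dm (pack p) = p" "cd (pack p) = [cmp p]" "arr p \<Longrightarrow> isoc (pack p)"
  by (simp_all add: pack_def isoc_def cell_def)

text \<open>\<open>vc_exchange\<close> with the four lists named, so that instances can be used for
  rewriting without first computing \<open>dm\<close> and \<open>cd\<close>.\<close>

lemma exchange:
  assumes "dm c = p" "cd c = q" "dm d = s" "cd d = t"
  shows "(c \<rhd> t) \<odot> (p \<lhd> d) = (q \<lhd> d) \<odot> (c \<rhd> s)"
  using vc_exchange [of c d] assms by simp

text \<open>\<open>acell [x, y] t\<close> is \<open>Assoc \<C> x y t\<close> up to an identity
  factor; this links the rebracketed whiskering of the definitions to the list calculus.\<close>

lemma RW_eq: "RW \<C> x y x' y' \<theta> t = rwr [x, y] [x', y'] \<theta> t"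
  if "x \<in> Arr \<C>" "y \<in> Arr \<C>" "x' \<in> Arr \<C>" "y' \<in> Arr \<C>" "t \<in> Arr \<C>" "Src \<C> x = Trg \<C> y"
      "Src \<C> x' = Trg \<C> y'"
    "Src \<C> y = Trg \<C> t" "Src \<C> y' = Trg \<C> t"
  using that by (simp add: RW_def rwr_def)

end

section \<open>Conditions (BF) for lists\<close>

context BF
begin

text \<open>Membership is tested on the right-bracketed composite; by (BF5) another bracketing gives
  the same answer.\<close>

definition WW :: "'m list \<Rightarrow> bool" where
  "WW p \<longleftrightarrow> arr p \<and> cmp p \<in> \<W>"

lemma WW_arr [simp]: "WW p \<Longrightarrow> arr p"
  by (simp add: WW_def)

lemma WW_single: "WW [x] \<longleftrightarrow> x \<in> \<W>"
  using W_Arr by (auto simp: WW_def)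

text \<open>(BF5) gives one direction; applied to the inverse cell it gives the other.\<close>

lemma WW_iso: "isoc c \<Longrightarrow> WW (dm c) \<longleftrightarrow> WW (cd c)"
proof -
  have *: "isoc c \<Longrightarrow> WW (cd c) \<Longrightarrow> WW (dm c)" for c
    using BF5 [of "cmp (cd c)" "cmp (dm c)" "raw c"] cell_parallel [of c]
        by (auto simp: WW_def isoc_def Iso2_iff)
  assume "isoc c"
  then show ?thesis
    using * [of c] * [of "cinv c"] by auto
qed

text \<open>(BF2) speaks of \<open>cmp p \<star> cmp q\<close>; \<open>acell\<close> is an
  isomorphism to the right-bracketed composite, along which (BF5) transfers membership.\<close>

lemma WW_append [simp]:
  assumes "WW p" "WW q" "src p = trg q"
  shows "WW (p @ q)"
proof -
  have a: "arr p" "arr q" "p \<noteq> []" "q \<noteq> []" using assms by auto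
  then have "cmp p \<star> cmp q \<in> \<W>"
    using BF2 [of "cmp q" "src q" "trg q" "cmp p" "trg p"] assms by (auto simp: WW_def Hom1_iff)
  then show ?thesis
    using BF5 [of "cmp p \<star> cmp q" "cmp (p @ q)" "Inv2 \<C> (acell p (cmp q))"] a assms(3)
    by (auto simp: WW_def Iso2_iff)
qed

lemma path_BF3:
  assumes "arr f" "WW w" "trg f = trg w"
  obtains w' f' c where "WW w'" "arr f'" "isoc c" "dm c = f @ w'" "cd c = w @ f'"
proof -
  have a: "arr f" "arr w" "f \<noteq> []" "w \<noteq> []" using assms by auto
  have "fillers \<C> \<W> (cmp f) (cmp w) \<noteq> {}"
    using BF3 [of "cmp w" "src w" "trg w" "cmp f" "src f"] assms by (simp add: WW_def Hom1_iff)
  then obtain D v' f' \<rho> where *: "v' \<in> Arr \<C>" "Src \<C> v' = D" "Trg \<C> v' = src f" "v' \<in> \<W>"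
    "f' \<in> Arr \<C>" "Src \<C> f' = D" "Trg \<C> f' = src w" "iso2 \<rho>" "Dom \<C> \<rho> = cmp f \<star> v'"
        "Cod \<C> \<rho> = cmp w \<star> f'"
    using a by (auto simp: fillers_def Hom1_iff Iso2_iff)
  define r where "r = ([cmp f, v'], \<rho>, [cmp w, f'])"
  have r: "isoc r" "dm r = [cmp f, v']" "cd r = [cmp w, f']"
    using * a assms by (auto simp: r_def isoc_def cell_def)
  show ?thesis
    by (rule that [of "[v']" "[f']" "cinv (pack w \<rhd> [f']) \<odot> r \<odot> (pack f \<rhd> [v'])"])
      (use * a r assms in \<open>auto simp: WW_single\<close>)
qed

text \<open>(BF4a) provides the lift and (BF4b) its invertibility. They are stated together because
  both concern one and the same \<open>d\<close>.\<close>

lemma lift_single: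
  assumes "WW [x]" "cell c" "dm c = [x, y]" "cd c = [x, z]"
  obtains v d where "v \<in> \<W>" "cell d" "dm d = [y, v]" "cd d = [z, v]" "[x] \<lhd> d = c \<rhd> [v]"
      "isoc c \<Longrightarrow> isoc d"
proof -
  note c = assms(2)
  have ty: "x \<in> Arr \<C>" "y \<in> Arr \<C>" "z \<in> Arr \<C>" "Src \<C> x = Trg \<C> y" "Src \<C> x = Trg \<C> z"
      "Src \<C> y = Src \<C> z" "x \<in> \<W>"
    "raw c \<in> Cell \<C>" "Dom \<C> (raw c) = x \<star> y" "Cod \<C> (raw c) = x \<star> z"
    using cell_parallel [OF c] assms by (auto simp: WW_single)
  have "lifts \<C> \<W> x y z (raw c) \<noteq> {}"
    by (rule BF4a [of x "Src \<C> x" "Trg \<C> x" y "Src \<C> y"]) (use ty in \<open>auto simp: Hom1_iff Hom2_iff\<close>)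
  then obtain D v \<beta> where v: "(D, v, \<beta>) \<in> lifts \<C> \<W> x y z (raw c)"
    by auto
  then have *: "v \<in> Arr \<C>" "Trg \<C> v = Src \<C> y" "v \<in> \<W>" "\<beta> \<in> Cell \<C>" "Dom \<C> \<beta> = y \<star> v" "Cod \<C> \<beta> = z \<star> v"
    "RW \<C> x y x z (raw c) v = x \<triangleleft> \<beta>"
    by (auto simp: lifts_def Hom1_iff Hom2_iff)
  define d where "d = ([y, v], \<beta>, [z, v])"
  have d: "cell d" "dm d = [y, v]" "cd d = [z, v]" "raw d = \<beta>"
    using * ty by (auto simp: d_def cell_def)
  have "isoc d" if "isoc c"
  proof -
    have "\<beta> \<in> Iso2 \<C> (y \<star> v) (z \<star> v)"
      by (rule BF4b [of x "Src \<C> x" "Trg \<C> x" y "Src \<C> y" z "raw c", OF _ _ _ _ _ v])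
        (use that ty in \<open>simp_all add: Hom1_iff Iso2_iff isoc_def\<close>)
    then show ?thesis
      using d(1,4) by (simp add: isoc_def Iso2_iff)
  qed
  moreover have "[x] \<lhd> d = c \<rhd> [v]"
  proof (rule proper_eqI)
    have r: "rwr [x, y] [x, z] (raw c) v = x \<triangleleft> \<beta>"
      by (subst RW_eq [symmetric]) (use * ty in simp_all)
    show "cell ([x] \<lhd> d) \<longleftrightarrow> cell (c \<rhd> [v])"
      using * ty c d assms(3,4) by simp
    assume "cell ([x] \<lhd> d)" "cell (c \<rhd> [v])"
    with r show "dm ([x] \<lhd> d) = dm (c \<rhd> [v]) \<and> cd ([x] \<lhd> d) = cd (c \<rhd> [v]) \<and> raw ([x] \<lhd> d)
        = raw (c \<rhd> [v])"
      by (simp add: raw_simps d assms(3,4))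
  qed simp_all
  ultimately show ?thesis
    using that d * by blast
qed

text \<open>The cell \<open>c\<close> is conjugated by \<open>?k1\<close>, \<open>?k2\<close> into a
  cell between lists of length two, lifted there, and the lift is unpacked.\<close>

lemma path_lift:
  assumes "WW w" "cell c" "dm c = w @ f1" "cd c = w @ f2" "arr f1" "arr f2"
  obtains v d where "WW v" "cell d" "dm d = f1 @ v" "cd d = f2 @ v" "w \<lhd> d = c \<rhd> v" "isoc c \<Longrightarrow> isoc d"
proof -
  have ne [simp]: "w \<noteq> []" "f1 \<noteq> []" "f2 \<noteq> []" and ty: "arr w" "src w = trg f1" "src w = trg f2"
      "src f2 = src f1"
    using assms cell_parallel [of c] by auto
  let ?k1 = "([cmp w] \<lhd> pack f1) \<odot> (pack w \<rhd> f1)" and ?k2 = "([cmp w] \<lhd> pack f2) \<odot> (pack w \<rhd> f2)"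
  have k: "isoc ?k1" "dm ?k1 = w @ f1" "cd ?k1 = [cmp w, cmp f1]" "isoc ?k2" "dm ?k2 = w @ f2"
      "cd ?k2 = [cmp w, cmp f2]"
    using assms ty by auto
  define e where "e = ?k2 \<odot> c \<odot> cinv ?k1"
  have e: "cell e" "dm e = [cmp w, cmp f1]" "cd e = [cmp w, cmp f2]" "isoc c \<Longrightarrow> isoc e"
    unfolding e_def using k assms ty by auto
  obtain v b where b: "v \<in> \<W>" "cell b" "dm b = [cmp f1, v]" "cd b = [cmp f2, v]"
      "[cmp w] \<lhd> b = e \<rhd> [v]" "isoc e \<Longrightarrow> isoc b"
    using lift_single [OF _ e(1-3)] assms(1) by (metis WW_def WW_single)
  have v: "v \<in> Arr \<C>" "src f1 = Trg \<C> v"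
    using cell_parallel [of b] b assms by auto
  define d where "d = cinv (pack f2 \<rhd> [v]) \<odot> b \<odot> (pack f1 \<rhd> [v])"
  have d: "cell d" "dm d = f1 @ [v]" "cd d = f2 @ [v]" "isoc c \<Longrightarrow> isoc d"
    unfolding d_def using b e v assms ty by auto
  \<comment> \<open>Equality is tested after composition with the invertible \<open>?k2\<close>:
    exchange moves \<open>pack w\<close> past \<open>d\<close>, the unpacking in \<open>d\<close>
    cancels, and the equation for \<open>b\<close> applies.\<close>
  have "(?k2 \<rhd> [v]) \<odot> (w \<lhd> d) = (?k2 \<rhd> [v]) \<odot> (c \<rhd> [v])"
  proof -
    have "(?k2 \<rhd> [v]) \<odot> (w \<lhd> d) = ([cmp w] \<lhd> pack f2 \<rhd> [v]) \<odot> ([cmp w] \<lhd> d) \<odot> (pack w \<rhd> (f1 @ [v]))"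
      using exchange [of "pack w" w "[cmp w]" d "f1 @ [v]" "f2 @ [v]"] d by simp
    also have "\<dots> = ([cmp w] \<lhd> b) \<odot> (?k1 \<rhd> [v])"
      unfolding d_def using b v assms ty e by simp
    also have "\<dots> = (?k2 \<rhd> [v]) \<odot> (c \<rhd> [v])"
      unfolding b(5) e_def using k assms ty v by simp
    finally show ?thesis .
  qed
  then have "w \<lhd> d = c \<rhd> [v]"
    by (rule vc_left_cancel [rotated 5]) (use k d v assms ty in auto)
  then show ?thesis
    using that [of "[v]" d] b d by (auto simp: WW_single)
qed

text \<open>
  Whiskered with an identity \<open>I\<close>, both cells become lifts in the sense of (BF4a) of the same cell, so
  that (BF4c) compares them.
\<close>

lemma faithful_single:
  assumes "WW [x]" "cell c" "cell d" "dm c = [y]" "cd c = [z]" "dm d = [y]" "cd d = [z]"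
      "[x] \<lhd> c = [x] \<lhd> d" "Src \<C> x = Trg \<C> y"
  obtains v where "WW v" "trg v = Src \<C> y" "c \<rhd> v = d \<rhd> v"
proof -
  have ty: "x \<in> Arr \<C>" "y \<in> Arr \<C>" "z \<in> Arr \<C>" "Src \<C> x = Trg \<C> y" "Src \<C> x = Trg \<C> z"
      "Src \<C> y = Src \<C> z" "x \<in> \<W>"
    using cell_parallel [OF assms(2)] assms WW_arr [OF assms(1)] by (simp_all add: WW_single)
  define I where "I = Id1 \<C> (Src \<C> y)"
  have I: "I \<in> Arr \<C>" "Src \<C> I = Src \<C> y" "Trg \<C> I = Src \<C> y" "I \<in> \<W>"
    using ty Src_Obj BF1 by (auto simp: I_def)
  have lift: "(Src \<C> y, I, raw (b \<rhd> [I])) \<in> lifts \<C> \<W> x y z (raw ([x] \<lhd> b))"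
    if b: "cell b" "dm b = [y]" "cd b = [z]" for b
  proof -
    have "raw ([x] \<lhd> (b \<rhd> [I])) = raw ([x] \<lhd> b \<rhd> [I])" by simp
    then have "RW \<C> x y x z (raw ([x] \<lhd> b)) I = x \<triangleleft> raw (b \<rhd> [I])"
      using b ty I by (simp add: raw_simps RW_eq del: lw_rw)
    moreover have "cell (b \<rhd> [I])" "dm (b \<rhd> [I]) = [y, I]" "cd (b \<rhd> [I]) = [z, I]"
      using b ty I by auto
    ultimately show ?thesis
      using cell_parallel [of "b \<rhd> [I]"] I ty by (auto simp: lifts_def Hom1_iff Hom2_iff)
  qed
  have a: "raw ([x] \<lhd> c) \<in> Hom2 \<C> (x \<star> y) (x \<star> z)"
    using cell_parallel [of "[x] \<lhd> c"] assms ty by (simp add: Hom2_iff)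
  obtain F u u' \<zeta> where u: "u \<in> Hom1 \<C> F (Src \<C> y)" "u' \<in> Hom1 \<C> F (Src \<C> y)"
      "\<zeta> \<in> Iso2 \<C> (I \<star> u) (I \<star> u')" "I \<star> u \<in> \<W>"
    "RW \<C> y I z I (raw (d \<rhd> [I])) u' \<bullet> (y \<triangleleft> \<zeta>) = (z \<triangleleft> \<zeta>) \<bullet> RW \<C> y I z I (raw (c \<rhd> [I])) u"
    using BF4c [of x "Src \<C> x" "Trg \<C> x" y "Src \<C> y" z "raw ([x] \<lhd> c)" "Src \<C> y" I "raw (c \<rhd> [I])"
        "Src \<C> y" I "raw (d \<rhd> [I])"]
      lift [of c] lift [of d] assms ty a by (auto simp: Hom1_iff)
  define Z where "Z = ([I, u], \<zeta>, [I, u'])"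
  have Z: "isoc Z" "dm Z = [I, u]" "cd Z = [I, u']" "raw Z = \<zeta>" and u': "u \<in> Arr \<C>"
      "Trg \<C> u = Src \<C> y" "u' \<in> Arr \<C>" "Trg \<C> u' = Src \<C> y"
    using u I by (auto simp: Z_def isoc_def cell_def Hom1_iff Iso2_iff)
  have eq: "(d \<rhd> [I] \<rhd> [u']) \<odot> ([y] \<lhd> Z) = ([z] \<lhd> Z) \<odot> (c \<rhd> [I] \<rhd> [u])"
    using u(5) Z u' I ty assms by (intro proper_eqI) (simp_all add: raw_simps RW_eq del: rw_rw)
  \<comment> \<open>Exchange moves \<open>Z\<close> past \<open>d\<close>, so that it stands in
    front on both sides and cancels. The remaining precomposition \<open>[I, u]\<close> is in \<W>
    by (BF4c).\<close>
  have "([z] \<lhd> Z) \<odot> (d \<rhd> [I, u]) = ([z] \<lhd> Z) \<odot> (c \<rhd> [I, u])"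
    using eq exchange [of d "[y]" "[z]" Z "[I, u]" "[I, u']"] Z assms by simp
  then have "d \<rhd> [I, u] = c \<rhd> [I, u]"
    by (rule vc_left_cancel [rotated 5]) (use Z u' I ty assms in auto)
  then show ?thesis
    using that [of "[I, u]"] u I u' by (auto simp: WW_def)
qed

text \<open>Conjugation by \<open>pack\<close> reduces to single 1-morphisms: \<open>?p c\<close>
  and \<open>?p d\<close> agree under \<open>cmp w\<close> because \<open>pack w\<close> can be
  exchanged past \<open>c\<close> and \<open>d\<close> and then cancelled.\<close>

lemma path_faithful:
  assumes "WW w" "cell c" "cell d" "dm c = f1" "cd c = f2" "dm d = f1" "cd d = f2" "w \<lhd> c = w \<lhd> d"
      "src w = trg f1"
  obtains v where "WW v" "trg v = src f1" "c \<rhd> v = d \<rhd> v"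
proof -
  have ne [simp]: "w \<noteq> []" "f1 \<noteq> []" "f2 \<noteq> []" and ty: "arr w" "arr f1" "arr f2" "src w = trg f1"
      "src w = trg f2" "src f2 = src f1"
    using assms cell_parallel [of c] by auto
  let ?p = "\<lambda>c. pack f2 \<odot> c \<odot> cinv (pack f1)"
  have p: "cell (?p c)" "dm (?p c) = [cmp f1]" "cd (?p c) = [cmp f2]" "cell (?p d)"
      "dm (?p d) = [cmp f1]" "cd (?p d) = [cmp f2]"
    using assms ty by auto
  have ex: "(pack w \<rhd> f2) \<odot> (w \<lhd> c) = ([cmp w] \<lhd> c) \<odot> (pack w \<rhd> f1)"
      "(pack w \<rhd> f2) \<odot> (w \<lhd> d) = ([cmp w] \<lhd> d) \<odot> (pack w \<rhd> f1)"
    using exchange [of "pack w" w "[cmp w]" c f1 f2] exchange [of "pack w" w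
        "[cmp w]" d f1 f2] assms(4-7) by simp_all
  have "[cmp w] \<lhd> c = [cmp w] \<lhd> d"
    by (rule vc_right_cancel [of "pack w \<rhd> f1"]) (use assms ty ex in auto)
  then have "[cmp w] \<lhd> ?p c = [cmp w] \<lhd> ?p d"
    by simp
  then obtain v where v: "WW v" "trg v = src f1" "?p c \<rhd> v = ?p d \<rhd> v"
    using faithful_single [OF _ p(1,4,2,3,5,6)] ty assms(1) by (metis WW_def WW_single cmp_simps)
  have "c \<rhd> v = (cinv (pack f2) \<odot> ?p c \<odot> pack f1) \<rhd> v" "d \<rhd> v = (cinv (pack f2) \<odot> ?p d \<odot> pack f1) \<rhd> v"
    using assms ty by auto
  then have "c \<rhd> v = d \<rhd> v"
    using v(3) by (metis rw_vc)
  with v that show ?thesis by blast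
qed

end

section \<open>Equivalence of representatives\<close>

context bicategory
begin

abbreviation hom :: "'m list \<Rightarrow> 'o \<Rightarrow> 'o \<Rightarrow> bool" where
  "hom p A B \<equiv> arr p \<and> src p = A \<and> trg p = B"

abbreviation cell_in :: "('m, 't) path_cell \<Rightarrow> 'm list \<Rightarrow> 'm list \<Rightarrow> bool" where
  "cell_in c p q \<equiv> cell c \<and> dm c = p \<and> cd c = q"

abbreviation iso_in :: "('m, 't) path_cell \<Rightarrow> 'm list \<Rightarrow> 'm list \<Rightarrow> bool" where
  "iso_in c p q \<equiv> isoc c \<and> dm c = p \<and> cd c = q"

lemma conjugate_inv:
  assumes "(x2 \<lhd> s2) \<odot> (c \<rhd> z) \<odot> (x1 \<lhd> s1) = c' \<rhd> z'"
    "cell_in c (x1 @ v1) (x2 @ v2)" "iso_in s1 (v1' @ z') (v1 @ z)" "iso_in s2 (v2 @ z) (v2' @ z')"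
    "hom x1 B1 D" "hom x2 B2 D" "hom v1 A3 B1" "hom v2 A3 B2" "hom v1' A3' B1" "hom v2' A3' B2"
        "hom z E A3" "hom z' E A3'"
  shows "(x2 \<lhd> cinv s2) \<odot> (c' \<rhd> z') \<odot> (x1 \<lhd> cinv s1) = c \<rhd> z"
  unfolding assms(1) [symmetric] using assms(2-) by simp

text \<open>The middle legs \<open>z'\<close> and \<open>y\<close> are joined by \<open>l\<close>;
  exchange slides \<open>l\<close> past \<open>c'\<close> to where it meets its inverse. The legs
  \<open>x1\<close>, \<open>x2\<close> are arbitrary, so that the \<alpha>- and the
  \<beta>-components are treated alike.\<close>

lemma conjugate_trans:
  assumes eq: "(x2 \<lhd> s2) \<odot> (c \<rhd> z) \<odot> (x1 \<lhd> s1) = c' \<rhd> z'" "(x2 \<lhd> r2) \<odot> (c' \<rhd> y) \<odot> (x1 \<lhd> r1) = c'' \<rhd> y'"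
    and c: "cell_in c (x1 @ v1) (x2 @ v2)" "cell_in c' (x1 @ v1') (x2 @ v2')"
    and s: "iso_in s1 (v1' @ z') (v1 @ z)" "iso_in s2 (v2 @ z) (v2' @ z')"
    and r: "iso_in r1 (v1'' @ y') (v1' @ y)" "iso_in r2 (v2' @ y) (v2'' @ y')"
    and l: "iso_in l (y @ m) (z' @ n)"
    and h: "hom x1 B1 D" "hom x2 B2 D" "hom v1 A3 B1" "hom v2 A3 B2" "hom v1' A3' B1" "hom v2' A3' B2"
      "hom v1'' A3'' B1" "hom v2'' A3'' B2" "hom z E A3" "hom z' E A3'" "hom y E' A3'"
          "hom y' E' A3''" "hom n E'' E" "hom m E'' E'"
  shows "(x2 \<lhd> ((r2 \<rhd> m) \<odot> (v2' \<lhd> cinv l) \<odot> (s2 \<rhd> n))) \<odot> (c \<rhd> (z @ n)) \<odot> (x1 \<lhd> ((s1 \<rhd> n) \<odot> (v1' \<lhd> l)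
      \<odot> (r1 \<rhd> m)))
     = c'' \<rhd> (y' @ m)"
proof -
  have "((x2 \<lhd> s2) \<odot> (c \<rhd> z) \<odot> (x1 \<lhd> s1)) \<rhd> n = c' \<rhd> z' \<rhd> n"
    using eq(1) by simp
  then have 1: "(x2 \<lhd> s2 \<rhd> n) \<odot> (c \<rhd> (z @ n)) \<odot> (x1 \<lhd> s1 \<rhd> n) = c' \<rhd> (z' @ n)"
    by simp
  have "((x2 \<lhd> r2) \<odot> (c' \<rhd> y) \<odot> (x1 \<lhd> r1)) \<rhd> m = c'' \<rhd> y' \<rhd> m"
    using eq(2) by simp
  then have 2: "(x2 \<lhd> r2 \<rhd> m) \<odot> (c' \<rhd> (y @ m)) \<odot> (x1 \<lhd> r1 \<rhd> m) = c'' \<rhd> (y' @ m)"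
    by simp
  have 3: "(c' \<rhd> (z' @ n)) \<odot> ((x1 @ v1') \<lhd> l) = ((x2 @ v2') \<lhd> l) \<odot> (c' \<rhd> (y @ m))"
    using exchange [of c' "x1 @ v1'" "x2 @ v2'" l "y @ m" "z' @ n"] c l by simp
  have "(x2 \<lhd> ((r2 \<rhd> m) \<odot> (v2' \<lhd> cinv l) \<odot> (s2 \<rhd> n))) \<odot> (c \<rhd> (z @ n)) \<odot> (x1 \<lhd> ((s1 \<rhd> n) \<odot> (v1' \<lhd> l)
      \<odot> (r1 \<rhd> m)))
     = (x2 \<lhd> r2 \<rhd> m) \<odot> ((x2 @ v2') \<lhd> cinv l) \<odot> ((x2 \<lhd> s2 \<rhd> n) \<odot> (c \<rhd> (z @ n)) \<odot> (x1 \<lhd> s1 \<rhd> n))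
         \<odot> ((x1 @ v1') \<lhd> l) \<odot> (x1 \<lhd> r1 \<rhd> m)"
    by simp
  also have "\<dots> = (x2 \<lhd> r2 \<rhd> m) \<odot> ((x2 @ v2') \<lhd> cinv l) \<odot> ((c' \<rhd> (z' @ n)) \<odot> ((x1 @ v1') \<lhd> l))
      \<odot> (x1 \<lhd> r1 \<rhd> m)"
    unfolding 1 by simp
  also have "\<dots> = (x2 \<lhd> r2 \<rhd> m) \<odot> (c' \<rhd> (y @ m)) \<odot> (x1 \<lhd> r1 \<rhd> m)"
    unfolding 3 using c s r l h by simp
  finally show ?thesis
    unfolding 2 .
qed

end

context BF
begin

lemma lift:
  assumes "WW w" "cell_in c (w @ p) (w @ q)" "hom p A B" "hom q A B"
  obtains y d E where "WW y" "hom y E A" "cell_in d (p @ y) (q @ y)" "w \<lhd> d = c \<rhd> y" "isoc c \<Longrightarrow> isoc d"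
proof -
  obtain v d where d: "WW v" "cell d" "dm d = p @ v" "cd d = q @ v" "w \<lhd> d = c \<rhd> v" "isoc c \<Longrightarrow> isoc d"
    using path_lift [of w c p q] assms by metis
  moreover have "hom v (src v) A"
    using cell_parallel [OF d(2)] d assms WW_arr [OF d(1)] by simp
  ultimately show ?thesis
    using that by blast
qed

lemma faithful:
  assumes "WW w" "cell_in c p q" "cell_in d p q" "w \<lhd> c = w \<lhd> d" "src w = trg p"
  obtains y E where "WW y" "hom y E (src p)" "c \<rhd> y = d \<rhd> y"
  using path_faithful [of w c d p q] assms WW_arr by metis

text \<open>(BF3) cannot be applied along \<open>p\<close>, since only \<open>w\<close> and
  \<open>w @ p\<close> are known to be in \<W>. It is applied to \<open>w @ q\<close> against
  \<open>w @ p\<close>, and \<open>w\<close> is then cancelled by a lift, which is invertible by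
  (BF4b).\<close>

lemma fill_lift:
  assumes "WW w" "WW (w @ p)" "hom p A D" "hom q B D" "src w = D"
  obtains y x l E where "WW y" "hom y E B" "hom x E A" "iso_in l (q @ y) (p @ x)"
proof -
  have w: "arr w" using assms by auto
  obtain y x c where c: "WW y" "arr x" "isoc c" "dm c = (w @ q) @ y" "cd c = (w @ p) @ x"
  proof (rule path_BF3 [of "w @ q" "w @ p"])
    show "arr (w @ q)" "WW (w @ p)" "trg (w @ q) = trg (w @ p)"
      using assms w by simp_all
  qed blast
  have yx: "hom y (src y) B" "hom x (src y) A"
    using cell_parallel [OF iso_cell [OF c(3)]] c assms w WW_arr [OF c(1)] by auto
  obtain v d E where d: "WW v" "hom v E (src y)" "cell_in d ((q @ y) @ v) ((p @ x) @ v)"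
      "isoc c \<Longrightarrow> isoc d"
  proof (rule lift [of w c "q @ y" "p @ x" "src y" D])
    show "WW w" "cell_in c (w @ q @ y) (w @ p @ x)" "hom (q @ y) (src y) D" "hom (p @ x) (src y) D"
      using assms c yx w by simp_all
  qed blast
  show ?thesis
    by (rule that [of "y @ v" E "x @ v" d]) (use c d yx in auto)
qed

text \<open>The legs are lists, so that composites such as \<open>w @ w1\<close> and
  \<open>g1 @ f1\<close> can stay unpacked until the result is translated back to
  \<open>frac_reps\<close>.\<close>

definition path_rep where
  "path_rep w1 f1 w2 f2 v1 v2 a b \<longleftrightarrow> (\<exists>A B C B1 B2.
     hom w1 B1 A \<and> hom w2 B2 A \<and> hom f1 B1 B \<and> hom f2 B2 B \<and> hom v1 C B1 \<and> hom v2 C B2 \<and>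
     WW (w1 @ v1) \<and> iso_in a (w1 @ v1) (w2 @ v2) \<and> cell_in b (f1 @ v1) (f2 @ v2))"

definition path_equiv where
  "path_equiv w1 f1 w2 f2 v1 v2 a b v1' v2' a' b' \<longleftrightarrow> (\<exists>z z' s1 s2 E.
     hom z E (src v1) \<and> hom z' E (src v1') \<and> iso_in s1 (v1' @ z') (v1 @ z)
         \<and> iso_in s2 (v2 @ z) (v2' @ z') \<and>
     WW (w1 @ v1 @ z) \<and>
     (w2 \<lhd> s2) \<odot> (a \<rhd> z) \<odot> (w1 \<lhd> s1) = a' \<rhd> z' \<and> (f2 \<lhd> s2) \<odot> (b \<rhd> z) \<odot> (f1 \<lhd> s1) = b' \<rhd> z')"

text \<open>The inverse cells reverse the comparison; membership in \<W> passes from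
  \<open>w1 @ v1 @ z\<close> to \<open>w1 @ v1' @ z'\<close> along \<open>w1 \<lhd> s1\<close> by
  (BF5).\<close>

lemma path_equiv_sym:
  assumes "path_rep w1 f1 w2 f2 v1 v2 a b" "path_rep w1 f1 w2 f2 v1' v2' a' b'"
    "path_equiv w1 f1 w2 f2 v1 v2 a b v1' v2' a' b'"
  shows "path_equiv w1 f1 w2 f2 v1' v2' a' b' v1 v2 a b"
proof -
  obtain A B C B1 B2 where r: "hom w1 B1 A" "hom w2 B2 A" "hom f1 B1 B" "hom f2 B2 B" "hom v1 C B1"
      "hom v2 C B2"
    "WW (w1 @ v1)" "iso_in a (w1 @ v1) (w2 @ v2)" "cell_in b (f1 @ v1) (f2 @ v2)"
    using assms(1) unfolding path_rep_def by blast
  obtain C' where r': "hom v1' C' B1" "hom v2' C' B2"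
    using assms(2) r(1,2) unfolding path_rep_def by blast
  obtain z z' s1 s2 E where z: "hom z E C" "hom z' E C'" "iso_in s1 (v1' @ z') (v1 @ z)"
      "iso_in s2 (v2 @ z) (v2' @ z')"
     "WW (w1 @ v1 @ z)" "(w2 \<lhd> s2) \<odot> (a \<rhd> z) \<odot> (w1 \<lhd> s1) = a' \<rhd> z'"
         "(f2 \<lhd> s2) \<odot> (b \<rhd> z) \<odot> (f1 \<lhd> s1) = b' \<rhd> z'"
    using assms(3) r(5) r'(1) unfolding path_equiv_def by blast
  have "WW (w1 @ v1' @ z')"
    using WW_iso [of "w1 \<lhd> s1"] r r' z by simp
  moreover have "(w2 \<lhd> cinv s2) \<odot> (a' \<rhd> z') \<odot> (w1 \<lhd> cinv s1) = a \<rhd> z"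
    by (rule conjugate_inv [OF z(6) _ z(3,4)]) (use r r' z in auto)
  moreover have "(f2 \<lhd> cinv s2) \<odot> (b' \<rhd> z') \<odot> (f1 \<lhd> cinv s1) = b \<rhd> z"
    by (rule conjugate_inv [OF z(7) _ z(3,4)]) (use r r' z in auto)
  ultimately show ?thesis
    unfolding path_equiv_def using r r' z iso_inv dm_inv by (intro exI [of _ z'] exI [of _ z] exI
        [of _ "cinv s1"] exI [of _ "cinv s2"] exI [of _ E]) simp
qed

text \<open>
  The two legs into the middle representative are filled by (BF3), and the filler is lifted along
  \<open>w1 @ v1'\<close> by (BF4a), (BF4b).
\<close>

lemma path_equiv_trans:
  assumes "path_rep w1 f1 w2 f2 v1 v2 a b" "path_rep w1 f1 w2 f2 v1' v2' a' b'"
      "path_rep w1 f1 w2 f2 v1'' v2'' a'' b''"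
    "path_equiv w1 f1 w2 f2 v1 v2 a b v1' v2' a' b'"
        "path_equiv w1 f1 w2 f2 v1' v2' a' b' v1'' v2'' a'' b''"
  shows "path_equiv w1 f1 w2 f2 v1 v2 a b v1'' v2'' a'' b''"
proof -
  obtain A B C B1 B2 where r: "hom w1 B1 A" "hom w2 B2 A" "hom f1 B1 B" "hom f2 B2 B" "hom v1 C B1"
      "hom v2 C B2"
    "WW (w1 @ v1)" "iso_in a (w1 @ v1) (w2 @ v2)" "cell_in b (f1 @ v1) (f2 @ v2)"
    using assms(1) unfolding path_rep_def by blast
  obtain C' where r': "hom v1' C' B1" "hom v2' C' B2" "WW (w1 @ v1')"
      "iso_in a' (w1 @ v1') (w2 @ v2')" "cell_in b' (f1 @ v1') (f2 @ v2')"
    using assms(2) r(1,2) unfolding path_rep_def by blast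
  obtain C'' where r'': "hom v1'' C'' B1" "hom v2'' C'' B2"
    using assms(3) r(1,2) unfolding path_rep_def by blast
  obtain z z' s1 s2 E where z: "hom z E C" "hom z' E C'" "iso_in s1 (v1' @ z') (v1 @ z)"
      "iso_in s2 (v2 @ z) (v2' @ z')"
     "WW (w1 @ v1 @ z)" "(w2 \<lhd> s2) \<odot> (a \<rhd> z) \<odot> (w1 \<lhd> s1) = a' \<rhd> z'"
         "(f2 \<lhd> s2) \<odot> (b \<rhd> z) \<odot> (f1 \<lhd> s1) = b' \<rhd> z'"
    using assms(4) r(5) r'(1) unfolding path_equiv_def by blast
  obtain y y' r1 r2 E' where y: "hom y E' C'" "hom y' E' C''" "iso_in r1 (v1'' @ y') (v1' @ y)"
      "iso_in r2 (v2' @ y) (v2'' @ y')"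
     "WW (w1 @ v1' @ y)" "(w2 \<lhd> r2) \<odot> (a' \<rhd> y) \<odot> (w1 \<lhd> r1) = a'' \<rhd> y'"
         "(f2 \<lhd> r2) \<odot> (b' \<rhd> y) \<odot> (f1 \<lhd> r1) = b'' \<rhd> y'"
    using assms(5) r''(1) r'(1) unfolding path_equiv_def by blast
  have W0: "WW (w1 @ v1' @ z')"
    using WW_iso [of "w1 \<lhd> s1"] r r' z by simp
  obtain m n l E'' where l: "WW m" "hom m E'' E'" "hom n E'' E" "iso_in l (y @ m) (z' @ n)"
  proof (rule fill_lift [of "w1 @ v1'" z' E C' y E'])
    show "WW (w1 @ v1')" "WW ((w1 @ v1') @ z')" "hom z' E C'" "hom y E' C'" "src (w1 @ v1') = C'"
      using r r' z y W0 by simp_all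
  qed blast
  \<comment> \<open>\<open>n\<close> is not known to be in \<W>, but \<open>m\<close> is; membership
    is shown for \<open>w1 @ v1' @ y @ m\<close> and carried over along \<open>l\<close> and
    \<open>s1\<close>.\<close>
  have W: "WW (w1 @ v1 @ z @ n)"
  proof -
    have "WW ((w1 @ v1' @ y) @ m)"
      by (rule WW_append) (use r r' y l in auto)
    moreover have "isoc ((w1 \<lhd> s1 \<rhd> n) \<odot> ((w1 @ v1') \<lhd> l))"
      using r r' z y l by auto
    ultimately show ?thesis
      using WW_iso [of "(w1 \<lhd> s1 \<rhd> n) \<odot> ((w1 @ v1') \<lhd> l)"] r r' z y l by simp
  qed
  let ?s1 = "(s1 \<rhd> n) \<odot> (v1' \<lhd> l) \<odot> (r1 \<rhd> m)" and ?s2 = "(r2 \<rhd> m) \<odot> (v2' \<lhd> cinv l) \<odot> (s2 \<rhd> n)"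
  have "(w2 \<lhd> ?s2) \<odot> (a \<rhd> (z @ n)) \<odot> (w1 \<lhd> ?s1) = a'' \<rhd> (y' @ m)"
    by (rule conjugate_trans [OF z(6) y(6) _ _ z(3,4) y(3,4) l(4)]) (use r r' r'' z y l in auto)
  moreover have "(f2 \<lhd> ?s2) \<odot> (b \<rhd> (z @ n)) \<odot> (f1 \<lhd> ?s1) = b'' \<rhd> (y' @ m)"
    by (rule conjugate_trans [OF z(7) y(7) _ _ z(3,4) y(3,4) l(4)]) (use r r' r'' z y l in auto)
  moreover have "iso_in ?s1 (v1'' @ y' @ m) (v1 @ z @ n)" "iso_in ?s2 (v2 @ z @ n) (v2'' @ y' @ m)"
    using r r' r'' z y l by auto
  moreover have "hom (z @ n) E'' C" "hom (y' @ m) E'' C''"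
    using z y l by auto
  ultimately show ?thesis
    unfolding path_equiv_def using W r(5) r''(1)
    by (intro exI [of _ "z @ n"] exI [of _ "y' @ m"] exI [of _ ?s1] exI [of _ ?s2] exI [of _ E''])
        (simp del: lw_vc)
qed

end

section \<open>Independence of the data (F5)--(F7)\<close>

context bicategory
begin

lemma iso_in_lw: "iso_in c p q \<Longrightarrow> arr (x @ p) \<Longrightarrow> iso_in (x \<lhd> c) (x @ p) (x @ q)"
  by auto

lemma cell_in_rw: "cell_in c p q \<Longrightarrow> arr (p @ t) \<Longrightarrow> cell_in (c \<rhd> t) (p @ t) (q @ t)"
  by auto

text \<open>Lifting yields an equation solved for the lifted cell. This lemma and the next bring it
  into the form wanted for the comparison, with that cell among the others.\<close>

lemma vc_solve_right: "p = a \<odot> cinv c \<odot> cinv d \<Longrightarrow> isoc c \<Longrightarrow> isoc d \<Longrightarrow> cell a \<Longrightarrow> cd c = dm d \<Longrightarrow> dm a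
    = dm c \<Longrightarrow> p \<odot> d \<odot> c = a"
  by simp

lemma vc_solve_middle: "q = cinv c \<odot> m \<odot> cinv d \<Longrightarrow> isoc c \<Longrightarrow> isoc d \<Longrightarrow> cell m \<Longrightarrow> cd m = cd c \<Longrightarrow> dm m
    = dm d \<Longrightarrow> m = c \<odot> q \<odot> d"
  by simp

end

context BF
begin

text \<open>\<open>r1\<close>, \<open>r2\<close> are the chosen fillers of \<open>(f, v1)\<close>
  and \<open>(f, v2)\<close>, common to both sets of data; \<open>a\<close>, \<open>b\<close> and
  \<open>a'\<close>, \<open>b'\<close> are the components of the two representatives of
  \<Delta>.\<close>

context
  fixes f g1 g2 v1 v2 w1 w2 f1 f2 u1 u2 u1' u2' z z' T1 T2 H T1' T2' H' :: "'m list"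
    and r1 r2 a b a' b' t1 t2 \<phi> S1 S2 \<phi>' S1' S2' :: "('m, 't) path_cell"
    and P B B1 B2 C D1 D2 B3 B3' Q X X' :: 'o
  assumes homs: "hom f P B" "hom v1 B1 B" "hom v2 B2 B" "hom g1 B1 C" "hom g2 B2 C"
      "hom w1 D1 P" "hom w2 D2 P" "hom f1 D1 B1" "hom f2 D2 B2"
      "hom u1 B3 B1" "hom u2 B3 B2" "hom u1' B3' B1" "hom u2' B3' B2" "hom z Q B3" "hom z' Q B3'"
      "hom T1 X D1" "hom T2 X D2" "hom H X B3" "hom T1' X' D1" "hom T2' X' D2" "hom H' X' B3'"
    and cells: "iso_in r1 (f @ w1) (v1 @ f1)" "iso_in r2 (f @ w2) (v2 @ f2)"
      "iso_in a (v1 @ u1) (v2 @ u2)" "cell_in b (g1 @ u1) (g2 @ u2)"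
      "iso_in a' (v1 @ u1') (v2 @ u2')" "cell_in b' (g1 @ u1') (g2 @ u2')"
      "iso_in t1 (u1' @ z') (u1 @ z)" "iso_in t2 (u2 @ z) (u2' @ z')"
      "iso_in \<phi> (w1 @ T1) (w2 @ T2)" "iso_in S1 (f1 @ T1) (u1 @ H)" "iso_in S2 (f2 @ T2) (u2 @ H)"
      "iso_in \<phi>' (w1 @ T1') (w2 @ T2')" "iso_in S1' (f1 @ T1') (u1' @ H')"
          "iso_in S2' (f2 @ T2') (u2' @ H')"
    and a: "(v2 \<lhd> t2) \<odot> (a \<rhd> z) \<odot> (v1 \<lhd> t1) = a' \<rhd> z'"
    and b: "(g2 \<lhd> t2) \<odot> (b \<rhd> z) \<odot> (g1 \<lhd> t1) = b' \<rhd> z'"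
    and F: "(a \<rhd> H) \<odot> (v1 \<lhd> S1) \<odot> (r1 \<rhd> T1) = (v2 \<lhd> S2) \<odot> (r2 \<rhd> T2) \<odot> (f \<lhd> \<phi>)"
    and F': "(a' \<rhd> H') \<odot> (v1 \<lhd> S1') \<odot> (r1 \<rhd> T1') = (v2 \<lhd> S2') \<odot> (r2 \<rhd> T2') \<odot> (f \<lhd> \<phi>')"
    and W: "WW w1" "WW w2" "WW v1" "WW v2" "WW (v1 @ u1)" "WW (v1 @ u1')" "WW (v1 @ u1 @ z)"
        "WW (w1 @ T1)" "WW (w1 @ T1')"
begin

context
  fixes Y Y' K :: "'m list" and l1 l2 h h' :: "('m, 't) path_cell" and E :: 'o
  assumes homs': "hom Y E X" "hom Y' E X'" "hom K E Q"
    and cells': "iso_in l1 (T1' @ Y') (T1 @ Y)" "iso_in l2 (T2 @ Y) (T2' @ Y')"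
      "iso_in h (H @ Y) (z @ K)" "iso_in h' (H' @ Y') (z' @ K)"
    and \<phi>: "(w2 \<lhd> l2) \<odot> (\<phi> \<rhd> Y) \<odot> (w1 \<lhd> l1) = \<phi>' \<rhd> Y'"
    and leg1: "(u1 \<lhd> h) \<odot> (S1 \<rhd> Y) \<odot> (f1 \<lhd> l1) = (t1 \<rhd> K) \<odot> (u1' \<lhd> h') \<odot> (S1' \<rhd> Y')"
begin

text \<open>
  After whiskering by \<open>v2\<close>, the second leg of the comparison is forced by the first one: this is
  what (F7), here \<open>F\<close> and \<open>F'\<close>, is for.
\<close>

lemma second_leg_whiskered:
  "v2 \<lhd> ((t2 \<rhd> K) \<odot> (u2 \<lhd> h) \<odot> (S2 \<rhd> Y)) = v2 \<lhd> ((u2' \<lhd> h') \<odot> (S2' \<rhd> Y') \<odot> (f2 \<lhd> l2))"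
proof (rule vc_right_cancel)
  \<comment> \<open>An invertible cell precomposed to both sides: it supplies \<open>r2\<close> and
    \<phi>, next to which \<open>S2\<close> stands in \<open>F\<close>, and the \<open>l1\<close>
    that occurs in \<open>leg1\<close>.\<close>
  let ?X = "(r2 \<rhd> (T2 @ Y)) \<odot> (f \<lhd> \<phi> \<rhd> Y) \<odot> ((f @ w1) \<lhd> l1)"
  have Fw: "(a \<rhd> (H @ Y)) \<odot> (v1 \<lhd> S1 \<rhd> Y) \<odot> (r1 \<rhd> (T1 @ Y)) = (v2 \<lhd> S2 \<rhd> Y) \<odot> (r2 \<rhd> (T2 @ Y))
      \<odot> (f \<lhd> \<phi> \<rhd> Y)"
    using arg_cong [OF F, of "\<lambda>c. c \<rhd> Y"] by simp
  have Fw': "(a' \<rhd> (H' @ Y')) \<odot> (v1 \<lhd> S1' \<rhd> Y') \<odot> (r1 \<rhd> (T1' @ Y'))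
      = (v2 \<lhd> S2' \<rhd> Y') \<odot> (r2 \<rhd> (T2' @ Y')) \<odot> (f \<lhd> \<phi>' \<rhd> Y')"
    using arg_cong [OF F', of "\<lambda>c. c \<rhd> Y'"] by simp
  have aw: "(v2 \<lhd> t2 \<rhd> K) \<odot> (a \<rhd> (z @ K)) \<odot> (v1 \<lhd> t1 \<rhd> K) = a' \<rhd> (z' @ K)"
    using arg_cong [OF a, of "\<lambda>c. c \<rhd> K"] by simp
  have \<phi>w: "((f @ w2) \<lhd> l2) \<odot> (f \<lhd> \<phi> \<rhd> Y) \<odot> ((f @ w1) \<lhd> l1) = f \<lhd> \<phi>' \<rhd> Y'"
    using arg_cong [OF \<phi>, of "\<lambda>c. f \<lhd> c"] by simp
  have leg1w: "((v1 @ u1) \<lhd> h) \<odot> (v1 \<lhd> S1 \<rhd> Y) \<odot> ((v1 @ f1) \<lhd> l1) = (v1 \<lhd> t1 \<rhd> K)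
      \<odot> ((v1 @ u1') \<lhd> h') \<odot> (v1 \<lhd> S1' \<rhd> Y')"
    using arg_cong [OF leg1, of "\<lambda>c. v1 \<lhd> c"] by simp
  have ah: "((v2 @ u2) \<lhd> h) \<odot> (a \<rhd> (H @ Y)) = (a \<rhd> (z @ K)) \<odot> ((v1 @ u1) \<lhd> h)"
    using cells cells' by (intro exchange [symmetric]) auto
  have ah': "(a' \<rhd> (z' @ K)) \<odot> ((v1 @ u1') \<lhd> h') = ((v2 @ u2') \<lhd> h') \<odot> (a' \<rhd> (H' @ Y'))"
    using cells cells' by (intro exchange) auto
  have rl1: "(r1 \<rhd> (T1 @ Y)) \<odot> ((f @ w1) \<lhd> l1) = ((v1 @ f1) \<lhd> l1) \<odot> (r1 \<rhd> (T1' @ Y'))"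
    using cells cells' by (intro exchange) auto
  have rl2: "(r2 \<rhd> (T2' @ Y')) \<odot> ((f @ w2) \<lhd> l2) = ((v2 @ f2) \<lhd> l2) \<odot> (r2 \<rhd> (T2 @ Y))"
    using cells cells' by (intro exchange) auto
  have "(v2 \<lhd> ((t2 \<rhd> K) \<odot> (u2 \<lhd> h) \<odot> (S2 \<rhd> Y))) \<odot> ?X
     = (v2 \<lhd> t2 \<rhd> K) \<odot> ((v2 @ u2) \<lhd> h) \<odot> ((v2 \<lhd> S2 \<rhd> Y) \<odot> (r2 \<rhd> (T2 @ Y)) \<odot> (f \<lhd> \<phi> \<rhd> Y))
         \<odot> ((f @ w1) \<lhd> l1)"
    by simp
  also have "\<dots> = (v2 \<lhd> t2 \<rhd> K) \<odot> (((v2 @ u2) \<lhd> h) \<odot> (a \<rhd> (H @ Y))) \<odot> (v1 \<lhd> S1 \<rhd> Y)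
      \<odot> ((r1 \<rhd> (T1 @ Y)) \<odot> ((f @ w1) \<lhd> l1))"
    unfolding Fw [symmetric] by simp
  also have "\<dots> = (v2 \<lhd> t2 \<rhd> K) \<odot> (a \<rhd> (z @ K)) \<odot> (((v1 @ u1) \<lhd> h) \<odot> (v1 \<lhd> S1 \<rhd> Y)
      \<odot> ((v1 @ f1) \<lhd> l1)) \<odot> (r1 \<rhd> (T1' @ Y'))"
    unfolding ah rl1 by simp
  also have "\<dots> = ((v2 \<lhd> t2 \<rhd> K) \<odot> (a \<rhd> (z @ K)) \<odot> (v1 \<lhd> t1 \<rhd> K)) \<odot> ((v1 @ u1') \<lhd> h')
      \<odot> (v1 \<lhd> S1' \<rhd> Y') \<odot> (r1 \<rhd> (T1' @ Y'))"
    unfolding leg1w by simp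
  also have "\<dots> = ((a' \<rhd> (z' @ K)) \<odot> ((v1 @ u1') \<lhd> h')) \<odot> (v1 \<lhd> S1' \<rhd> Y') \<odot> (r1 \<rhd> (T1' @ Y'))"
    unfolding aw by simp
  also have "\<dots> = ((v2 @ u2') \<lhd> h') \<odot> ((a' \<rhd> (H' @ Y')) \<odot> (v1 \<lhd> S1' \<rhd> Y') \<odot> (r1 \<rhd> (T1' @ Y')))"
    unfolding ah' by simp
  also have "\<dots> = ((v2 @ u2') \<lhd> h') \<odot> (v2 \<lhd> S2' \<rhd> Y') \<odot> ((r2 \<rhd> (T2' @ Y')) \<odot> ((f @ w2) \<lhd> l2))
      \<odot> (f \<lhd> \<phi> \<rhd> Y) \<odot> ((f @ w1) \<lhd> l1)"
    unfolding Fw' \<phi>w [symmetric] by simp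
  also have "\<dots> = (v2 \<lhd> ((u2' \<lhd> h') \<odot> (S2' \<rhd> Y') \<odot> (f2 \<lhd> l2))) \<odot> ?X"
    unfolding rl2 by simp
  finally show "(v2 \<lhd> ((t2 \<rhd> K) \<odot> (u2 \<lhd> h) \<odot> (S2 \<rhd> Y))) \<odot> ?X = (v2 \<lhd> ((u2' \<lhd> h') \<odot> (S2' \<rhd> Y')
      \<odot> (f2 \<lhd> l2))) \<odot> ?X" .
qed (use homs homs' cells cells' in auto)

text \<open>\<open>b\<close> and \<open>b'\<close> slide past \<open>h\<close> and \<open>h'\<close>
  by exchange and are then related over \<open>z\<close>, \<open>z'\<close>; \<open>leg1\<close>
  matches the sources and \<open>leg2\<close> the targets.\<close>

lemma whiskered_cells_agree:
  assumes leg2: "(t2 \<rhd> K) \<odot> (u2 \<lhd> h) \<odot> (S2 \<rhd> Y) = (u2' \<lhd> h') \<odot> (S2' \<rhd> Y') \<odot> (f2 \<lhd> l2)"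
  shows "((g2 @ f2) \<lhd> l2) \<odot> (((g2 \<lhd> cinv S2) \<odot> (b \<rhd> H) \<odot> (g1 \<lhd> S1)) \<rhd> Y) \<odot> ((g1 @ f1) \<lhd> l1)
    = ((g2 \<lhd> cinv S2') \<odot> (b' \<rhd> H') \<odot> (g1 \<lhd> S1')) \<rhd> Y'" (is "?L = ?R")
proof (rule vc_left_cancel)
  \<comment> \<open>Composition with the invertible \<open>?M\<close> removes the inverse of
    \<open>S2'\<close> and brings in the \<open>h'\<close> past which \<open>b'\<close> is
    moved.\<close>
  let ?M = "((g2 @ u2') \<lhd> h') \<odot> (g2 \<lhd> S2' \<rhd> Y')"
  have bw: "(g2 \<lhd> t2 \<rhd> K) \<odot> (b \<rhd> (z @ K)) \<odot> (g1 \<lhd> t1 \<rhd> K) = b' \<rhd> (z' @ K)"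
    using arg_cong [OF b, of "\<lambda>c. c \<rhd> K"] by simp
  have leg1w: "((g1 @ u1) \<lhd> h) \<odot> (g1 \<lhd> S1 \<rhd> Y) \<odot> ((g1 @ f1) \<lhd> l1) = (g1 \<lhd> t1 \<rhd> K)
      \<odot> ((g1 @ u1') \<lhd> h') \<odot> (g1 \<lhd> S1' \<rhd> Y')"
    using arg_cong [OF leg1, of "\<lambda>c. g1 \<lhd> c"] by simp
  have leg2w: "(g2 \<lhd> t2 \<rhd> K) \<odot> ((g2 @ u2) \<lhd> h) \<odot> (g2 \<lhd> S2 \<rhd> Y) = ((g2 @ u2') \<lhd> h') \<odot> (g2 \<lhd> S2' \<rhd> Y')
      \<odot> ((g2 @ f2) \<lhd> l2)"
    using arg_cong [OF leg2, of "\<lambda>c. g2 \<lhd> c"] by simp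
  have bh: "(b \<rhd> (z @ K)) \<odot> ((g1 @ u1) \<lhd> h) = ((g2 @ u2) \<lhd> h) \<odot> (b \<rhd> (H @ Y))"
    using cells cells' by (intro exchange) auto
  have bh': "((g2 @ u2') \<lhd> h') \<odot> (b' \<rhd> (H' @ Y')) = (b' \<rhd> (z' @ K)) \<odot> ((g1 @ u1') \<lhd> h')"
    using cells cells' by (intro exchange [symmetric]) auto
  have "?M \<odot> ?R = (((g2 @ u2') \<lhd> h') \<odot> (b' \<rhd> (H' @ Y'))) \<odot> (g1 \<lhd> S1' \<rhd> Y')"
    using homs homs' cells cells' by simp
  also have "\<dots> = (g2 \<lhd> t2 \<rhd> K) \<odot> (b \<rhd> (z @ K)) \<odot> ((g1 \<lhd> t1 \<rhd> K) \<odot> ((g1 @ u1') \<lhd> h') \<odot> (g1 \<lhd> S1' \<rhd> Y'))"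
    unfolding bh' bw [symmetric] by simp
  also have "\<dots> = (g2 \<lhd> t2 \<rhd> K) \<odot> ((b \<rhd> (z @ K)) \<odot> ((g1 @ u1) \<lhd> h)) \<odot> (g1 \<lhd> S1 \<rhd> Y) \<odot> ((g1 @ f1) \<lhd> l1)"
    unfolding leg1w [symmetric] by simp
  also have "\<dots> = ((g2 \<lhd> t2 \<rhd> K) \<odot> ((g2 @ u2) \<lhd> h) \<odot> (g2 \<lhd> S2 \<rhd> Y)) \<odot> (g2 \<lhd> cinv S2 \<rhd> Y)
      \<odot> (b \<rhd> (H @ Y)) \<odot> (g1 \<lhd> S1 \<rhd> Y) \<odot> ((g1 @ f1) \<lhd> l1)"
    unfolding bh using homs homs' cells cells' by simp
  also have "\<dots> = ?M \<odot> ?L"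
    unfolding leg2w by simp
  finally show "?M \<odot> ?L = ?M \<odot> ?R" ..
qed (use homs homs' cells cells' in auto)

end

text \<open>
  \<open>l1\<close>, \<open>l2\<close>, \<open>h\<close> come from (BF3) and lifting; \<open>h'\<close> is a lift along \<open>v1 @ u1'\<close>, which is in \<open>\<W>\<close>
  although \<open>u1'\<close> need not be. Every lift and every use of faithfulness costs a further
  precomposition \<open>m2, \<dots>, m6\<close>.
\<close>

lemma whiskered_equiv:
  "path_equiv w1 (g1 @ f1) w2 (g2 @ f2) T1 T2 \<phi> ((g2 \<lhd> cinv S2) \<odot> (b \<rhd> H) \<odot> (g1 \<lhd> S1))
     T1' T2' \<phi>' ((g2 \<lhd> cinv S2') \<odot> (b' \<rhd> H') \<odot> (g1 \<lhd> S1'))"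
proof -
  obtain y0 x0 l0 E0 where 0: "WW y0" "hom y0 E0 X'" "hom x0 E0 X" "iso_in l0 (T1' @ y0) (T1 @ x0)"
  proof (rule fill_lift [of w1 T1 X D1 T1' X'])
    show "WW w1" "WW (w1 @ T1)" "hom T1 X D1" "hom T1' X' D1" "src w1 = D1"
      using W homs by simp_all
  qed blast
  \<comment> \<open>Compatibility with \<phi> and \<phi>' dictates \<open>w2 \<lhd> l2\<close>: back
    along \<phi>, across the inverse of \<open>l0\<close>, out along \<phi>'. Lifting
    \<open>?c2\<close> along \<open>w2\<close> achieves it up to a precomposition.\<close>
  let ?c2 = "(\<phi>' \<rhd> y0) \<odot> (w1 \<lhd> cinv l0) \<odot> (cinv \<phi> \<rhd> x0)"
  have c2: "iso_in ?c2 (w2 @ T2 @ x0) (w2 @ T2' @ y0)"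
    using 0 homs cells by simp
  obtain m2 l2 E2 where 2: "WW m2" "hom m2 E2 E0" "cell_in l2 ((T2 @ x0) @ m2) ((T2' @ y0) @ m2)"
      "w2 \<lhd> l2 = ?c2 \<rhd> m2"
    "isoc ?c2 \<Longrightarrow> isoc l2"
  proof (rule lift [of w2 ?c2 "T2 @ x0" "T2' @ y0" E0 D2])
    show "WW w2" "hom (T2 @ x0) E0 D2" "hom (T2' @ y0) E0 D2"
      using W homs 0 by simp_all
    show "cell_in ?c2 (w2 @ T2 @ x0) (w2 @ T2' @ y0)"
      using c2 iso_cell by blast
  qed blast
  have l2: "iso_in l2 (T2 @ x0 @ m2) (T2' @ y0 @ m2)"
    using 2 c2 by simp
  \<comment> \<open>\<open>z\<close> is filled over \<open>v1 @ u1\<close>; that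
    \<open>v1 @ u1 @ z\<close> is in \<W> comes with the equivalence of the two
    representatives.\<close>
  obtain m3 K h3 E3 where 3: "WW m3" "hom m3 E3 E2" "hom K E3 Q"
      "iso_in h3 ((H @ x0 @ m2) @ m3) (z @ K)"
  proof (rule fill_lift [of "v1 @ u1" z Q B3 "H @ x0 @ m2" E2])
    show "WW (v1 @ u1)" "WW ((v1 @ u1) @ z)" "hom z Q B3" "hom (H @ x0 @ m2) E2 B3" "src (v1 @ u1) = B3"
      using W homs 0 2(2) by simp_all
  qed blast
  let ?x = "x0 @ m2 @ m3" and ?y = "y0 @ m2 @ m3"
  \<comment> \<open>The equation for \<open>S1\<close>, solved for
    \<open>u1' \<lhd> h'\<close>.\<close>
  let ?e = "(cinv t1 \<rhd> K) \<odot> (u1 \<lhd> h3) \<odot> (S1 \<rhd> ?x) \<odot> (f1 \<lhd> l0 \<rhd> (m2 @ m3)) \<odot> (cinv S1' \<rhd> ?y)"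
  have e: "iso_in ?e (u1' @ H' @ ?y) (u1' @ z' @ K)"
    using 0 2(2) 3 homs cells by simp
  have ve: "iso_in (v1 \<lhd> ?e) (v1 @ u1' @ H' @ ?y) (v1 @ u1' @ z' @ K)"
    by (rule iso_in_lw [OF e]) (use 0 2(2) 3 homs in simp)
  obtain m4 h4 E4 where 4: "WW m4" "hom m4 E4 E3" "cell_in h4 ((H' @ ?y) @ m4) ((z' @ K) @ m4)"
      "(v1 @ u1') \<lhd> h4 = (v1 \<lhd> ?e) \<rhd> m4"
    "isoc (v1 \<lhd> ?e) \<Longrightarrow> isoc h4"
  proof (rule lift [of "v1 @ u1'" "v1 \<lhd> ?e" "H' @ ?y" "z' @ K" E3 B3'])
    show "WW (v1 @ u1')" "hom (H' @ ?y) E3 B3'" "hom (z' @ K) E3 B3'"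
      using W homs 0 2(2) 3 by simp_all
    show "cell_in (v1 \<lhd> ?e) ((v1 @ u1') @ H' @ ?y) ((v1 @ u1') @ z' @ K)"
      using ve by (simp only: append_assoc iso_cell)
  qed blast
  have h4: "iso_in h4 (H' @ ?y @ m4) (z' @ K @ m4)"
    using 4(3) 4(5) [OF conjunct1 [OF ve]] by simp
  \<comment> \<open>The lift gives the equation for \<open>S1\<close> only under \<open>v1\<close>;
    faithfulness removes \<open>v1\<close>.\<close>
  obtain m5 E5 where 5: "WW m5" "hom m5 E5 (src (u1' @ H' @ ?y @ m4))"
      "(u1' \<lhd> h4) \<rhd> m5 = (?e \<rhd> m4) \<rhd> m5"
  proof (rule faithful [of v1 "u1' \<lhd> h4" "u1' @ H' @ ?y @ m4" "u1' @ z' @ K @ m4" "?e \<rhd> m4"])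
    show "WW v1" "cell_in (u1' \<lhd> h4) (u1' @ H' @ ?y @ m4) (u1' @ z' @ K @ m4)"
        "src v1 = trg (u1' @ H' @ ?y @ m4)"
      using W homs 0 2(2) 3 4(2) h4 by simp_all
    have "cell_in (?e \<rhd> m4) ((u1' @ H' @ ?y) @ m4) ((u1' @ z' @ K) @ m4)"
    proof (rule cell_in_rw)
      show "cell_in ?e (u1' @ H' @ ?y) (u1' @ z' @ K)"
        using e by (simp only: iso_cell)
    qed (use homs 0 2(2) 3 4(2) in simp)
    then show "cell_in (?e \<rhd> m4) (u1' @ H' @ ?y @ m4) (u1' @ z' @ K @ m4)"
      by (simp only: append_assoc)
    show "v1 \<lhd> u1' \<lhd> h4 = v1 \<lhd> (?e \<rhd> m4)"
      using 4(4) by simp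
  qed blast
  have m5: "hom m5 E5 E4"
    using 5(2) homs 0 2(2) 3 4(2) by simp
  let ?m = "m3 @ m4 @ m5"
  let ?Y = "x0 @ m2 @ ?m" and ?Y' = "y0 @ m2 @ ?m" and ?K = "K @ m4 @ m5"
    and ?l1 = "l0 \<rhd> (m2 @ ?m)" and ?l2 = "l2 \<rhd> ?m" and ?h = "h3 \<rhd> (m4 @ m5)" and ?h' = "h4 \<rhd> m5"
  have homs5: "hom ?Y E5 X" "hom ?Y' E5 X'" "hom ?K E5 Q"
    using 0 2(2) 3 4(2) m5 by simp_all
  have cells5: "iso_in ?l1 (T1' @ ?Y') (T1 @ ?Y)" "iso_in ?l2 (T2 @ ?Y) (T2' @ ?Y')"
      "iso_in ?h (H @ ?Y) (z @ ?K)" "iso_in ?h' (H' @ ?Y') (z' @ ?K)"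
    using homs 0 2(2) l2 3 4(2) h4 m5 by simp_all
  have w2l2: "w2 \<lhd> ?l2 = (\<phi>' \<rhd> ?Y') \<odot> cinv (w1 \<lhd> ?l1) \<odot> cinv (\<phi> \<rhd> ?Y)"
    using arg_cong [OF 2(4), of "\<lambda>c. c \<rhd> ?m"] homs cells 0 2(2) 3 4(2) m5 by simp
  have \<phi>5: "(w2 \<lhd> ?l2) \<odot> (\<phi> \<rhd> ?Y) \<odot> (w1 \<lhd> ?l1) = \<phi>' \<rhd> ?Y'"
    by (rule vc_solve_right [OF w2l2]) (use homs cells 0 2(2) 3 4(2) m5 in simp_all)
  have u1h: "u1' \<lhd> ?h' = cinv (t1 \<rhd> ?K) \<odot> ((u1 \<lhd> ?h) \<odot> (S1 \<rhd> ?Y) \<odot> (f1 \<lhd> ?l1)) \<odot> cinv (S1' \<rhd> ?Y')"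
    using 5(3) homs cells 0 2(2) 3 4(2) m5 by simp
  have leg1: "(u1 \<lhd> ?h) \<odot> (S1 \<rhd> ?Y) \<odot> (f1 \<lhd> ?l1) = (t1 \<rhd> ?K) \<odot> (u1' \<lhd> ?h') \<odot> (S1' \<rhd> ?Y')"
    by (rule vc_solve_middle [OF u1h]) (use homs cells 0 2(2) 3 4(2) m5 in simp_all)
  let ?p = "(t2 \<rhd> ?K) \<odot> (u2 \<lhd> ?h) \<odot> (S2 \<rhd> ?Y)" and ?q = "(u2' \<lhd> ?h') \<odot> (S2' \<rhd> ?Y') \<odot> (f2 \<lhd> ?l2)"
  \<comment> \<open>The equation for \<open>S2\<close> is known under \<open>v2\<close>. Removing
    \<open>v2\<close> costs the last precomposition, under which the equations already obtained
    persist.\<close>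
  obtain m6 E6 where 6: "WW m6" "hom m6 E6 (src (f2 @ T2 @ ?Y))" "?p \<rhd> m6 = ?q \<rhd> m6"
  proof (rule faithful [of v2 ?p "f2 @ T2 @ ?Y" "u2' @ z' @ ?K" ?q])
    show "WW v2" "src v2 = trg (f2 @ T2 @ ?Y)"
      "cell_in ?p (f2 @ T2 @ ?Y) (u2' @ z' @ ?K)" "cell_in ?q (f2 @ T2 @ ?Y) (u2' @ z' @ ?K)"
      using W homs cells 0 2(2) l2 3 4(2) h4 m5 by simp_all
    show "v2 \<lhd> ?p = v2 \<lhd> ?q"
      by (rule second_leg_whiskered [OF homs5 cells5 \<phi>5 leg1])
  qed blast
  have m6: "hom m6 E6 E5"
    using 6(2) homs 0 2(2) 3 4(2) m5 by simp
  have homs6: "hom (?Y @ m6) E6 X" "hom (?Y' @ m6) E6 X'" "hom (?K @ m6) E6 Q"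
    using 0 2(2) 3 4(2) m5 m6 by simp_all
  have cells6: "iso_in (?l1 \<rhd> m6) (T1' @ ?Y' @ m6) (T1 @ ?Y @ m6)"
      "iso_in (?l2 \<rhd> m6) (T2 @ ?Y @ m6) (T2' @ ?Y' @ m6)"
      "iso_in (?h \<rhd> m6) (H @ ?Y @ m6) (z @ ?K @ m6)" "iso_in (?h' \<rhd> m6) (H' @ ?Y' @ m6) (z' @ ?K @ m6)"
    using homs 0 2(2) l2 3 4(2) h4 m5 m6 by simp_all
  have \<phi>6: "(w2 \<lhd> ?l2 \<rhd> m6) \<odot> (\<phi> \<rhd> (?Y @ m6)) \<odot> (w1 \<lhd> ?l1 \<rhd> m6) = \<phi>' \<rhd> (?Y' @ m6)"
    using arg_cong [OF \<phi>5, of "\<lambda>c. c \<rhd> m6"] by simp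
  have leg16: "(u1 \<lhd> ?h \<rhd> m6) \<odot> (S1 \<rhd> (?Y @ m6)) \<odot> (f1 \<lhd> ?l1 \<rhd> m6) = (t1 \<rhd> (?K @ m6))
      \<odot> (u1' \<lhd> ?h' \<rhd> m6) \<odot> (S1' \<rhd> (?Y' @ m6))"
    using arg_cong [OF leg1, of "\<lambda>c. c \<rhd> m6"] by simp
  have leg26: "(t2 \<rhd> (?K @ m6)) \<odot> (u2 \<lhd> ?h \<rhd> m6) \<odot> (S2 \<rhd> (?Y @ m6)) = (u2' \<lhd> ?h' \<rhd> m6)
      \<odot> (S2' \<rhd> (?Y' @ m6)) \<odot> (f2 \<lhd> ?l2 \<rhd> m6)"
    using 6(3) by simp
  \<comment> \<open>\<open>x0\<close> is not known to be in \<W>, but \<open>y0\<close> and all of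
    \<open>m2, ..., m6\<close> are. So membership is shown on the primed side and carried over along
    \<open>l1\<close> by (BF5).\<close>
  have "WW (y0 @ m2 @ m3 @ m4 @ m5 @ m6)"
    using 0(1,2) 2(1,2) 3(1,2) 4(1,2) 5(1) m5 6(1) m6 by simp
  then have "WW ((w1 @ T1') @ y0 @ m2 @ m3 @ m4 @ m5 @ m6)"
    by (rule WW_append [rotated]) (use W(9) homs 0(1,2) in simp_all)
  then have WY: "WW (w1 @ T1 @ ?Y @ m6)"
    using WW_iso [of "w1 \<lhd> ?l1 \<rhd> m6"] homs 0 2(2) 3 4(2) m5 m6 by simp
  have "((g2 @ f2) \<lhd> ?l2 \<rhd> m6) \<odot> (((g2 \<lhd> cinv S2) \<odot> (b \<rhd> H) \<odot> (g1 \<lhd> S1)) \<rhd> (?Y @ m6))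
      \<odot> ((g1 @ f1) \<lhd> ?l1 \<rhd> m6)
    = ((g2 \<lhd> cinv S2') \<odot> (b' \<rhd> H') \<odot> (g1 \<lhd> S1')) \<rhd> (?Y' @ m6)"
    using whiskered_cells_agree [OF homs6 cells6] \<phi>6 leg16 leg26 by simp
  then show ?thesis
    unfolding path_equiv_def using homs homs6 cells6 \<phi>6 WY
    by (intro exI [of _ "?Y @ m6"] exI [of _ "?Y' @ m6"] exI [of _ "?l1 \<rhd> m6"] exI [of _
        "?l2 \<rhd> m6"] exI [of _ E6])
      simp
qed

end

end

section \<open>The classes of the bicategory of fractions\<close>

context BF
begin

lemma frac_hom_iff: "(A', w, f) \<in> frac_hom \<C> \<W> A B \<longleftrightarrow> hom [w] A' A \<and> w \<in> \<W> \<and> hom [f] A' B"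
  by (auto simp: frac_hom_def Hom1_iff)

lemma frac_reps_iff:
  assumes "hom [w1] A1 A" "hom [w2] A2 A" "hom [f1] A1 B" "hom [f2] A2 B"
  shows "(A3, v1, v2, \<alpha>, \<beta>) \<in> frac_reps \<C> \<W> (A1, w1, f1) (A2, w2, f2) \<longleftrightarrow>
    Src \<C> v1 = A3 \<and> path_rep [w1] [f1] [w2] [f2] [v1] [v2] ([w1, v1], \<alpha>, [w2, v2]) ([f1, v1], \<beta>,
        [f2, v2])"
  using assms by (auto simp: path_rep_def WW_def isoc_def cell_def Iso2_iff Hom1_iff Hom2_iff)

text \<open>A comparison along lists \<open>z\<close>, \<open>z'\<close> becomes one along
  1-morphisms on taking \<open>cmp\<close>, since right whiskering depends only on the composite;
  conversely, a 1-morphism is a list of length one.\<close>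

lemma frac_equiv_iff:
  assumes h: "hom [w1] A1 A" "hom [w2] A2 A" "hom [f1] A1 B" "hom [f2] A2 B"
    and r: "(A3, v1, v2, \<alpha>, \<beta>) \<in> frac_reps \<C> \<W> (A1, w1, f1) (A2, w2, f2)"
    and r': "(A3', v1', v2', \<alpha>', \<beta>') \<in> frac_reps \<C> \<W> (A1, w1, f1) (A2, w2, f2)"
  shows "((A3, v1, v2, \<alpha>, \<beta>), (A3', v1', v2', \<alpha>', \<beta>')) \<in> frac_equiv \<C> \<W> (A1, w1, f1) (A2, w2, f2) \<longleftrightarrow>
    path_equiv [w1] [f1] [w2] [f2] [v1] [v2] ([w1, v1], \<alpha>, [w2, v2]) ([f1, v1], \<beta>, [f2, v2])
      [v1'] [v2'] ([w1, v1'], \<alpha>', [w2, v2']) ([f1, v1'], \<beta>', [f2, v2'])"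
    (is "?l \<longleftrightarrow> ?r")
proof -
  let ?a = "([w1, v1], \<alpha>, [w2, v2])" and ?b = "([f1, v1], \<beta>, [f2, v2])"
  let ?a' = "([w1, v1'], \<alpha>', [w2, v2'])" and ?b' = "([f1, v1'], \<beta>', [f2, v2'])"
  have v: "hom [v1] A3 A1" "hom [v2] A3 A2" "cell ?a" "cell ?b"
    using r h by (auto simp: cell_def Iso2_iff Hom1_iff Hom2_iff)
  have v': "hom [v1'] A3' A1" "hom [v2'] A3' A2" "cell ?a'" "cell ?b'"
    using r' h by (auto simp: cell_def Iso2_iff Hom1_iff Hom2_iff)
  \<comment> \<open>Stated for arbitrary legs \<open>x1\<close>, \<open>x2\<close>, to be used with
    \<open>w1\<close>, \<open>w2\<close> and again with \<open>f1\<close>,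
    \<open>f2\<close>.\<close>
  have eq: "(x2 \<triangleleft> raw s2) \<bullet> RW \<C> x1 v1 x2 v2 (raw c) (cmp z) \<bullet> (x1 \<triangleleft> raw s1)
      = RW \<C> x1 v1' x2 v2' (raw c') (cmp z')
     \<longleftrightarrow> ([x2] \<lhd> s2) \<odot> (c \<rhd> z) \<odot> ([x1] \<lhd> s1) = c' \<rhd> z'"
    if "cell_in c [x1, v1] [x2, v2]" "cell_in c' [x1, v1'] [x2, v2']" "hom [x1] A1 M" "hom [x2] A2 M"
      "hom z E A3" "hom z' E A3'" "cell_in s1 ([v1'] @ z') ([v1] @ z)"
          "cell_in s2 ([v2] @ z) ([v2'] @ z')" for x1 x2 c c' z z' s1 s2 M E
  proof -
    have c: "cell (([x2] \<lhd> s2) \<odot> (c \<rhd> z) \<odot> ([x1] \<lhd> s1))" "cell (c' \<rhd> z')"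
      using that v v' by auto
    have "([x2] \<lhd> s2) \<odot> (c \<rhd> z) \<odot> ([x1] \<lhd> s1) = c' \<rhd> z'
      \<longleftrightarrow> raw (([x2] \<lhd> s2) \<odot> (c \<rhd> z) \<odot> ([x1] \<lhd> s1)) = raw (c' \<rhd> z')"
    proof
      assume "raw (([x2] \<lhd> s2) \<odot> (c \<rhd> z) \<odot> ([x1] \<lhd> s1)) = raw (c' \<rhd> z')"
      then show "([x2] \<lhd> s2) \<odot> (c \<rhd> z) \<odot> ([x1] \<lhd> s1) = c' \<rhd> z'"
        by (intro proper_eqI) (use c that v v' in simp_all)
    qed simp
    moreover have
        "raw (([x2] \<lhd> s2) \<odot> (c \<rhd> z) \<odot> ([x1] \<lhd> s1)) = (x2 \<triangleleft> raw s2) \<bullet> RW \<C> x1 v1 x2 v2 (raw c) (cmp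
        z) \<bullet> (x1 \<triangleleft> raw s1)"
      using that v v' by (simp add: raw_simps RW_eq)
    moreover have "raw (c' \<rhd> z') = RW \<C> x1 v1' x2 v2' (raw c') (cmp z')"
      using that v v' by (simp add: raw_simps RW_eq)
    ultimately show ?thesis
      by simp
  qed
  show ?thesis
  proof
    assume ?l
    then obtain E z z' \<sigma>1 \<sigma>2 where z: "hom [z] E A3" "hom [z'] E A3'"
        "\<sigma>1 \<in> Iso2 \<C> (v1' \<star> z') (v1 \<star> z)" "\<sigma>2 \<in> Iso2 \<C> (v2 \<star> z) (v2' \<star> z')"
           "w1 \<star> (v1 \<star> z) \<in> \<W>"
           "(w2 \<triangleleft> \<sigma>2) \<bullet> RW \<C> w1 v1 w2 v2 \<alpha> z \<bullet> (w1 \<triangleleft> \<sigma>1) = RW \<C> w1 v1' w2 v2' \<alpha>' z'"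
           "(f2 \<triangleleft> \<sigma>2) \<bullet> RW \<C> f1 v1 f2 v2 \<beta> z \<bullet> (f1 \<triangleleft> \<sigma>1) = RW \<C> f1 v1' f2 v2' \<beta>' z'"
      by (auto simp: Hom1_iff)
    define s1 where "s1 = ([v1', z'], \<sigma>1, [v1, z])"
    define s2 where "s2 = ([v2, z], \<sigma>2, [v2', z'])"
    have s: "iso_in s1 ([v1'] @ [z']) ([v1] @ [z])" "iso_in s2 ([v2] @ [z]) ([v2'] @ [z'])"
        "raw s1 = \<sigma>1" "raw s2 = \<sigma>2"
      using z(1-4) v v' by (auto simp: s1_def s2_def isoc_def cell_def Iso2_iff)
    show ?r
      unfolding path_equiv_def
    proof (rule exI [of _ "[z]"], rule exI [of _ "[z']"], rule exI [of _ s1], rule exI [of _ s2],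
        rule exI [of _ E], intro conjI)
      show "([w2] \<lhd> s2) \<odot> (?a \<rhd> [z]) \<odot> ([w1] \<lhd> s1) = ?a' \<rhd> [z']"
        by (rule iffD1 [OF eq [where M = A and E = E]]) (use z(1,2,6) s v v' h in simp_all)
      show "([f2] \<lhd> s2) \<odot> (?b \<rhd> [z]) \<odot> ([f1] \<lhd> s1) = ?b' \<rhd> [z']"
        by (rule iffD1 [OF eq [where M = B and E = E]]) (use z(1,2,7) s v v' h in simp_all)
      show "WW ([w1] @ [v1] @ [z])"
        using z(1,5) v h by (simp add: WW_def)
    qed (use z(1,2) v v' s in simp_all)
  next
    assume ?r
    then obtain z z' s1 s2 E where z: "hom z E A3" "hom z' E A3'"
        "iso_in s1 ([v1'] @ z') ([v1] @ z)" "iso_in s2 ([v2] @ z) ([v2'] @ z')"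
      "WW ([w1] @ [v1] @ z)" "([w2] \<lhd> s2) \<odot> (?a \<rhd> z) \<odot> ([w1] \<lhd> s1) = ?a' \<rhd> z'"
          "([f2] \<lhd> s2) \<odot> (?b \<rhd> z) \<odot> ([f1] \<lhd> s1) = ?b' \<rhd> z'"
      unfolding path_equiv_def using v v' by auto
    have "(w2 \<triangleleft> raw s2) \<bullet> RW \<C> w1 v1 w2 v2 (raw ?a) (cmp z) \<bullet> (w1 \<triangleleft> raw s1)
        = RW \<C> w1 v1' w2 v2' (raw ?a') (cmp z')"
      by (rule iffD2 [OF eq [where M = A and E = E]]) (use z v v' h in simp_all)
    moreover have "(f2 \<triangleleft> raw s2) \<bullet> RW \<C> f1 v1 f2 v2 (raw ?b) (cmp z) \<bullet> (f1 \<triangleleft> raw s1)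
        = RW \<C> f1 v1' f2 v2' (raw ?b') (cmp z')"
      by (rule iffD2 [OF eq [where M = B and E = E]]) (use z v v' h in simp_all)
    moreover have "raw s1 \<in> Iso2 \<C> (v1' \<star> cmp z') (v1 \<star> cmp z)"
        "raw s2 \<in> Iso2 \<C> (v2 \<star> cmp z) (v2' \<star> cmp z')"
      using z(1-4) cell_parallel [of s1] cell_parallel [of s2] by (simp_all add: Iso2_iff isoc_def)
    moreover have "cmp z \<in> Hom1 \<C> E A3" "cmp z' \<in> Hom1 \<C> E A3'" "w1 \<star> (v1 \<star> cmp z) \<in> \<W>"
      using z(1,2,5) by (simp_all add: Hom1_iff WW_def)
    ultimately show ?l
      using r r' by simp blast
  qed
qed

lemma frac_equiv_sym:
  assumes "F \<in> frac_hom \<C> \<W> A B" "G \<in> frac_hom \<C> \<W> A B" "(r, s) \<in> frac_equiv \<C> \<W> F G"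
  shows "(s, r) \<in> frac_equiv \<C> \<W> F G"
proof -
  obtain A1 w1 f1 A2 w2 f2 where FG: "F = (A1, w1, f1)" "G = (A2, w2, f2)"
    by (metis prod_cases3)
  obtain A3 v1 v2 \<alpha> \<beta> A3' v1' v2' \<alpha>' \<beta>' where rs: "r = (A3, v1, v2, \<alpha>, \<beta>)" "s = (A3', v1', v2', \<alpha>', \<beta>')"
    by (metis prod_cases5)
  have h: "hom [w1] A1 A" "hom [w2] A2 A" "hom [f1] A1 B" "hom [f2] A2 B"
    using assms(1,2) unfolding FG frac_hom_iff by auto
  have R: "r \<in> frac_reps \<C> \<W> F G" "s \<in> frac_reps \<C> \<W> F G"
    using assms(3) unfolding FG rs by auto
  show ?thesis
    using assms(3) R path_equiv_sym unfolding FG rs frac_equiv_iff [OF h R [unfolded FG rs]]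
      frac_equiv_iff [OF h R(2,1) [unfolded FG rs]] frac_reps_iff [OF h] by blast
qed

lemma frac_equiv_trans:
  assumes "F \<in> frac_hom \<C> \<W> A B" "G \<in> frac_hom \<C> \<W> A B" "(r, s) \<in> frac_equiv \<C> \<W> F G"
      "(s, t) \<in> frac_equiv \<C> \<W> F G"
  shows "(r, t) \<in> frac_equiv \<C> \<W> F G"
proof -
  obtain A1 w1 f1 A2 w2 f2 where FG: "F = (A1, w1, f1)" "G = (A2, w2, f2)"
    by (metis prod_cases3)
  obtain A3 v1 v2 \<alpha> \<beta> A3' v1' v2' \<alpha>' \<beta>' A3'' v1'' v2'' \<alpha>'' \<beta>'' where
    rs: "r = (A3, v1, v2, \<alpha>, \<beta>)" "s = (A3', v1', v2', \<alpha>', \<beta>')" "t = (A3'', v1'', v2'', \<alpha>'', \<beta>'')"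
    by (metis prod_cases5)
  have h: "hom [w1] A1 A" "hom [w2] A2 A" "hom [f1] A1 B" "hom [f2] A2 B"
    using assms(1,2) unfolding FG frac_hom_iff by auto
  have R: "r \<in> frac_reps \<C> \<W> F G" "s \<in> frac_reps \<C> \<W> F G" "t \<in> frac_reps \<C> \<W> F G"
    using assms(3,4) unfolding FG rs by auto
  show ?thesis
    using assms(3,4) R path_equiv_trans unfolding FG rs frac_equiv_iff [OF h R(1,2) [unfolded FG rs]]
      frac_equiv_iff [OF h R(2,3) [unfolded FG rs]] frac_equiv_iff [OF h R(1,3) [unfolded FG rs]]
          frac_reps_iff [OF h] by blast
qed

lemma frac_class_eq:
  assumes "F \<in> frac_hom \<C> \<W> A B" "G \<in> frac_hom \<C> \<W> A B" "(r, s) \<in> frac_equiv \<C> \<W> F G"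
  shows "frac_class \<C> \<W> F G r = frac_class \<C> \<W> F G s"
  using assms frac_equiv_sym frac_equiv_trans unfolding frac_class_def by blast

text \<open>\<open>z\<close>, \<open>z'\<close>, \<open>s1\<close>, \<open>s2\<close> are kept:
  isomorphisms of the legs slide past \<open>s1\<close>, \<open>s2\<close> by exchange. With
  \<open>pack\<close> for these isomorphisms, lists such as \<open>[w, w1]\<close> are replaced by
  the single composites in \<open>frac_comp\<close>.\<close>

lemma path_equiv_conjugate:
  assumes "path_equiv w1 f1 w2 f2 v1 v2 a b v1' v2' a' b'"
    "path_rep w1 f1 w2 f2 v1 v2 a b" "path_rep w1 f1 w2 f2 v1' v2' a' b'"
    "iso_in k1 w1 x1" "iso_in k2 w2 x2" "iso_in j1 f1 y1" "iso_in j2 f2 y2"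
  shows "path_equiv x1 y1 x2 y2
      v1 v2 ((k2 \<rhd> v2) \<odot> a \<odot> cinv (k1 \<rhd> v1)) ((j2 \<rhd> v2) \<odot> b \<odot> cinv (j1 \<rhd> v1))
      v1' v2' ((k2 \<rhd> v2') \<odot> a' \<odot> cinv (k1 \<rhd> v1')) ((j2 \<rhd> v2') \<odot> b' \<odot> cinv (j1 \<rhd> v1'))"
proof -
  obtain A B C B1 B2 where r: "hom w1 B1 A" "hom w2 B2 A" "hom f1 B1 B" "hom f2 B2 B" "hom v1 C B1"
      "hom v2 C B2"
    "WW (w1 @ v1)" "iso_in a (w1 @ v1) (w2 @ v2)" "cell_in b (f1 @ v1) (f2 @ v2)"
    using assms(2) unfolding path_rep_def by blast
  obtain C' where r': "hom v1' C' B1" "hom v2' C' B2" "iso_in a' (w1 @ v1') (w2 @ v2')"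
      "cell_in b' (f1 @ v1') (f2 @ v2')"
    using assms(3) r(1,2) unfolding path_rep_def by blast
  obtain z z' s1 s2 E where z: "hom z E C" "hom z' E C'" "iso_in s1 (v1' @ z') (v1 @ z)"
      "iso_in s2 (v2 @ z) (v2' @ z')"
     "WW (w1 @ v1 @ z)" "(w2 \<lhd> s2) \<odot> (a \<rhd> z) \<odot> (w1 \<lhd> s1) = a' \<rhd> z'"
         "(f2 \<lhd> s2) \<odot> (b \<rhd> z) \<odot> (f1 \<lhd> s1) = b' \<rhd> z'"
    using assms(1) r(5) r'(1) unfolding path_equiv_def by blast
  have x: "hom x1 B1 A" "hom x2 B2 A" "hom y1 B1 B" "hom y2 B2 B"
    using assms(4-7) r cell_parallel [of k1] cell_parallel [of k2] cell_parallel [of j1]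
        cell_parallel [of j2] by auto
  have W: "WW (x1 @ v1 @ z)"
    using WW_iso [of "k1 \<rhd> (v1 @ z)"] assms(4) z(1,5) r by simp
  have eq: "(n2 \<lhd> s2) \<odot> (((k2 \<rhd> v2) \<odot> c \<odot> cinv (k1 \<rhd> v1)) \<rhd> z) \<odot> (n1 \<lhd> s1) = ((k2 \<rhd> v2') \<odot> c'
      \<odot> cinv (k1 \<rhd> v1')) \<rhd> z'"
    if e: "(m2 \<lhd> s2) \<odot> (c \<rhd> z) \<odot> (m1 \<lhd> s1) = c' \<rhd> z'" and k: "iso_in k1 m1 n1" "iso_in k2 m2 n2"
      and m: "hom m1 B1 D" "hom m2 B2 D" "hom n1 B1 D" "hom n2 B2 D" and c:
          "cell_in c (m1 @ v1) (m2 @ v2)" "cell_in c' (m1 @ v1') (m2 @ v2')"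
    for m1 m2 n1 n2 k1 k2 c c' D
  proof -
    have 1: "(n2 \<lhd> s2) \<odot> (k2 \<rhd> (v2 @ z)) = (k2 \<rhd> (v2' @ z')) \<odot> (m2 \<lhd> s2)"
      using k z by (intro exchange [symmetric]) auto
    have 2: "(cinv k1 \<rhd> (v1 @ z)) \<odot> (n1 \<lhd> s1) = (m1 \<lhd> s1) \<odot> (cinv k1 \<rhd> (v1' @ z'))"
      using k z by (intro exchange) auto
    have "(n2 \<lhd> s2) \<odot> (((k2 \<rhd> v2) \<odot> c \<odot> cinv (k1 \<rhd> v1)) \<rhd> z) \<odot> (n1 \<lhd> s1)
       = ((n2 \<lhd> s2) \<odot> (k2 \<rhd> (v2 @ z))) \<odot> (c \<rhd> z) \<odot> ((cinv k1 \<rhd> (v1 @ z)) \<odot> (n1 \<lhd> s1))"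
      using k m r(5,6) by simp
    also have "\<dots> = (k2 \<rhd> (v2' @ z')) \<odot> ((m2 \<lhd> s2) \<odot> (c \<rhd> z) \<odot> (m1 \<lhd> s1)) \<odot> (cinv k1 \<rhd> (v1' @ z'))"
      unfolding 1 2 by simp
    also have "\<dots> = ((k2 \<rhd> v2') \<odot> c' \<odot> cinv (k1 \<rhd> v1')) \<rhd> z'"
      unfolding e using k m r'(1,2) by simp
    finally show ?thesis .
  qed
  show ?thesis
    unfolding path_equiv_def
    using z(1-4) r(5) r'(1) W eq [OF z(6) assms(4,5) r(1,2) x(1,2)] eq [OF z(7) assms(6,7) r(3,4)
        x(3,4)] r(8,9) r'(3,4)
    by (intro exI [of _ z] exI [of _ z'] exI [of _ s1] exI [of _ s2] exI [of _ E]) (simp del: rw_vc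
        inv_rw)
qed

end

section \<open>Data (F5)--(F7) as cells\<close>

context bicategory
begin

lemma Inv2_RW:
  assumes "iso2 \<theta>" "Dom \<C> \<theta> = x \<star> y" "Cod \<C> \<theta> = x' \<star> y'" "hom [y] A B" "hom [x] B C" "hom [y'] A B'"
      "hom [x'] B' C" "hom [t] E A"
  shows "iso2 (RW \<C> x y x' y' \<theta> t)" "Inv2 \<C> (RW \<C> x y x' y' \<theta> t) = RW \<C> x' y' x y (Inv2 \<C> \<theta>) t"
    "Dom \<C> (RW \<C> x y x' y' \<theta> t) = x \<star> y \<star> t" "Cod \<C> (RW \<C> x y x' y' \<theta> t) = x' \<star> y' \<star> t"
  using assms iso2_rwr [of "[x, y]" "[x', y']" t \<theta>] rwr_simps [of "[x, y]" "[x', y']" t \<theta>]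
      by (simp_all add: RW_eq)

text \<open>The list counterpart of \<open>F7_cell\<close>; the whiskerings by \<open>t3\<close> and
  \<open>t4\<close> are already contained in \<open>T1\<close>, \<open>T2\<close>,
  \<open>H2\<close>, \<open>s1\<close>, \<open>s2\<close>.\<close>

definition F7_path where
  "F7_path f v1 v2 a r1 r2 T1 T2 H2 s1 s2 \<phi> =
     (cinv a \<rhd> H2) \<odot> (v2 \<lhd> s2) \<odot> (r2 \<rhd> T2) \<odot> (f \<lhd> \<phi>) \<odot> (cinv r1 \<rhd> T1) \<odot> (v1 \<lhd> cinv s1)"

context
  fixes f v1 v2 u1 u2 w1 w2 f1 f2 T1 T2 H1 H2 :: "'m list" and a r1 r2 s1 s2 \<phi> :: "('m, 't) path_cell"
    and P B B1 B2 B3 D1 D2 X :: 'o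
  assumes homs: "hom f P B" "hom v1 B1 B" "hom v2 B2 B" "hom u1 B3 B1" "hom u2 B3 B2" "hom w1 D1 P"
      "hom w2 D2 P" "hom f1 D1 B1" "hom f2 D2 B2"
      "hom T1 X D1" "hom T2 X D2" "hom H1 X B3" "hom H2 X B3"
    and isos: "iso_in a (v1 @ u1) (v2 @ u2)" "iso_in r1 (f @ w1) (v1 @ f1)"
        "iso_in r2 (f @ w2) (v2 @ f2)"
      "iso_in \<phi> (w1 @ T1) (w2 @ T2)" "iso_in s1 (f1 @ T1) (u1 @ H1)" "iso_in s2 (f2 @ T2) (u2 @ H2)"
begin

lemma F7_path_iso: "iso_in (F7_path f v1 v2 a r1 r2 T1 T2 H2 s1 s2 \<phi>) (v1 @ u1 @ H1) (v1 @ u1 @ H2)"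
  unfolding F7_path_def using homs isos by simp

text \<open>D(W) produces \<delta> only after precomposition with some \<open>r\<close>; the
  whiskered equation is then (F7) for the precomposed data.\<close>

lemma F7_path_rw:
  assumes "hom t E X"
  shows "F7_path f v1 v2 a r1 r2 T1 T2 H2 s1 s2 \<phi> \<rhd> t
    = F7_path f v1 v2 a r1 r2 (T1 @ t) (T2 @ t) (H2 @ t) (s1 \<rhd> t) (s2 \<rhd> t) (\<phi> \<rhd> t)"
  unfolding F7_path_def using homs isos assms by simp

text \<open>
  \<open>\<delta>\<close> disappears when it is absorbed into the second leg; the condition (F7) becomes symmetric.
\<close>

lemma F7_path_compat:
  assumes d: "iso_in d H1 H2" "(v1 @ u1) \<lhd> d = F7_path f v1 v2 a r1 r2 T1 T2 H2 s1 s2 \<phi>"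
  shows "(a \<rhd> H1) \<odot> (v1 \<lhd> s1) \<odot> (r1 \<rhd> T1) = (v2 \<lhd> ((u2 \<lhd> cinv d) \<odot> s2)) \<odot> (r2 \<rhd> T2) \<odot> (f \<lhd> \<phi>)"
proof (rule vc_left_cancel)
  let ?M = "(v2 @ u2) \<lhd> d"
  have ex: "((v2 @ u2) \<lhd> d) \<odot> (a \<rhd> H1) = (a \<rhd> H2) \<odot> ((v1 @ u1) \<lhd> d)"
    using d isos by (intro exchange [symmetric]) auto
  have "?M \<odot> (a \<rhd> H1) \<odot> (v1 \<lhd> s1) \<odot> (r1 \<rhd> T1) = (((v2 @ u2) \<lhd> d) \<odot> (a \<rhd> H1)) \<odot> (v1 \<lhd> s1) \<odot> (r1 \<rhd> T1)"
    by simp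
  also have "\<dots> = (v2 \<lhd> s2) \<odot> (r2 \<rhd> T2) \<odot> (f \<lhd> \<phi>)"
    unfolding ex d(2) F7_path_def using homs isos d(1) by simp
  also have "\<dots> = ?M \<odot> (v2 \<lhd> ((u2 \<lhd> cinv d) \<odot> s2)) \<odot> (r2 \<rhd> T2) \<odot> (f \<lhd> \<phi>)"
    using homs isos d(1) by simp
  finally show "?M \<odot> (a \<rhd> H1) \<odot> (v1 \<lhd> s1) \<odot> (r1 \<rhd> T1) = ?M \<odot> (v2 \<lhd> ((u2 \<lhd> cinv d) \<odot> s2)) \<odot> (r2 \<rhd> T2)
      \<odot> (f \<lhd> \<phi>)" .
qed (use homs isos d(1) in auto)

end

text \<open>The splitting of the lists is left open, only their composites being prescribed. So one
  translation serves \<open>[t1 \<star> t3]\<close> for given data and \<open>[t1, s3]\<close>,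
  \<open>[t1, s3, r]\<close> for the selected data.\<close>

lemma raw_F7_path:
  assumes "hom [f] P B" "hom [v1] B1 B" "hom [v2] B2 B" "hom [u1] B3 B1" "hom [u2] B3 B2"
      "hom [w1] D1 P" "hom [w2] D2 P"
      "hom [f1] D1 B1" "hom [f2] D2 B2" "hom T1 X D1" "hom T2 X D2" "hom H1 X B3" "hom H2 X B3"
      "hom [t1] D3 D1" "hom [t2] D4 D2" "hom [h1] D3 B3" "hom [h2] D4 B3" "hom [t3] X D3"
          "hom [t4] X D4"
    and "iso_in a [v1, u1] [v2, u2]" "iso_in r1 [f, w1] [v1, f1]" "iso_in r2 [f, w2] [v2, f2]"
      "iso_in p (w1 # T1) (w2 # T2)" "iso_in s1 (f1 # T1) (u1 # H1)" "iso_in s2 (f2 # T2) (u2 # H2)"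
    and "cmp T1 = t1 \<star> t3" "cmp T2 = t2 \<star> t4" "cmp H1 = h1 \<star> t3" "cmp H2 = h2 \<star> t4"
    and "iso2 \<sigma>1" "Dom \<C> \<sigma>1 = f1 \<star> t1" "Cod \<C> \<sigma>1 = u1 \<star> h1" "raw s1 = RW \<C> f1 t1 u1 h1 \<sigma>1 t3"
      "raw s2 = RW \<C> f2 t2 u2 h2 \<sigma>2 t4"
  shows "raw (F7_path [f] [v1] [v2] a r1 r2 T1 T2 H2 s1 s2 p)
    = F7_cell \<C> f v1 v2 u1 u2 (raw a) w1 f1 (raw r1) w2 f2 (raw r2) t1 t2 h1 h2 \<sigma>1 \<sigma>2 t3 t4 (raw p)"
proof -
  have c: "cell (F7_path [f] [v1] [v2] a r1 r2 T1 T2 H2 s1 s2 p)"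
    using F7_path_iso [of "[f]" P B "[v1]" B1 "[v2]" B2 "[u1]" B3 "[u2]" "[w1]" D1 "[w2]" D2 "[f1]"
        "[f2]" T1 X T2 H1 H2 a r1 r2 p s1 s2] assms
    by simp
  have ne: "H2 \<noteq> []" "T1 \<noteq> []" "T2 \<noteq> []"
    using assms(10-13) by auto
  have ht: "hom [h2 \<star> t4] X B3" "hom [t1 \<star> t3] X D1" "hom [t2 \<star> t4] X D2"
    using assms(14-19) by simp_all
  have "raw (cinv a \<rhd> H2) = rwr [v2, u2] [v1, u1] (Inv2 \<C> (raw a)) (h2 \<star> t4)"
    using assms(2-5,13,20) ne by (subst raw_simps) (simp_all add: raw_inv flip: assms(29))
  then have 1: "raw (cinv a \<rhd> H2) = RW \<C> v2 u2 v1 u1 (Inv2 \<C> (raw a)) (h2 \<star> t4)"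
    using RW_eq [of v2 u2 v1 u1 "h2 \<star> t4" "Inv2 \<C> (raw a)"] ht(1) assms(2-5) by simp
  have "raw (r2 \<rhd> T2) = rwr [f, w2] [v2, f2] (raw r2) (t2 \<star> t4)"
    using assms(1,3,7,9,11,22) ne by (subst raw_simps) (simp_all flip: assms(27))
  then have 2: "raw (r2 \<rhd> T2) = RW \<C> f w2 v2 f2 (raw r2) (t2 \<star> t4)"
    using RW_eq [of f w2 v2 f2 "t2 \<star> t4" "raw r2"] ht(3) assms(1,3,7,9) by simp
  have "raw (cinv r1 \<rhd> T1) = rwr [v1, f1] [f, w1] (Inv2 \<C> (raw r1)) (t1 \<star> t3)"
    using assms(1,2,6,8,10,21) ne by (subst raw_simps) (simp_all add: raw_inv flip: assms(26))
  then have 3: "raw (cinv r1 \<rhd> T1) = RW \<C> v1 f1 f w1 (Inv2 \<C> (raw r1)) (t1 \<star> t3)"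
    using RW_eq [of v1 f1 f w1 "t1 \<star> t3" "Inv2 \<C> (raw r1)"] ht(2) assms(1,2,6,8) by simp
  have "Inv2 \<C> (raw s1) = RW \<C> u1 h1 f1 t1 (Inv2 \<C> \<sigma>1) t3"
    unfolding assms(33) using assms(1-19,30-32) by (intro Inv2_RW) auto
  then have 4: "raw ([v1] \<lhd> cinv s1) = v1 \<triangleleft> RW \<C> u1 h1 f1 t1 (Inv2 \<C> \<sigma>1) t3"
    using assms(2,4,12,24) by (simp add: raw_simps raw_inv)
  have 5: "raw ([v2] \<lhd> s2) = v2 \<triangleleft> RW \<C> f2 t2 u2 h2 \<sigma>2 t4"
    using assms(3,9,11,25) by (simp add: raw_simps flip: assms(34))
  have 6: "raw ([f] \<lhd> p) = f \<triangleleft> raw p"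
    using assms(1,6,10,23) by (simp add: raw_simps)
  have "raw (F7_path [f] [v1] [v2] a r1 r2 T1 T2 H2 s1 s2 p)
    = raw (cinv a \<rhd> H2) \<bullet> raw ([v2] \<lhd> s2) \<bullet> raw (r2 \<rhd> T2) \<bullet> raw ([f] \<lhd> p) \<bullet> raw (cinv r1 \<rhd> T1) \<bullet> raw
        ([v1] \<lhd> cinv s1)"
    using c unfolding F7_path_def by (simp only: raw_simps(1) cell_vc)
  then show ?thesis
    unfolding 1 2 3 4 5 6 F7_cell_def .
qed

end

context BF
begin

section \<open>The fillers and lifts provided by the choices\<close>

lemma C_choices_fillers:
  assumes "C_choices \<C> \<W> CW" "hom [f] A B" "hom [v] E B" "v \<in> \<W>" "CW f v = (D, v', f', \<rho>)"
  shows "hom [v'] D A \<and> v' \<in> \<W> \<and> hom [f'] D E \<and> iso_in ([f, v'], \<rho>, [v, f']) [f, v'] [v, f']"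
proof -
  have fv: "f \<in> Hom1 \<C> A B" "v \<in> Hom1 \<C> E B"
    using assms(2,3) by (simp_all add: Hom1_iff)
  then have "(D, v', f', \<rho>) \<in> fillers \<C> \<W> f v"
    using assms(1,4) unfolding C_choices_def assms(5) [symmetric] by blast
  then have "v' \<in> Arr \<C>" "Src \<C> v' = D" "Trg \<C> v' = A" "v' \<in> \<W>" "f' \<in> Arr \<C>" "Src \<C> f' = D"
      "Trg \<C> f' = E"
      "iso2 \<rho>" "Dom \<C> \<rho> = f \<star> v'" "Cod \<C> \<rho> = v \<star> f'"
    using fv by (simp_all add: fillers_def Hom1_iff Iso2_iff)
  with fv show ?thesis
    by (simp add: isoc_def cell_def Hom1_iff)
qed

text \<open>The counterpart of \<open>lift_single\<close> for the lift chosen by D(W), written out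
  as a cell because the selected data are computed from this very lift.\<close>

lemma D_choices_lifts:
  assumes "D_choices \<C> \<W> DW" "hom [w] B A" "w \<in> \<W>" "hom [f1] E B" "hom [f2] E B"
      "cell_in c [w, f1] [w, f2]" "DW w f1 f2 (raw c) = (D, v, \<beta>)"
  shows "hom [v] D E \<and> v \<in> \<W> \<and> cell_in ([f1, v], \<beta>, [f2, v]) [f1, v] [f2, v]
      \<and> (isoc c \<longrightarrow> isoc ([f1, v], \<beta>, [f2, v])) \<and>
    [w] \<lhd> ([f1, v], \<beta>, [f2, v]) = c \<rhd> [v]"
proof -
  have c: "raw c \<in> Hom2 \<C> (w \<star> f1) (w \<star> f2)"
    using assms(6) cell_parallel [of c] by (simp add: Hom2_iff)
  have ty: "w \<in> Hom1 \<C> B A" "f1 \<in> Hom1 \<C> E B" "f2 \<in> Hom1 \<C> E B"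
    using assms(2,4,5) by (simp_all add: Hom1_iff)
  then have l: "(D, v, \<beta>) \<in> lifts \<C> \<W> w f1 f2 (raw c)"
    using assms(1,3) c unfolding D_choices_def assms(7) [symmetric] by blast
  then have v: "hom [v] D E" "v \<in> \<W>" "\<beta> \<in> Cell \<C>" "Dom \<C> \<beta> = f1 \<star> v" "Cod \<C> \<beta> = f2 \<star> v"
      "RW \<C> w f1 w f2 (raw c) v = w \<triangleleft> \<beta>"
    using ty by (simp_all add: lifts_def Hom1_iff Hom2_iff)
  let ?d = "([f1, v], \<beta>, [f2, v])"
  have d: "cell_in ?d [f1, v] [f2, v]"
    using v(1,3-5) assms(4,5) by (simp add: cell_def)
  have "isoc ?d" if "isoc c"
  proof -
    have "\<beta> \<in> Iso2 \<C> (f1 \<star> v) (f2 \<star> v)"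
      by (rule BF4b [OF ty(1) assms(3) ty(2,3) _ l]) (use that c in \<open>simp add: Hom2_iff Iso2_iff
          isoc_def\<close>)
    with d show ?thesis
      by (simp add: isoc_def Iso2_iff)
  qed
  moreover have "[w] \<lhd> ?d = c \<rhd> [v]"
  proof (rule proper_eqI)
    assume "cell ([w] \<lhd> ?d)" "cell (c \<rhd> [v])"
    then show "dm ([w] \<lhd> ?d) = dm (c \<rhd> [v]) \<and> cd ([w] \<lhd> ?d) = cd (c \<rhd> [v]) \<and> raw ([w] \<lhd> ?d)
        = raw (c \<rhd> [v])"
      using v(6) RW_eq [of w f1 w f2 v "raw c"] v(1) assms(2,4-6) by (simp add: raw_simps)
  qed (use d v(1) assms(2,4-6) in simp_all)
  ultimately show ?thesis
    using v d by simp
qed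

text \<open>The unpacking argument of \<open>path_lift\<close> with the lift \<open>b\<close> given
  in advance: D(W) works on composites, and its value has to be kept.\<close>

lemma unpack_lift:
  assumes "hom w B A" "hom p E B" "hom q E B" "hom [v] D E" "cell_in c (w @ p) (w @ q)"
      "cell_in b [cmp p, v] [cmp q, v]"
    "[cmp w] \<lhd> b = (([cmp w] \<lhd> pack q) \<odot> (pack w \<rhd> q) \<odot> c \<odot> cinv (([cmp w] \<lhd> pack p)
        \<odot> (pack w \<rhd> p))) \<rhd> [v]"
  shows "w \<lhd> (cinv (pack q \<rhd> [v]) \<odot> b \<odot> (pack p \<rhd> [v])) = c \<rhd> [v]" (is "w \<lhd> ?d = _")
proof (rule vc_left_cancel)
  let ?k = "([cmp w] \<lhd> pack q \<rhd> [v]) \<odot> (pack w \<rhd> (q @ [v]))"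
  have d: "cell_in ?d (p @ [v]) (q @ [v])"
    using assms(2-6) by simp
  have "?k \<odot> (w \<lhd> ?d) = ([cmp w] \<lhd> pack q \<rhd> [v]) \<odot> ([cmp w] \<lhd> ?d) \<odot> (pack w \<rhd> (p @ [v]))"
    using exchange [of "pack w" w "[cmp w]" ?d "p @ [v]" "q @ [v]"] d by simp
  also have "\<dots> = ([cmp w] \<lhd> b) \<odot> ([cmp w] \<lhd> pack p \<rhd> [v]) \<odot> (pack w \<rhd> (p @ [v]))"
    using assms(1-6) by simp
  also have "\<dots> = ?k \<odot> (c \<rhd> [v])"
    unfolding assms(7) using assms(1-6) by simp
  finally show "?k \<odot> (w \<lhd> ?d) = ?k \<odot> (c \<rhd> [v])" .
qed (use assms in auto)

text \<open>(F5) imposes no equation on \<sigma>, only typing and invertibility; the latter comes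
  from (BF4b) for the chosen lift.\<close>

lemma select_F5_props:
  assumes "C_choices \<C> \<W> CW" "D_choices \<C> \<W> DW" "hom [v] B A" "v \<in> \<W>" "hom [f] E B" "hom [u] B' B"
      "v \<star> u \<in> \<W>"
    "select_F5 \<C> CW DW v f u = (D, t, h, \<sigma>)"
  shows "hom [t] D E \<and> t \<in> \<W> \<and> hom [h] D B' \<and> iso_in ([f, t], \<sigma>, [u, h]) [f, t] [u, h]"
proof -
  obtain M p q \<tau> where 1: "CW (v \<star> f) (v \<star> u) = (M, p, q, \<tau>)"
    by (metis prod_cases4)
  have C: "hom [p] M E" "p \<in> \<W>" "hom [q] M B'"
      "iso_in ([v \<star> f, p], \<tau>, [v \<star> u, q]) [v \<star> f, p] [v \<star> u, q]"
    using C_choices_fillers [OF assms(1) _ _ assms(7) 1, of E A B'] assms(3-6) by auto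
  define c where "c = ([v, f \<star> p], Assoc \<C> v u q \<bullet> \<tau> \<bullet> Inv2 \<C> (Assoc \<C> v f p), [v, u \<star> q])"
  have c: "iso_in c [v, f \<star> p] [v, u \<star> q]"
    using C assms(3-6) by (simp add: c_def isoc_def cell_def)
  obtain D' r \<theta> where 2: "DW v (f \<star> p) (u \<star> q) (raw c) = (D', r, \<theta>)"
    by (metis prod_cases3)
  have D: "hom [r] D' M" "r \<in> \<W>" "isoc ([f \<star> p, r], \<theta>, [u \<star> q, r])"
    using D_choices_lifts [OF assms(2,3,4) _ _ _ 2, of M] c C assms(3-6) by simp_all
  have "D = D'" "t = p \<star> r" "h = q \<star> r" "\<sigma> = Assoc \<C> u q r \<bullet> \<theta> \<bullet> Inv2 \<C> (Assoc \<C> f p r)"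
    using assms(8) 2 by (auto simp: select_F5_def 1 c_def)
  moreover have "p \<star> r \<in> \<W>"
    using BF2 [of r D' M p E] D C by (simp add: Hom1_iff)
  ultimately show ?thesis
    using C D assms(3-6) by (simp add: isoc_def cell_def)
qed

end

section \<open>The selected data\<close>

context bicategory
begin

lemma raw_pack_rw:
  assumes "hom [h] A B" "hom [s] E A" "hom [r] D E"
  shows "raw (pack [h, s] \<rhd> [r]) = Inv2 \<C> (Assoc \<C> h s r)"
  using assms by (simp add: raw_simps rwr_def) (simp add: pack_def)

lemma raw_pack_lw:
  assumes "hom x A B" "hom p D A"
  shows "raw (x \<lhd> pack p) = Id2 \<C> (cmp (x @ p))"
  using assms lwr_Id2 [of "cmp p" x] by (simp add: raw_simps) (simp add: pack_def)

end

context BF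
begin

text \<open>This makes the defined composite an instance of independence. The point is (F7): D(W)
  solves it for \<open>s3\<close>, \<open>s4\<close> up to the precomposition \<open>r\<close>, and
  whiskering by \<open>r\<close> commutes with forming \<open>F7_path\<close>.\<close>

lemma select_F567_mem:
  assumes ch: "C_choices \<C> \<W> CW" "D_choices \<C> \<W> DW"
    and F: "hom [f] P B" "hom [v1] B1 B" "v1 \<in> \<W>" "hom [v2] B2 B" "v2 \<in> \<W>"
      "hom [g1] B1 C" "hom [g2] B2 C"
    and R: "(B3, u1, u2, \<alpha>, \<beta>) \<in> frac_reps \<C> \<W> (B1, v1, g1) (B2, v2, g2)"
    and w: "hom [w] P A"
  shows "select_F567 \<C> CW DW (P, w, f) (B1, v1, g1) (B2, v2, g2) (B3, u1, u2, \<alpha>, \<beta>)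
    \<in> F567 \<C> \<W> CW (P, w, f) (B1, v1, g1) (B2, v2, g2) (B3, u1, u2, \<alpha>, \<beta>)"
proof -
  obtain D1 w1 f1 \<rho>1 where CW1: "CW f v1 = (D1, w1, f1, \<rho>1)" by (metis prod_cases4)
  obtain D2 w2 f2 \<rho>2 where CW2: "CW f v2 = (D2, w2, f2, \<rho>2)" by (metis prod_cases4)
  define r1 where "r1 = ([f, w1], \<rho>1, [v1, f1])"
  define r2 where "r2 = ([f, w2], \<rho>2, [v2, f2])"
  define a where "a = ([v1, u1], \<alpha>, [v2, u2])"
  have raws [simp]: "raw r1 = \<rho>1" "raw r2 = \<rho>2" "raw a = \<alpha>" by (simp_all add: r1_def r2_def a_def)
  have 1: "hom [w1] D1 P" "w1 \<in> \<W>" "hom [f1] D1 B1" "iso_in r1 [f, w1] [v1, f1]"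
    using C_choices_fillers [OF ch(1) F(1,2,3) CW1] unfolding r1_def by auto
  have 2: "hom [w2] D2 P" "w2 \<in> \<W>" "hom [f2] D2 B2" "iso_in r2 [f, w2] [v2, f2]"
    using C_choices_fillers [OF ch(1) F(1,4,5) CW2] unfolding r2_def by auto
  have u: "hom [u1] B3 B1" "hom [u2] B3 B2" "v1 \<star> u1 \<in> \<W>" "iso_in a [v1, u1] [v2, u2]"
    using R F by (auto simp: Hom1_iff Iso2_iff isoc_def cell_def a_def)
  \<comment> \<open>By (BF5) along \<alpha>; the selection of the second leg applies C(W) to
    \<open>v2 \<star> u2\<close>.\<close>
  have "WW [v2, u2]"
    using WW_iso [of a] u F(2) by (simp add: WW_def)
  then have vu2: "v2 \<star> u2 \<in> \<W>"
    by (simp add: WW_def)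
  obtain D3 t1 h1 \<sigma>1 where sel1: "select_F5 \<C> CW DW v1 f1 u1 = (D3, t1, h1, \<sigma>1)" by (metis prod_cases4)
  obtain D4 t2 h2 \<sigma>2 where sel2: "select_F5 \<C> CW DW v2 f2 u2 = (D4, t2, h2, \<sigma>2)" by (metis prod_cases4)
  define sc1 where "sc1 = ([f1, t1], \<sigma>1, [u1, h1])"
  define sc2 where "sc2 = ([f2, t2], \<sigma>2, [u2, h2])"
  have raws' [simp]: "raw sc1 = \<sigma>1" "raw sc2 = \<sigma>2" by (simp_all add: sc1_def sc2_def)
  have 3: "hom [t1] D3 D1" "t1 \<in> \<W>" "hom [h1] D3 B3" "iso_in sc1 [f1, t1] [u1, h1]"
    using select_F5_props [OF ch F(2,3) 1(3) u(1,3) sel1] unfolding sc1_def by auto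
  have 4: "hom [t2] D4 D2" "t2 \<in> \<W>" "hom [h2] D4 B3" "iso_in sc2 [f2, t2] [u2, h2]"
    using select_F5_props [OF ch F(4,5) 2(3) u(2) vu2 sel2] unfolding sc2_def by auto
  have \<sigma>: "iso2 \<sigma>1" "Dom \<C> \<sigma>1 = f1 \<star> t1" "Cod \<C> \<sigma>1 = u1 \<star> h1" "iso2 \<sigma>2" "Dom \<C> \<sigma>2 = f2 \<star> t2"
      "Cod \<C> \<sigma>2 = u2 \<star> h2"
    using 3(4) 4(4) by (simp_all add: isoc_def cell_def sc1_def sc2_def)
  obtain E s3 s4 \<psi> where CW3: "CW (w1 \<star> t1) (w2 \<star> t2) = (E, s3, s4, \<psi>)" by (metis prod_cases4)
  have "w2 \<star> t2 \<in> \<W>"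
    using BF2 [of t2 D4 D2 w2 P] 2 4 by (simp add: Hom1_iff)
  then have s: "hom [s3] E D3" "s3 \<in> \<W>" "hom [s4] E D4"
      "iso_in ([w1 \<star> t1, s3], \<psi>, [w2 \<star> t2, s4]) [w1 \<star> t1, s3] [w2 \<star> t2, s4]"
    using C_choices_fillers [OF ch(1) _ _ _ CW3, of D3 P D4] 1(1) 2(1) 3(1) 4(1) by auto
  define \<phi>0 where "\<phi>0 = Assoc \<C> w2 t2 s4 \<bullet> \<psi> \<bullet> Inv2 \<C> (Assoc \<C> w1 t1 s3)"
  define p0 where "p0 = ([w1, t1, s3], \<phi>0, [w2, t2, s4])"
  have p0: "iso_in p0 [w1, t1, s3] [w2, t2, s4]" "raw p0 = \<phi>0"
    using s 1(1) 2(1) 3(1) 4(1) by (simp_all add: p0_def \<phi>0_def isoc_def cell_def)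
  \<comment> \<open>The right-hand side of (F7) before the precomposition with
    \<open>r\<close>.\<close>
  define c0 where "c0 = F7_path [f] [v1] [v2] a r1 r2 [t1, s3] [t2, s4] [h2, s4] (sc1 \<rhd> [s3]) (sc2 \<rhd>
      [s4]) p0"
  have c0: "iso_in c0 [v1, u1, h1, s3] [v1, u1, h2, s4]"
    using F7_path_iso [of "[f]" P B "[v1]" B1 "[v2]" B2 "[u1]" B3 "[u2]" "[w1]" D1 "[w2]" D2 "[f1]"
        "[f2]" "[t1, s3]" E "[t2, s4]"
        "[h1, s3]" "[h2, s4]" a r1 r2 p0 "sc1 \<rhd> [s3]" "sc2 \<rhd> [s4]"] F 1 2 u 3 4 s p0 unfolding
            c0_def by simp
  let ?F7 = "F7_cell \<C> f v1 v2 u1 u2 \<alpha> w1 f1 \<rho>1 w2 f2 \<rho>2 t1 t2 h1 h2 \<sigma>1 \<sigma>2"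
  have raw_c0: "raw c0 = ?F7 s3 s4 \<phi>0"
    unfolding c0_def using raw_F7_path [of f P B v1 B1 v2 B2 u1 B3 u2 w1 D1 w2 D2 f1 f2 "[t1, s3]" E
        "[t2, s4]" "[h1, s3]" "[h2, s4]"
      t1 D3 t2 D4 h1 h2 s3 s4 a r1 r2 p0 "sc1 \<rhd> [s3]" "sc2 \<rhd> [s4]" \<sigma>1 \<sigma>2] F(1,2,4) 1 2 u 3 4 s(1,3) p0 \<sigma>
    by (simp add: raw_simps RW_eq)
  \<comment> \<open>Packing into the two 1-morphisms on which D(W) operates. The resulting
    2-morphism is a single inverse associator, since packing the tail is an identity.\<close>
  let ?k = "\<lambda>h s. ([cmp [v1, u1]] \<lhd> pack [h, s]) \<odot> (pack [v1, u1] \<rhd> [h, s])"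
  have raw_k: "raw (?k h s) = Inv2 \<C> (Assoc \<C> v1 u1 (h \<star> s))" and k:
      "iso_in (?k h s) [v1, u1, h, s] [v1 \<star> u1, h \<star> s]"
    if "hom [h] D B3" "hom [s] E D" for h s D
  proof -
    have "raw (pack [v1, u1] \<rhd> [h, s]) = raw (pack [v1, u1] \<rhd> [h \<star> s])"
      using that F u(1) by (simp add: raw_simps)
    also have "\<dots> = Inv2 \<C> (Assoc \<C> v1 u1 (h \<star> s))"
      using that F(2) u(1) raw_pack_rw [of v1 B1 B u1 B3 "h \<star> s" E] by simp
    finally show "raw (?k h s) = Inv2 \<C> (Assoc \<C> v1 u1 (h \<star> s))"
      using that F(2) u(1) raw_pack_lw [of "[v1 \<star> u1]" B3 B "[h, s]" E] by (subst raw_simps) simp_all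
    show "iso_in (?k h s) [v1, u1, h, s] [v1 \<star> u1, h \<star> s]"
      using that F(2) u(1) by simp
  qed
  define k1 where "k1 = ?k h1 s3"
  define k2 where "k2 = ?k h2 s4"
  define e0 where "e0 = k2 \<odot> c0 \<odot> cinv k1"
  have k1: "iso_in k1 [v1, u1, h1, s3] [v1 \<star> u1, h1 \<star> s3]" "raw k1 = Inv2 \<C> (Assoc \<C> v1 u1 (h1 \<star> s3))"
    unfolding k1_def using k [OF 3(3) s(1)] raw_k [OF 3(3) s(1)] by simp_all
  have k2: "iso_in k2 [v1, u1, h2, s4] [v1 \<star> u1, h2 \<star> s4]" "raw k2 = Inv2 \<C> (Assoc \<C> v1 u1 (h2 \<star> s4))"
    unfolding k2_def using k [OF 4(3) s(3)] raw_k [OF 4(3) s(3)] by simp_all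
  have e0: "iso_in e0 [v1 \<star> u1, h1 \<star> s3] [v1 \<star> u1, h2 \<star> s4]"
    unfolding e0_def using c0 k1 k2 by simp
  \<comment> \<open>This is literally the 2-morphism handed to \<open>DW\<close> in the
    selection.\<close>
  have raw_e0: "raw e0 = Inv2 \<C> (Assoc \<C> v1 u1 (h2 \<star> s4)) \<bullet> ?F7 s3 s4 \<phi>0 \<bullet> Assoc \<C> v1 u1 (h1 \<star> s3)"
  proof -
    have "raw e0 = raw k2 \<bullet> raw c0 \<bullet> raw (cinv k1)"
      using iso_cell [of e0] e0 unfolding e0_def by (simp only: raw_simps(1) cell_vc)
    then show ?thesis
      using k1(2) k2(2) 3(3) s(1) F(2) u(1) raw_c0 by (simp add: raw_inv)
  qed
  obtain D5 r \<delta>0 where DW0: "DW (v1 \<star> u1) (h1 \<star> s3) (h2 \<star> s4) (raw e0) = (D5, r, \<delta>0)"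
      by (metis prod_cases3)
  define d0 where "d0 = ([h1 \<star> s3, r], \<delta>0, [h2 \<star> s4, r])"
  have r: "hom [r] D5 E" "r \<in> \<W>" "iso_in d0 [h1 \<star> s3, r] [h2 \<star> s4, r]" "[v1 \<star> u1] \<lhd> d0 = e0 \<rhd> [r]"
      "raw d0 = \<delta>0"
    using D_choices_lifts [OF ch(2) _ u(3) _ _ _ DW0, of B3 B E] e0 F(2) u(1) 3(3) 4(3) s(1,3)
        unfolding d0_def by simp_all
  define d where "d = cinv (pack [h2, s4] \<rhd> [r]) \<odot> d0 \<odot> (pack [h1, s3] \<rhd> [r])"
  have d: "iso_in d [h1, s3, r] [h2, s4, r]"
    unfolding d_def using r 3(3) 4(3) s(1,3) by simp
  have vd: "[v1, u1] \<lhd> d = c0 \<rhd> [r]"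
    unfolding d_def
    by (rule unpack_lift [of _ B3 B _ E _ _ D5]) (use F(2) u(1) 3(3) 4(3) s(1,3) r c0 in \<open>simp_all
        add: e0_def k1_def k2_def\<close>)
  define \<delta> where "\<delta> = Assoc \<C> h2 s4 r \<bullet> \<delta>0 \<bullet> Inv2 \<C> (Assoc \<C> h1 s3 r)"
  have raw_d: "raw d = \<delta>"
  proof -
    have "raw d = raw (cinv (pack [h2, s4] \<rhd> [r])) \<bullet> raw d0 \<bullet> raw (pack [h1, s3] \<rhd> [r])"
      using iso_cell [of d] d unfolding d_def by (simp only: raw_simps(1) cell_vc)
    then show ?thesis
      using raw_pack_rw [of h1 D3 B3 s3 E r D5] raw_pack_rw [of h2 D4 B3 s4 E r D5] r(1,5) 3(3) 4(3)
          s(1,3) by (simp add: \<delta>_def raw_inv)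
  qed
  define \<phi> where "\<phi> = (w2 \<triangleleft> Assoc \<C> t2 s4 r)
              \<bullet> RW \<C> w1 (t1 \<star> s3) w2 (t2 \<star> s4) \<phi>0 r
              \<bullet> (w1 \<triangleleft> Inv2 \<C> (Assoc \<C> t1 s3 r))"
  have \<phi>0: "iso2 \<phi>0" "Dom \<C> \<phi>0 = w1 \<star> t1 \<star> s3" "Cod \<C> \<phi>0 = w2 \<star> t2 \<star> s4"
    using p0 cell_parallel [of p0] by (simp_all add: isoc_def)
  have p: "iso_in (p0 \<rhd> [r]) [w1, t1, s3, r] [w2, t2, s4, r]" and raw_p: "raw (p0 \<rhd> [r]) = \<phi>"
    using p0 r(1) 1(1) 2(1) 3(1) 4(1) s(1,3) \<phi>0 by (simp_all add: raw_simps rwr_def RW_def \<phi>_def)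
  \<comment> \<open>The right-hand side of (F7) for \<open>s3 \<star> r\<close> and
    \<open>s4 \<star> r\<close>: \<open>F7_path_rw\<close> distributes \<open>r\<close> over the
    ingredients.\<close>
  have "raw (c0 \<rhd> [r]) = ?F7 (s3 \<star> r) (s4 \<star> r) \<phi>"
  proof -
    have "c0 \<rhd> [r] = F7_path [f] [v1] [v2] a r1 r2 ([t1, s3] @ [r]) ([t2, s4] @ [r]) ([h2, s4] @
        [r]) (sc1 \<rhd> [s3] \<rhd> [r]) (sc2 \<rhd> [s4] \<rhd> [r]) (p0 \<rhd> [r])"
      unfolding c0_def
      by (rule F7_path_rw [of "[f]" P B "[v1]" B1 "[v2]" B2 "[u1]" B3 "[u2]" "[w1]" D1 "[w2]" D2
          "[f1]" "[f2]" "[t1, s3]" E "[t2, s4]"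
        "[h1, s3]" "[h2, s4]" a r1 r2 p0 "sc1 \<rhd> [s3]" "sc2 \<rhd> [s4]"]) (use F(1,2,4) 1 2 u 3 4 s(1,3)
            p0 r(1) in simp_all)
    also have "raw \<dots> = ?F7 (s3 \<star> r) (s4 \<star> r) \<phi>"
      using raw_F7_path [of f P B v1 B1 v2 B2 u1 B3 u2 w1 D1 w2 D2 f1 f2 "[t1, s3, r]" D5
          "[t2, s4, r]" "[h1, s3, r]" "[h2, s4, r]"
      t1 D3 t2 D4 h1 h2 "s3 \<star> r" "s4 \<star> r" a r1 r2 "p0 \<rhd> [r]" "sc1 \<rhd> [s3, r]"
          "sc2 \<rhd> [s4, r]" \<sigma>1 \<sigma>2] F(1,2,4) 1 2 u 3 4 s(1,3) p raw_p \<sigma> r(1)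
      by (simp add: raw_simps RW_eq)
    finally show ?thesis .
  qed
  moreover have "raw ([v1, u1] \<lhd> d) = v1 \<triangleleft> u1 \<triangleleft> \<delta>"
    using d raw_d F(2) u(1) 3(3) s(1) r(1) by (simp add: raw_simps)
  ultimately have F7: "v1 \<triangleleft> u1 \<triangleleft> \<delta> = ?F7 (s3 \<star> r) (s4 \<star> r) \<phi>"
    using vd by simp
  have "\<delta> \<in> Iso2 \<C> (h1 \<star> s3 \<star> r) (h2 \<star> s4 \<star> r)" "\<phi> \<in> Iso2 \<C> (w1 \<star> t1 \<star> s3 \<star> r) (w2 \<star> t2 \<star> s4 \<star> r)"
    using d p cell_parallel [of d] cell_parallel [of "p0 \<rhd> [r]"] raw_d raw_p
        by (simp_all add: Iso2_iff isoc_def)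
  moreover have "s3 \<star> r \<in> \<W>"
    using BF2 [of r D5 E s3 D3] r s by (simp add: Hom1_iff)
  moreover have "select_F567 \<C> CW DW (P, w, f) (B1, v1, g1) (B2, v2, g2) (B3, u1, u2, \<alpha>, \<beta>)
      = (D3, D4, t1, t2, h1, h2, \<sigma>1, \<sigma>2, D5, s3 \<star> r, s4 \<star> r, \<phi>, \<delta>)"
    using DW0 unfolding raw_e0 by (simp add: CW1 CW2 sel1 sel2 CW3 Let_def \<phi>0_def \<phi>_def \<delta>_def)
  ultimately show ?thesis
    using F7 3(1-3) 4(1-3) s(1,3) r(1) \<sigma> by (simp add: CW1 CW2 Hom1_iff Iso2_iff)
qed

end

section \<open>The composite\<close>

context BF
begin

section \<open>Changing the legs of a representative\<close>

lemma path_rep_conjugate: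
  assumes "path_rep w1 f1 w2 f2 v1 v2 a b" "iso_in k1 w1 x1" "iso_in k2 w2 x2" "iso_in j1 f1 y1"
      "iso_in j2 f2 y2"
  shows "path_rep x1 y1 x2 y2 v1 v2 ((k2 \<rhd> v2) \<odot> a \<odot> cinv (k1 \<rhd> v1)) ((j2 \<rhd> v2) \<odot> b \<odot> cinv (j1 \<rhd> v1))"
proof -
  obtain A B C B1 B2 where r: "hom w1 B1 A" "hom w2 B2 A" "hom f1 B1 B" "hom f2 B2 B" "hom v1 C B1"
      "hom v2 C B2"
    "WW (w1 @ v1)" "iso_in a (w1 @ v1) (w2 @ v2)" "cell_in b (f1 @ v1) (f2 @ v2)"
    using assms(1) unfolding path_rep_def by blast
  have x: "hom x1 B1 A" "hom x2 B2 A" "hom y1 B1 B" "hom y2 B2 B"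
    using assms(2-5) r(1-4) cell_parallel [of k1] cell_parallel [of k2] cell_parallel [of j1]
        cell_parallel [of j2] by auto
  have W: "WW (x1 @ v1)"
    using WW_iso [of "k1 \<rhd> v1"] assms(2) r by simp
  show ?thesis
    unfolding path_rep_def using x r(5,6) W
    by (intro exI [of _ A] exI [of _ B] exI [of _ C] exI [of _ B1] exI [of _ B2]) (use assms(2-5) r
        in simp)
qed

lemma path_rep_precompose:
  assumes "path_rep w1 f1 w2 f2 v1 v2 a b" "WW w" "src w = trg w1"
  shows "path_rep (w @ w1) f1 (w @ w2) f2 v1 v2 (w \<lhd> a) b"
proof -
  obtain A B C B1 B2 where r: "hom w1 B1 A" "hom w2 B2 A" "hom f1 B1 B" "hom f2 B2 B" "hom v1 C B1"
      "hom v2 C B2"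
    "WW (w1 @ v1)" "iso_in a (w1 @ v1) (w2 @ v2)" "cell_in b (f1 @ v1) (f2 @ v2)"
    using assms(1) unfolding path_rep_def by blast
  have w: "hom w A (trg w)" "w \<noteq> []"
    using assms(2,3) r(1) WW_arr by auto
  have "WW (w @ w1 @ v1)"
    by (rule WW_append) (use assms r in auto)
  then show ?thesis
    unfolding path_rep_def using r w
    by (intro exI [of _ "trg w"] exI [of _ B] exI [of _ C] exI [of _ B1] exI [of _ B2]) simp
qed

text \<open>Whiskering the first components by \<open>w\<close> preserves the comparison. In this
  way \<open>w \<circ> \<phi>\<close> enters only after the two sets of data have been
  compared.\<close>

lemma path_equiv_precompose:
  assumes "path_equiv w1 f1 w2 f2 v1 v2 a b v1' v2' a' b'" "WW w" "hom w1 B1 A" "hom w A D"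
      "hom v1 M B1"
  shows "path_equiv (w @ w1) f1 (w @ w2) f2 v1 v2 (w \<lhd> a) b v1' v2' (w \<lhd> a') b'"
proof -
  obtain z z' s1 s2 E where z: "hom z E (src v1)" "hom z' E (src v1')"
      "iso_in s1 (v1' @ z') (v1 @ z)" "iso_in s2 (v2 @ z) (v2' @ z')"
     "WW (w1 @ v1 @ z)" "(w2 \<lhd> s2) \<odot> (a \<rhd> z) \<odot> (w1 \<lhd> s1) = a' \<rhd> z'"
         "(f2 \<lhd> s2) \<odot> (b \<rhd> z) \<odot> (f1 \<lhd> s1) = b' \<rhd> z'"
    using assms(1) unfolding path_equiv_def by blast
  have "((w @ w2) \<lhd> s2) \<odot> ((w \<lhd> a) \<rhd> z) \<odot> ((w @ w1) \<lhd> s1) = (w \<lhd> a') \<rhd> z'"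
    using arg_cong [OF z(6), of "\<lambda>c. w \<lhd> c"] by simp
  moreover have "WW (w @ w1 @ v1 @ z)"
    by (rule WW_append) (use assms z in auto)
  ultimately show ?thesis
    unfolding path_equiv_def using z(1-4,7)
    by (intro exI [of _ z] exI [of _ z'] exI [of _ s1] exI [of _ s2] exI [of _ E]) simp
qed

lemma raw_pack_rw_cinv:
  assumes "hom [h] A B" "hom [s] E A" "hom [r] D E"
  shows "raw (cinv (pack [h, s] \<rhd> [r])) = Assoc \<C> h s r"
  using raw_pack_rw [OF assms] assms by (simp add: raw_inv del: inv_rw)

text \<open>The form in which given data enter the comparison: \<open>H\<close> is
  \<open>h1 \<star> t3\<close>, \<delta> is absorbed into \<open>S2\<close>, and the outermost
  associators of \<open>induced_rep\<close> become whiskered \<open>pack\<close> cells.\<close>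

lemma induced_rep_path:
  assumes CW: "C_choices \<C> \<W> CW" "CW f v1 = (D1, w1, f1, \<rho>1)" "CW f v2 = (D2, w2, f2, \<rho>2)"
    and F: "hom [w] P A" "hom [f] P B" "hom [v1] B1 B" "v1 \<in> \<W>" "hom [v2] B2 B" "v2 \<in> \<W>"
        "hom [g1] B1 C" "hom [g2] B2 C"
    and R: "(B3, u1, u2, \<alpha>, \<beta>) \<in> frac_reps \<C> \<W> (B1, v1, g1) (B2, v2, g2)"
    and S: "S \<in> F567 \<C> \<W> CW (P, w, f) (B1, v1, g1) (B2, v2, g2) (B3, u1, u2, \<alpha>, \<beta>)"
  obtains X T1 T2 H p S1 S2 \<xi> where "hom [T1] X D1" "hom [T2] X D2" "hom [H] X B3" "WW [w1, T1]"
    "iso_in p [w1, T1] [w2, T2]" "iso_in S1 [f1, T1] [u1, H]" "iso_in S2 [f2, T2] [u2, H]"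
    "(([v1, u1], \<alpha>, [v2, u2]) \<rhd> [H]) \<odot> ([v1] \<lhd> S1) \<odot> (([f, w1], \<rho>1, [v1, f1]) \<rhd> [T1])
        = ([v2] \<lhd> S2) \<odot> (([f, w2], \<rho>2, [v2, f2]) \<rhd> [T2]) \<odot> ([f] \<lhd> p)"
    "\<xi> = ([g2] \<lhd> cinv S2) \<odot> (([g1, u1], \<beta>, [g2, u2]) \<rhd> [H]) \<odot> ([g1] \<lhd> S1)"
    "induced_rep \<C> CW (P, w, f) (B1, v1, g1) (B2, v2, g2) (B3, u1, u2, \<alpha>, \<beta>) S
      = (X, T1, T2, raw ((pack [w, w2] \<rhd> [T2]) \<odot> ([w] \<lhd> p) \<odot> cinv (pack [w, w1] \<rhd> [T1])),
          raw ((pack [g2, f2] \<rhd> [T2]) \<odot> \<xi> \<odot> cinv (pack [g1, f1] \<rhd> [T1])))"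
proof -
  obtain D3 D4 t1 t2 h1 h2 \<sigma>1 \<sigma>2 D5 t3 t4 \<phi> \<delta> where Seq:
      "S = (D3, D4, t1, t2, h1, h2, \<sigma>1, \<sigma>2, D5, t3, t4, \<phi>, \<delta>)"
    by (metis surj_pair)
  have S': "hom [t1] D3 D1" "t1 \<in> \<W>" "hom [t2] D4 D2" "hom [h1] D3 B3" "hom [h2] D4 B3"
      "iso2 \<sigma>1" "Dom \<C> \<sigma>1 = f1 \<star> t1" "Cod \<C> \<sigma>1 = u1 \<star> h1" "iso2 \<sigma>2" "Dom \<C> \<sigma>2 = f2 \<star> t2"
          "Cod \<C> \<sigma>2 = u2 \<star> h2"
      "hom [t3] D5 D3" "t3 \<in> \<W>" "hom [t4] D5 D4" "iso2 \<phi>" "Dom \<C> \<phi> = w1 \<star> t1 \<star> t3"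
          "Cod \<C> \<phi> = w2 \<star> t2 \<star> t4"
      "iso2 \<delta>" "Dom \<C> \<delta> = h1 \<star> t3" "Cod \<C> \<delta> = h2 \<star> t4"
      "v1 \<triangleleft> u1 \<triangleleft> \<delta> = F7_cell \<C> f v1 v2 u1 u2 \<alpha> w1 f1 \<rho>1 w2 f2 \<rho>2 t1 t2 h1 h2 \<sigma>1 \<sigma>2 t3 t4 \<phi>"
    using S unfolding Seq by (simp_all add: CW Hom1_iff Iso2_iff)
  define r1 where "r1 = ([f, w1], \<rho>1, [v1, f1])"
  define r2 where "r2 = ([f, w2], \<rho>2, [v2, f2])"
  define a where "a = ([v1, u1], \<alpha>, [v2, u2])"
  define b where "b = ([g1, u1], \<beta>, [g2, u2])"
  have raws [simp]: "raw r1 = \<rho>1" "raw r2 = \<rho>2" "raw a = \<alpha>" "raw b = \<beta>"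
      by (simp_all add: r1_def r2_def a_def b_def)
  have 1: "hom [w1] D1 P" "w1 \<in> \<W>" "hom [f1] D1 B1" "iso_in r1 [f, w1] [v1, f1]"
    using C_choices_fillers [OF CW(1) F(2,3,4) CW(2)] unfolding r1_def by auto
  have 2: "hom [w2] D2 P" "w2 \<in> \<W>" "hom [f2] D2 B2" "iso_in r2 [f, w2] [v2, f2]"
    using C_choices_fillers [OF CW(1) F(2,5,6) CW(3)] unfolding r2_def by auto
  have u: "hom [u1] B3 B1" "hom [u2] B3 B2" "v1 \<star> u1 \<in> \<W>" "iso_in a [v1, u1] [v2, u2]"
      "cell_in b [g1, u1] [g2, u2]"
    using R F by (auto simp: Hom1_iff Hom2_iff Iso2_iff isoc_def cell_def a_def b_def)
  let ?T1 = "t1 \<star> t3" and ?T2 = "t2 \<star> t4" and ?H1 = "h1 \<star> t3" and ?H2 = "h2 \<star> t4"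
  have T: "hom [?T1] D5 D1" "hom [?T2] D5 D2" "hom [?H1] D5 B3" "hom [?H2] D5 B3"
    using S' by simp_all
  define p where "p = ([w1, ?T1], \<phi>, [w2, ?T2])"
  define d where "d = ([?H1], \<delta>, [?H2])"
  define s1 where "s1 = ([f1, ?T1], RW \<C> f1 t1 u1 h1 \<sigma>1 t3, [u1, ?H1])"
  define s2 where "s2 = ([f2, ?T2], RW \<C> f2 t2 u2 h2 \<sigma>2 t4, [u2, ?H2])"
  have raws' [simp]: "raw p = \<phi>" "raw d = \<delta>" "raw s1 = RW \<C> f1 t1 u1 h1 \<sigma>1 t3"
      "raw s2 = RW \<C> f2 t2 u2 h2 \<sigma>2 t4"
    by (simp_all add: p_def d_def s1_def s2_def)
  have p: "iso_in p [w1, ?T1] [w2, ?T2]" and d: "iso_in d [?H1] [?H2]"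
    using S' T 1(1) 2(1) by (simp_all add: p_def d_def isoc_def cell_def)
  note RW1 = Inv2_RW [OF S'(6,7,8,1) 1(3) S'(4) u(1) S'(12)]
  note RW2 = Inv2_RW [OF S'(9,10,11,3) 2(3) S'(5) u(2) S'(14)]
  have s1: "iso_in s1 [f1, ?T1] [u1, ?H1]" and s2: "iso_in s2 [f2, ?T2] [u2, ?H2]"
    using RW1 RW2 T 1(3) 2(3) u(1,2) by (simp_all add: s1_def s2_def isoc_def cell_def)
  let ?F7 = "F7_path [f] [v1] [v2] a r1 r2 [?T1] [?T2] [?H2] s1 s2 p"
  have F7: "iso_in ?F7 [v1, u1, ?H1] [v1, u1, ?H2]"
    using F7_path_iso [of "[f]" P B "[v1]" B1 "[v2]" B2 "[u1]" B3 "[u2]" "[w1]" D1 "[w2]" D2 "[f1]"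
        "[f2]" "[?T1]" D5 "[?T2]"
        "[?H1]" "[?H2]" a r1 r2 p s1 s2] F(2,3,5) 1 2 u T p s1 s2 by simp
  have "raw ?F7 = v1 \<triangleleft> u1 \<triangleleft> \<delta>"
    unfolding S'(21) using raw_F7_path [of f P B v1 B1 v2 B2 u1 B3 u2 w1 D1 w2 D2 f1 f2 "[?T1]" D5
        "[?T2]" "[?H1]" "[?H2]"
      t1 D3 t2 D4 h1 h2 t3 t4 a r1 r2 p s1 s2 \<sigma>1 \<sigma>2] F(2,3,5) 1 2 u T p s1 s2 S'(1-20) by simp
  then have vd: "([v1] @ [u1]) \<lhd> d = ?F7"
    by (intro proper_eqI) (use d F7 F(3) u(1) T in \<open>simp_all add: raw_simps proper_def\<close>)
  define S2 where "S2 = ([u2] \<lhd> cinv d) \<odot> s2"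
  have S2: "iso_in S2 [f2, ?T2] [u2, ?H1]"
    unfolding S2_def using s2 d u(2) T by simp
  have compat: "(a \<rhd> [?H1]) \<odot> ([v1] \<lhd> s1) \<odot> (r1 \<rhd> [?T1]) = ([v2] \<lhd> S2) \<odot> (r2 \<rhd> [?T2]) \<odot> ([f] \<lhd> p)"
    unfolding S2_def
    by (rule F7_path_compat [of "[f]" P B "[v1]" B1 "[v2]" B2 "[u1]" B3 "[u2]" "[w1]" D1 "[w2]" D2
        "[f1]" "[f2]" "[?T1]" D5 "[?T2]"
        "[?H1]" "[?H2]" a r1 r2 p s1 s2 d]) (use F(2,3,5) 1 2 u T p s1 s2 d vd in simp_all)
  define \<xi> where "\<xi> = ([g2] \<lhd> cinv S2) \<odot> (b \<rhd> [?H1]) \<odot> ([g1] \<lhd> s1)"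
  \<comment> \<open>Sliding \<delta> past \<beta> converts \<xi>, written with
    \<open>h1 \<star> t3\<close>, into the formula with \<open>h2 \<star> t4\<close>.\<close>
  have ex: "([g2, u2] \<lhd> d) \<odot> (b \<rhd> [?H1]) = (b \<rhd> [?H2]) \<odot> ([g1, u1] \<lhd> d)"
    using u(5) d by (intro exchange [symmetric]) auto
  have "\<xi> = ([g2] \<lhd> cinv s2) \<odot> (([g2, u2] \<lhd> d) \<odot> (b \<rhd> [?H1])) \<odot> ([g1] \<lhd> s1)"
    unfolding \<xi>_def S2_def using s2 d u T by simp
  then have \<xi>: "\<xi> = ([g2] \<lhd> cinv s2) \<odot> (b \<rhd> [?H2]) \<odot> ([g1, u1] \<lhd> d) \<odot> ([g1] \<lhd> s1)"
    unfolding ex by simp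
  have \<xi>_cell: "cell_in \<xi> [g1, f1, ?T1] [g2, f2, ?T2]"
    unfolding \<xi> using s1 s2 d u T F(7,8) 1(3) 2(3) by simp
  have "raw \<xi> = raw ([g2] \<lhd> cinv s2) \<bullet> raw (b \<rhd> [?H2]) \<bullet> raw ([g1, u1] \<lhd> d) \<bullet> raw ([g1] \<lhd> s1)"
    using \<xi>_cell unfolding \<xi> by (simp only: raw_simps(1) cell_vc)
  moreover have "raw ([g2] \<lhd> cinv s2) = g2 \<triangleleft> RW \<C> u2 h2 f2 t2 (Inv2 \<C> \<sigma>2) t4"
    using s2 RW2(2) F(8) u(2) T by (simp add: raw_simps raw_inv)
  moreover have "raw (b \<rhd> [?H2]) = RW \<C> g1 u1 g2 u2 \<beta> (h2 \<star> t4)"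
    using u F(7,8) T by (simp add: raw_simps RW_eq)
  moreover have "raw ([g1, u1] \<lhd> d) = g1 \<triangleleft> u1 \<triangleleft> \<delta>"
    using d u F(7) T by (simp add: raw_simps)
  moreover have "raw ([g1] \<lhd> s1) = g1 \<triangleleft> RW \<C> f1 t1 u1 h1 \<sigma>1 t3"
    using s1 F(7) u(1) 1(3) T by (simp add: raw_simps)
  ultimately have raw_\<xi>: "raw \<xi> = (g2 \<triangleleft> RW \<C> u2 h2 f2 t2 (Inv2 \<C> \<sigma>2) t4) \<bullet> RW \<C> g1 u1 g2 u2 \<beta> (h2 \<star> t4)
      \<bullet> (g1 \<triangleleft> u1 \<triangleleft> \<delta>) \<bullet> (g1 \<triangleleft> RW \<C> f1 t1 u1 h1 \<sigma>1 t3)"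
    by simp
  have wp: "cell_in ([w] \<lhd> p) [w, w1, ?T1] [w, w2, ?T2]" "raw ([w] \<lhd> p) = w \<triangleleft> \<phi>"
    using p F(1) 1(1) 2(1) T by (simp_all add: raw_simps)
  have raw_conj: "raw ((pack [y, q] \<rhd> [t]) \<odot> c \<odot> cinv (pack [x, n] \<rhd> [s]))
      = Inv2 \<C> (Assoc \<C> y q t) \<bullet> raw c \<bullet> Assoc \<C> x n s"
    if "hom [y] M N" "hom [q] L M" "hom [t] K L" "hom [x] M' N" "hom [n] L' M'" "hom [s] K L'"
        "cell_in c [x, n, s] [y, q, t]" for x n s y q t c M N L K M' L'
  proof -
    have "cell ((pack [y, q] \<rhd> [t]) \<odot> c \<odot> cinv (pack [x, n] \<rhd> [s]))"
      using that by simp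
    then have "raw ((pack [y, q] \<rhd> [t]) \<odot> c \<odot> cinv (pack [x, n] \<rhd> [s]))
        = raw (pack [y, q] \<rhd> [t]) \<bullet> raw c \<bullet> raw (cinv (pack [x, n] \<rhd> [s]))"
      by (simp only: raw_simps(1) cell_vc)
    then show ?thesis
      using raw_pack_rw [OF that(1-3)] raw_pack_rw_cinv [OF that(4-6)] by simp
  qed
  have ind: "induced_rep \<C> CW (P, w, f) (B1, v1, g1) (B2, v2, g2) (B3, u1, u2, \<alpha>, \<beta>) S
      = (D5, ?T1, ?T2, raw ((pack [w, w2] \<rhd> [?T2]) \<odot> ([w] \<lhd> p) \<odot> cinv (pack [w, w1] \<rhd> [?T1])),
          raw ((pack [g2, f2] \<rhd> [?T2]) \<odot> \<xi> \<odot> cinv (pack [g1, f1] \<rhd> [?T1])))"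
    unfolding raw_conj [OF F(1) 2(1) T(2) F(1) 1(1) T(1) wp(1)] raw_conj [OF F(8) 2(3) T(2) F(7)
        1(3) T(1) \<xi>_cell] wp(2) raw_\<xi> Seq
    by (simp add: CW)
  have "?T1 \<in> \<W>"
    using BF2 [of t3 D5 D3 t1 D1] S' by (simp add: Hom1_iff)
  then have W: "WW [w1, ?T1]"
    using WW_append [of "[w1]" "[?T1]"] 1(1,2) T by (simp add: WW_single)
  show ?thesis
    by (rule that [OF T(1,2,3) W p s1 S2 compat [unfolded a_def r1_def r2_def] \<xi>_def [unfolded
        b_def] ind])
qed

text \<open>\<open>whiskered_equiv\<close> compares the data over \<open>w1\<close> and
  \<open>[g1, f1]\<close>; whiskering by \<open>w\<close> and packing lead to the legs of
  \<open>frac_comp\<close>. The two sets of data may coincide, which yields membership in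
  \<open>frac_reps\<close>.\<close>

lemma induced_rep_equiv:
  assumes CW: "C_choices \<C> \<W> CW"
    and F: "F \<in> frac_hom \<C> \<W> A B" and G: "G1 \<in> frac_hom \<C> \<W> B C" "G2 \<in> frac_hom \<C> \<W> B C"
    and R: "(R, R') \<in> frac_equiv \<C> \<W> G1 G2"
    and S: "S \<in> F567 \<C> \<W> CW F G1 G2 R" "S' \<in> F567 \<C> \<W> CW F G1 G2 R'"
  shows "(induced_rep \<C> CW F G1 G2 R S, induced_rep \<C> CW F G1 G2 R' S') \<in> frac_equiv \<C> \<W> (frac_comp
      \<C> CW G1 F) (frac_comp \<C> CW G2 F)"
    "frac_comp \<C> CW G1 F \<in> frac_hom \<C> \<W> A C" "frac_comp \<C> CW G2 F \<in> frac_hom \<C> \<W> A C"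
proof -
  obtain P w f where Feq: "F = (P, w, f)" by (metis prod_cases3)
  obtain B1 v1 g1 where G1eq: "G1 = (B1, v1, g1)" by (metis prod_cases3)
  obtain B2 v2 g2 where G2eq: "G2 = (B2, v2, g2)" by (metis prod_cases3)
  obtain B3 u1 u2 \<alpha> \<beta> where Req: "R = (B3, u1, u2, \<alpha>, \<beta>)" by (metis prod_cases5)
  obtain B3' u1' u2' \<alpha>' \<beta>' where Req': "R' = (B3', u1', u2', \<alpha>', \<beta>')" by (metis prod_cases5)
  note eqs = Feq G1eq G2eq Req Req'
  obtain D1 w1 f1 \<rho>1 where CW1: "CW f v1 = (D1, w1, f1, \<rho>1)" by (metis prod_cases4)
  obtain D2 w2 f2 \<rho>2 where CW2: "CW f v2 = (D2, w2, f2, \<rho>2)" by (metis prod_cases4)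
  have h: "hom [w] P A" "w \<in> \<W>" "hom [f] P B" "hom [v1] B1 B" "v1 \<in> \<W>" "hom [v2] B2 B" "v2 \<in> \<W>"
      "hom [g1] B1 C" "hom [g2] B2 C"
    using F G unfolding eqs frac_hom_iff by auto
  have reps: "R \<in> frac_reps \<C> \<W> G1 G2" "R' \<in> frac_reps \<C> \<W> G1 G2"
    using R unfolding eqs by auto
  have 1: "hom [w1] D1 P" "w1 \<in> \<W>" "hom [f1] D1 B1" "iso_in ([f, w1], \<rho>1, [v1, f1]) [f, w1] [v1, f1]"
    using C_choices_fillers [OF CW h(3,4,5) CW1] by auto
  have 2: "hom [w2] D2 P" "w2 \<in> \<W>" "hom [f2] D2 B2" "iso_in ([f, w2], \<rho>2, [v2, f2]) [f, w2] [v2, f2]"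
    using C_choices_fillers [OF CW h(3,6,7) CW2] by auto
  have WW: "WW [w, w1]" "WW [w, w2]"
    using WW_append [of "[w]" "[w1]"] WW_append [of "[w]" "[w2]"] h(1,2) 1(1,2) 2(1,2)
        by (simp_all add: WW_single)
  have comp: "frac_comp \<C> CW G1 F = (D1, w \<star> w1, g1 \<star> f1)" "frac_comp \<C> CW G2 F = (D2, w \<star> w2, g2 \<star> f2)"
    unfolding eqs by (simp_all add: CW1 CW2)
  show fh: "frac_comp \<C> CW G1 F \<in> frac_hom \<C> \<W> A C" "frac_comp \<C> CW G2 F \<in> frac_hom \<C> \<W> A C"
    unfolding comp frac_hom_iff using WW h 1(1,3) 2(1,3) by (simp_all add: WW_def)
  obtain X T1 T2 H p S1 S2 \<xi> where T: "hom [T1] X D1" "hom [T2] X D2" "hom [H] X B3" "WW [w1, T1]"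
    "iso_in p [w1, T1] [w2, T2]" "iso_in S1 [f1, T1] [u1, H]" "iso_in S2 [f2, T2] [u2, H]"
    "(([v1, u1], \<alpha>, [v2, u2]) \<rhd> [H]) \<odot> ([v1] \<lhd> S1) \<odot> (([f, w1], \<rho>1, [v1, f1]) \<rhd> [T1])
        = ([v2] \<lhd> S2) \<odot> (([f, w2], \<rho>2, [v2, f2]) \<rhd> [T2]) \<odot> ([f] \<lhd> p)"
    "\<xi> = ([g2] \<lhd> cinv S2) \<odot> (([g1, u1], \<beta>, [g2, u2]) \<rhd> [H]) \<odot> ([g1] \<lhd> S1)"
    "induced_rep \<C> CW (P, w, f) (B1, v1, g1) (B2, v2, g2) (B3, u1, u2, \<alpha>, \<beta>) S
      = (X, T1, T2, raw ((pack [w, w2] \<rhd> [T2]) \<odot> ([w] \<lhd> p) \<odot> cinv (pack [w, w1] \<rhd> [T1])),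
          raw ((pack [g2, f2] \<rhd> [T2]) \<odot> \<xi> \<odot> cinv (pack [g1, f1] \<rhd> [T1])))"
    by (rule induced_rep_path [OF CW CW1 CW2 h(1,3-9) reps(1) [unfolded eqs] S(1) [unfolded eqs]])
  obtain X' T1' T2' H' p' S1' S2' \<xi>' where T': "hom [T1'] X' D1" "hom [T2'] X' D2" "hom [H'] X' B3'"
      "WW [w1, T1']"
    "iso_in p' [w1, T1'] [w2, T2']" "iso_in S1' [f1, T1'] [u1', H']" "iso_in S2' [f2, T2'] [u2', H']"
    "(([v1, u1'], \<alpha>', [v2, u2']) \<rhd> [H']) \<odot> ([v1] \<lhd> S1') \<odot> (([f, w1], \<rho>1, [v1, f1]) \<rhd> [T1'])
        = ([v2] \<lhd> S2') \<odot> (([f, w2], \<rho>2, [v2, f2]) \<rhd> [T2']) \<odot> ([f] \<lhd> p')"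
    "\<xi>' = ([g2] \<lhd> cinv S2') \<odot> (([g1, u1'], \<beta>', [g2, u2']) \<rhd> [H']) \<odot> ([g1] \<lhd> S1')"
    "induced_rep \<C> CW (P, w, f) (B1, v1, g1) (B2, v2, g2) (B3', u1', u2', \<alpha>', \<beta>') S'
      = (X', T1', T2', raw ((pack [w, w2] \<rhd> [T2']) \<odot> ([w] \<lhd> p') \<odot> cinv (pack [w, w1] \<rhd> [T1'])),
          raw ((pack [g2, f2] \<rhd> [T2']) \<odot> \<xi>' \<odot> cinv (pack [g1, f1] \<rhd> [T1'])))"
    by (rule induced_rep_path [OF CW CW1 CW2 h(1,3-9) reps(2) [unfolded eqs] S(2) [unfolded eqs]])
  let ?a = "([v1, u1], \<alpha>, [v2, u2])" and ?b = "([g1, u1], \<beta>, [g2, u2])" and ?a' =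
      "([v1, u1'], \<alpha>', [v2, u2'])" and ?b' = "([g1, u1'], \<beta>', [g2, u2'])"
  have u: "hom [u1] B3 B1" "hom [u2] B3 B2" "WW [v1, u1]" "iso_in ?a [v1, u1] [v2, u2]"
      "cell_in ?b [g1, u1] [g2, u2]"
    using reps(1) h unfolding eqs by (auto simp: Hom1_iff Hom2_iff Iso2_iff isoc_def cell_def WW_def)
  have u': "hom [u1'] B3' B1" "hom [u2'] B3' B2" "WW [v1, u1']" "iso_in ?a' [v1, u1'] [v2, u2']"
      "cell_in ?b' [g1, u1'] [g2, u2']"
    using reps(2) h unfolding eqs by (auto simp: Hom1_iff Hom2_iff Iso2_iff isoc_def cell_def WW_def)
  have "path_equiv [v1] [g1] [v2] [g2] [u1] [u2] ?a ?b [u1'] [u2'] ?a' ?b'"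
    using frac_equiv_iff [OF h(4,6,8,9) reps [unfolded eqs]] R unfolding eqs by simp
  then obtain z z' t1 t2 Q where z: "hom z Q B3" "hom z' Q B3'" "iso_in t1 ([u1'] @ z') ([u1] @ z)"
      "iso_in t2 ([u2] @ z) ([u2'] @ z')"
     "WW ([v1] @ [u1] @ z)" "([v2] \<lhd> t2) \<odot> (?a \<rhd> z) \<odot> ([v1] \<lhd> t1) = ?a' \<rhd> z'"
         "([g2] \<lhd> t2) \<odot> (?b \<rhd> z) \<odot> ([g1] \<lhd> t1) = ?b' \<rhd> z'"
    unfolding path_equiv_def using u(1) u'(1) by auto
  have cells: "iso_in ([f, w1], \<rho>1, [v1, f1]) ([f] @ [w1]) ([v1] @ [f1])"
      "iso_in ([f, w2], \<rho>2, [v2, f2]) ([f] @ [w2]) ([v2] @ [f2])"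
      "iso_in ?a ([v1] @ [u1]) ([v2] @ [u2])" "cell_in ?b ([g1] @ [u1]) ([g2] @ [u2])"
      "iso_in ?a' ([v1] @ [u1']) ([v2] @ [u2'])" "cell_in ?b' ([g1] @ [u1']) ([g2] @ [u2'])"
      "iso_in p ([w1] @ [T1]) ([w2] @ [T2])" "iso_in S1 ([f1] @ [T1]) ([u1] @ [H])"
          "iso_in S2 ([f2] @ [T2]) ([u2] @ [H])"
      "iso_in p' ([w1] @ [T1']) ([w2] @ [T2'])" "iso_in S1' ([f1] @ [T1']) ([u1'] @ [H'])"
          "iso_in S2' ([f2] @ [T2']) ([u2'] @ [H'])"
    unfolding append_Cons append_Nil by (fact 1 2 u u' T T')+
  have W: "WW [w1]" "WW [w2]" "WW [v1]" "WW [v2]" "WW ([v1] @ [u1])" "WW ([v1] @ [u1'])"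
      "WW ([w1] @ [T1])" "WW ([w1] @ [T1'])"
    using h(5,7) 1(2) 2(2) u(3) u'(3) T(4) T'(4) by (simp_all add: WW_single)
  have "path_equiv [w1] ([g1] @ [f1]) [w2] ([g2] @ [f2]) [T1] [T2] p (([g2] \<lhd> cinv S2) \<odot> (?b \<rhd> [H])
      \<odot> ([g1] \<lhd> S1))
     [T1'] [T2'] p' (([g2] \<lhd> cinv S2') \<odot> (?b' \<rhd> [H']) \<odot> ([g1] \<lhd> S1'))"
    by (rule whiskered_equiv [OF h(3,4,6,8,9) 1(1) 2(1) 1(3) 2(3) u(1,2) u'(1,2) z(1,2) T(1-3) T'(1-3)
        cells(1-6) z(3,4) cells(7-12) z(6,7) T(8) T'(8) W(1-6) z(5) W(7,8)])
  then have E1: "path_equiv [w1] [g1, f1] [w2] [g2, f2] [T1] [T2] p \<xi> [T1'] [T2'] p' \<xi>'"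
    using T(9) T'(9) by simp
  have \<xi>: "cell_in \<xi> [g1, f1, T1] [g2, f2, T2]" "cell_in \<xi>' [g1, f1, T1'] [g2, f2, T2']"
    unfolding T(9) T'(9) using h 1 2 u u' T(1-7) T'(1-7) by simp_all
  have rep: "path_rep [w1] [g1, f1] [w2] [g2, f2] [T1] [T2] p \<xi>"
      "path_rep [w1] [g1, f1] [w2] [g2, f2] [T1'] [T2'] p' \<xi>'"
    unfolding path_rep_def using h 1(1,3) 2(1,3) T(1-5) T'(1-5) \<xi> by auto
  have rep': "path_rep [w, w1] [g1, f1] [w, w2] [g2, f2] [T1] [T2] ([w] \<lhd> p) \<xi>"
      "path_rep [w, w1] [g1, f1] [w, w2] [g2, f2] [T1'] [T2'] ([w] \<lhd> p') \<xi>'"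
    using path_rep_precompose [OF rep(1), of "[w]"] path_rep_precompose [OF rep(2), of "[w]"] h(1,2)
        1(1) by (simp_all add: WW_single)
  have E2: "path_equiv [w, w1] [g1, f1] [w, w2] [g2, f2] [T1] [T2] ([w] \<lhd> p) \<xi> [T1'] [T2'] ([w] \<lhd>
      p') \<xi>'"
    using path_equiv_precompose [OF E1, of "[w]" D1 P A X] h(1,2) 1(1) T(1) by (simp add: WW_single)
  have k: "iso_in (pack [w, w1]) [w, w1] [w \<star> w1]" "iso_in (pack [w, w2]) [w, w2] [w \<star> w2]"
      "iso_in (pack [g1, f1]) [g1, f1] [g1 \<star> f1]" "iso_in (pack [g2, f2]) [g2, f2] [g2 \<star> f2]"
    using h 1(1,3) 2(1,3) by simp_all
  let ?p = "(pack [w, w2] \<rhd> [T2]) \<odot> ([w] \<lhd> p) \<odot> cinv (pack [w, w1] \<rhd> [T1])"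
  let ?p' = "(pack [w, w2] \<rhd> [T2']) \<odot> ([w] \<lhd> p') \<odot> cinv (pack [w, w1] \<rhd> [T1'])"
  let ?x = "(pack [g2, f2] \<rhd> [T2]) \<odot> \<xi> \<odot> cinv (pack [g1, f1] \<rhd> [T1])"
  let ?x' = "(pack [g2, f2] \<rhd> [T2']) \<odot> \<xi>' \<odot> cinv (pack [g1, f1] \<rhd> [T1'])"
  \<comment> \<open>The packed cells in the form of triples that \<open>frac_reps_iff\<close> and
    \<open>frac_equiv_iff\<close> speak about.\<close>
  have triple: "?p = ([w \<star> w1, T1], raw ?p, [w \<star> w2, T2])"
      "?p' = ([w \<star> w1, T1'], raw ?p', [w \<star> w2, T2'])"
    "?x = ([g1 \<star> f1, T1], raw ?x, [g2 \<star> f2, T2])" "?x' = ([g1 \<star> f1, T1'], raw ?x', [g2 \<star> f2, T2'])"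
    using h 1(1,3) 2(1,3) T(1-5) T'(1-5) \<xi> by (simp_all add: prod_eq_iff)
  note rep'' = path_rep_conjugate [OF rep'(1) k] path_rep_conjugate [OF rep'(2) k]
  note E3 = path_equiv_conjugate [OF E2 rep' k]
  have hc: "hom [w \<star> w1] D1 A" "hom [w \<star> w2] D2 A" "hom [g1 \<star> f1] D1 C" "hom [g2 \<star> f2] D2 C"
    using fh unfolding comp frac_hom_iff by simp_all
  have in_reps:
      "(X, T1, T2, raw ?p, raw ?x) \<in> frac_reps \<C> \<W> (D1, w \<star> w1, g1 \<star> f1) (D2, w \<star> w2, g2 \<star> f2)"
    "(X', T1', T2', raw ?p', raw ?x') \<in> frac_reps \<C> \<W> (D1, w \<star> w1, g1 \<star> f1) (D2, w \<star> w2, g2 \<star> f2)"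
    unfolding frac_reps_iff [OF hc] triple [symmetric] using rep'' T(1) T'(1) by simp_all
  show "(induced_rep \<C> CW F G1 G2 R S, induced_rep \<C> CW F G1 G2 R' S') \<in> frac_equiv \<C> \<W> (frac_comp \<C>
      CW G1 F) (frac_comp \<C> CW G2 F)"
    unfolding comp unfolding eqs T(10) T'(10) frac_equiv_iff [OF hc in_reps] triple [symmetric]
        by (rule E3)
qed

end

theorem proposition6p1:
  fixes \<C> :: "('o, 'm, 't, 'x) bicategory_data_scheme" (structure)
    and \<W> :: "'m set"
    and CW :: "'m \<Rightarrow> 'm \<Rightarrow> 'o \<times> 'm \<times> 'm \<times> 't"
    and DW :: "'m \<Rightarrow> 'm \<Rightarrow> 'm \<Rightarrow> 't \<Rightarrow> 'o \<times> 'm \<times> 't"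
    and F G1 G2 :: "('o, 'm) frac"
    and \<Delta> :: "('o, 'm, 't) frac_rep set"
    and R :: "('o, 'm, 't) frac_rep"
    and S :: "('o, 'm, 't) F_data"
  assumes "BF \<C> \<W>"
    and "C_choices \<C> \<W> CW"
    and "D_choices \<C> \<W> DW"
    and "F \<in> frac_hom \<C> \<W> A B"
    and "G1 \<in> frac_hom \<C> \<W> B E" and "G2 \<in> frac_hom \<C> \<W> B E"
    and "\<Delta> \<in> frac_2hom \<C> \<W> G1 G2"
    and "R \<in> \<Delta>"
    and "S \<in> F567 \<C> \<W> CW F G1 G2 R"
  shows "induced_rep \<C> CW F G1 G2 R S
           \<in> frac_reps \<C> \<W> (frac_comp \<C> CW G1 F) (frac_comp \<C> CW G2 F)
       \<and> frac_whisker \<C> \<W> CW DW G1 G2 \<Delta> F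
           = frac_class \<C> \<W> (frac_comp \<C> CW G1 F) (frac_comp \<C> CW G2 F)
               (induced_rep \<C> CW F G1 G2 R S)
       \<and> (\<forall>R'\<in>\<Delta>. \<forall>S'\<in>F567 \<C> \<W> CW F G1 G2 R'.
            frac_class \<C> \<W> (frac_comp \<C> CW G1 F) (frac_comp \<C> CW G2 F)
               (induced_rep \<C> CW F G1 G2 R' S')
            = frac_class \<C> \<W> (frac_comp \<C> CW G1 F) (frac_comp \<C> CW G2 F)
               (induced_rep \<C> CW F G1 G2 R S))"
proof -
  interpret BF \<C> \<W> by (rule assms(1))
  note ch = assms(2,3) and FG = assms(4-6)
  obtain r where r: "\<Delta> = frac_equiv \<C> \<W> G1 G2 `` {r}"
    using assms(7) unfolding frac_2hom_def by (rule quotientE)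
  \<comment> \<open>Both are related to the generator \<open>r\<close> of the class.\<close>
  have equiv: "(R1, R2) \<in> frac_equiv \<C> \<W> G1 G2" if "R1 \<in> \<Delta>" "R2 \<in> \<Delta>" for R1 R2
    using that unfolding r using frac_equiv_sym [OF FG(2,3)] frac_equiv_trans [OF FG(2,3)] by blast
  let ?cl = "\<lambda>R S. frac_class \<C> \<W> (frac_comp \<C> CW G1 F) (frac_comp \<C> CW G2 F) (induced_rep \<C> CW F G1
      G2 R S)"
  have same_class: "?cl R' S' = ?cl R S" if "R' \<in> \<Delta>" "S' \<in> F567 \<C> \<W> CW F G1 G2 R'" for R' S'
    using induced_rep_equiv [OF ch(1) FG equiv [OF that(1) assms(8)] that(2) assms(9)] frac_class_eq
        by blast
  have select: "select_F567 \<C> CW DW F G1 G2 R' \<in> F567 \<C> \<W> CW F G1 G2 R'" if "R' \<in> \<Delta>" for R'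
  proof -
    obtain P w f where F: "F = (P, w, f)" by (metis prod_cases3)
    obtain B1 v1 g1 where G1: "G1 = (B1, v1, g1)" by (metis prod_cases3)
    obtain B2 v2 g2 where G2: "G2 = (B2, v2, g2)" by (metis prod_cases3)
    obtain B3 u1 u2 \<alpha> \<beta> where R': "R' = (B3, u1, u2, \<alpha>, \<beta>)" by (metis prod_cases5)
    have "R' \<in> frac_reps \<C> \<W> G1 G2"
      using equiv [OF that that] unfolding G1 G2 R' by simp
    then show ?thesis
      using FG unfolding F G1 G2 R' frac_hom_iff by (intro select_F567_mem [OF ch]) auto
  qed
  \<comment> \<open>The index set \<Delta> contains \<open>R\<close>, and all members of the union
    are one and the same class.\<close>
  have "frac_whisker \<C> \<W> CW DW G1 G2 \<Delta> F = ?cl R S"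
    unfolding frac_whisker_def using same_class select assms(8) by blast
  \<comment> \<open>Membership is part of the relation \<open>frac_equiv\<close>, so comparing
    \<open>R\<close>, \<open>S\<close> with themselves suffices.\<close>
  moreover have
      "induced_rep \<C> CW F G1 G2 R S \<in> frac_reps \<C> \<W> (frac_comp \<C> CW G1 F) (frac_comp \<C> CW G2 F)"
    using induced_rep_equiv(1) [OF ch(1) FG equiv [OF assms(8,8)] assms(9,9)]
    by (cases "frac_comp \<C> CW G1 F"; cases "frac_comp \<C> CW G2 F"; cases
        "induced_rep \<C> CW F G1 G2 R S") auto
  ultimately show ?thesis
    using same_class by blast
qed

end
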